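(* Let the system be a register of $\log_2 D$ qubits (Hilbert space dimension $D$), let $\sigma$ be an unknown density operator on it, and let $t\in\mathbb{R}$. Given $n$ copies of $\sigma$, there is a quantum circuit, consisting of $\mathcal{O}(\log(D)\cdot n\log n)$ gates (single-qubit gates and controlled-Fredkin, i.e. controlled-controlled-SWAP, gates) acting on the system, the $n$ copies and ancillary qubits, which implements the unitary $e^{-i\sigma t}$ on the system, and likewise one (with an additional control qubit) which implements $|0\rangle\langle0|\otimes I+|1\rangle\langle1|\otimes e^{-i\sigma t}$, each with error $\mathcal{O}((t^2+1)/n)$ in trace distance.
   Context: The error is measured as the trace distance between the reduced output state of the system (and control qubit, in the controlled case) produced by the circuit and the output state of the ideal unitary. *)

theory Defs
  imports Complex_Main "Jordan_Normal_Form.Matrix"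
begin

definition adj :: "complex mat \<Rightarrow> complex mat" where
  "adj A = mat (dim_col A) (dim_row A) (\<lambda>(i,j). cnj (A $$ (j,i)))"

definition mtrace :: "complex mat \<Rightarrow> complex" where
  "mtrace A = (\<Sum>i<dim_row A. A $$ (i,i))"

definition psd :: "nat \<Rightarrow> complex mat \<Rightarrow> bool" where
  "psd d A \<longleftrightarrow> A \<in> carrier_mat d d \<and> adj A = A \<and>
     (\<forall>v. dim_vec v = d \<longrightarrow> 0 \<le> Re ((A *\<^sub>v v) \<bullet>c v))"

definition density :: "nat \<Rightarrow> complex mat \<Rightarrow> bool" where
  "density d \<rho> \<longleftrightarrow> psd d \<rho> \<and> mtrace \<rho> = 1"

definition unitary_mat :: "nat \<Rightarrow> complex mat \<Rightarrow> bool" where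
  "unitary_mat d U \<longleftrightarrow> U \<in> carrier_mat d d \<and> adj U * U = 1\<^sub>m d"

definition psd_sqrt :: "complex mat \<Rightarrow> complex mat" where
  "psd_sqrt A = (THE B. psd (dim_row A) B \<and> B * B = A)"

definition trace_norm :: "complex mat \<Rightarrow> real" where
  "trace_norm A = Re (mtrace (psd_sqrt (adj A * A)))"

definition trace_dist :: "complex mat \<Rightarrow> complex mat \<Rightarrow> real" where
  "trace_dist A B = trace_norm (A - B) / 2"

definition mat_exp :: "complex mat \<Rightarrow> complex mat" where
  "mat_exp A = mat (dim_row A) (dim_col A)
     (\<lambda>(i,j). \<Sum>k. (A ^\<^sub>m k) $$ (i,j) / of_nat (fact k))"

text \<open>Kronecker (tensor) product; the first factor acts on the leading qubits.\<close>
definition kron :: "complex mat \<Rightarrow> complex mat \<Rightarrow> complex mat" where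
  "kron A B = mat (dim_row A * dim_row B) (dim_col A * dim_col B)
     (\<lambda>(i,j). A $$ (i div dim_row B, j div dim_col B) * B $$ (i mod dim_row B, j mod dim_col B))"

primrec kpow :: "complex mat \<Rightarrow> nat \<Rightarrow> complex mat" where
  "kpow A 0 = 1\<^sub>m 1"
| "kpow A (Suc n) = kron A (kpow A n)"

definition ket0_proj :: "nat \<Rightarrow> complex mat" where
  "ket0_proj m = mat (2^m) (2^m) (\<lambda>(i,j). if i = 0 \<and> j = 0 then 1 else 0)"

definition proj1 :: "complex mat" where
  "proj1 = mat 2 2 (\<lambda>(i,j). if i = 1 \<and> j = 1 then 1 else 0)"

definition ptrace_right :: "nat \<Rightarrow> nat \<Rightarrow> complex mat \<Rightarrow> complex mat" where
  "ptrace_right d1 d2 M = mat d1 d1 (\<lambda>(i,j). \<Sum>k<d2. M $$ (i * d2 + k, j * d2 + k))"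

text \<open>Value of qubit j (qubit 0 = most significant) of basis index x in an N-qubit register.\<close>
definition qbit :: "nat \<Rightarrow> nat \<Rightarrow> nat \<Rightarrow> nat" where
  "qbit N x j = (x div 2 ^ (N - 1 - j)) mod 2"

datatype gate =
    Gate1 "complex mat" nat
  | CFredkin nat nat nat nat         \<comment> \<open>controls c1 c2, swap targets a b\<close>

fun wf_gate :: "nat \<Rightarrow> gate \<Rightarrow> bool" where
  "wf_gate N (Gate1 U j) \<longleftrightarrow> j < N \<and> unitary_mat 2 U"
| "wf_gate N (CFredkin c1 c2 a b) \<longleftrightarrow>
     c1 < N \<and> c2 < N \<and> a < N \<and> b < N \<and> distinct [c1, c2, a, b]"

fun gate_mat :: "nat \<Rightarrow> gate \<Rightarrow> complex mat" where
  "gate_mat N (Gate1 U j) = mat (2^N) (2^N) (\<lambda>(x,y).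
      if (\<forall>k<N. k \<noteq> j \<longrightarrow> qbit N x k = qbit N y k)
      then U $$ (qbit N x j, qbit N y j) else 0)"
| "gate_mat N (CFredkin c1 c2 a b) = mat (2^N) (2^N) (\<lambda>(x,y).
      if (\<forall>k<N. k \<noteq> a \<and> k \<noteq> b \<longrightarrow> qbit N x k = qbit N y k) \<and>
         (if qbit N y c1 = 1 \<and> qbit N y c2 = 1
          then qbit N x a = qbit N y b \<and> qbit N x b = qbit N y a
          else qbit N x a = qbit N y a \<and> qbit N x b = qbit N y b)
      then 1 else 0)"

fun circuit_mat :: "nat \<Rightarrow> gate list \<Rightarrow> complex mat" where
  "circuit_mat N [] = 1\<^sub>m (2^N)"
| "circuit_mat N (g # gs) = circuit_mat N gs * gate_mat N g"

definition wf_circuit :: "nat \<Rightarrow> gate list \<Rightarrow> bool" where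
  "wf_circuit N gs \<longleftrightarrow> list_all (wf_gate N) gs"

definition circuit_output :: "nat \<Rightarrow> nat \<Rightarrow> gate list \<Rightarrow> complex mat \<Rightarrow> complex mat" where
  "circuit_output k r gs \<rho>in =
     (let U = circuit_mat (k + r) gs in ptrace_right (2^k) (2^r) (U * \<rho>in * adj U))"

end

theory Submission
  imports Defs "Jordan_Normal_Form.Spectral_Radius" "HOL-Analysis.L2_Norm"
begin

text \<open>The system is partially swapped, by \<open>exp (-i\<delta> SWAP)\<close> with \<open>\<delta> = t / n\<close>, with one
  copy of \<open>\<sigma>\<close> after the other. Since the swap has eigenvalues \<open>1\<close> and \<open>-1\<close>, a partial swap is
  realised exactly by a rotation of an ancilla in state \<open>|+\<rangle>\<close> between two controlled swaps, that is
  by \<open>2q\<close> controlled Fredkin gates and two single-qubit gates; the ancilla is left unchanged and serves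
  all steps. The second control is the control qubit, or an ancilla in state \<open>|1\<rangle>\<close> in the uncontrolled
  case. This uses \<open>O(qn)\<close> gates, which is \<open>O(q n ln n)\<close> for \<open>n \<ge> 2\<close>.

  Tracing out the copy turns a partial swap into a channel that differs from conjugation by
  \<open>exp (-i\<delta>\<sigma>)\<close> by \<open>O(\<delta>\<^sup>2)\<close> in trace norm. Summing over the \<open>n\<close> steps gives an error \<open>O(t\<^sup>2/n)\<close>.

  Trace norms are estimated through the dual description: the trace norm of \<open>X\<close> is at most \<open>b\<close> as
  soon as \<open>|tr(WX)| \<le> b\<close> for all contractions \<open>W\<close>.\<close>


text \<open>One circuit has to serve every \<sigma> and every input state, so only \<delta> may
  enter the gates. The obstacle in the estimates is the trace norm itself: it is given through a
  definite description of a square root, for which even the triangle inequality is not evident. The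
  dual bound is closed under sums, scalar factors and multiplication by contractions, so the square
  root is met only once, in passing from the dual bound back to the norm. Functions of \<sigma> are
  compared in an eigenbasis of \<sigma>, where the error of one step becomes a bound on a scalar. Of
  the four products of amplitudes in a step, conjugation by cos \<delta> - i sin \<delta> \<sigma>
  matches all but the one with both factors swapped, which has size (sin \<delta>)^2. The 17 that
  recurs is 12 + 3 + 2 from one step, and exp 17 is the price of bounding a geometric growth
  linearly. Both claims share one proof, with the number \<open>b\<close> of control qubits as a
  parameter and \<open>B = 2^b\<close> values of the leading digit.\<close>

lemma mult_mat_index:
  assumes "A \<in> carrier_mat n m" "B \<in> carrier_mat m l" "i < n" "j < l"
  shows "(A * B) $$ (i,j) = (\<Sum>k<m. A $$ (i,k) * B $$ (k,j))"
  using assms by (auto simp: scalar_prod_def atLeast0LessThan intro!: sum.cong)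

subsection \<open>Adjoints and the spectral theorem\<close>

lemma mult_square_carrier [simp]:
  "A \<in> carrier_mat d d \<Longrightarrow> B \<in> carrier_mat d d \<Longrightarrow> A * B \<in> carrier_mat d d"
  by (rule mult_carrier_mat)

lemma adj_carrier [simp]: "A \<in> carrier_mat n m \<Longrightarrow> adj A \<in> carrier_mat m n"
  by (auto simp: adj_def)

lemma adj_index [simp]: "A \<in> carrier_mat n m \<Longrightarrow> i < m \<Longrightarrow> j < n \<Longrightarrow> adj A $$ (i,j) = cnj (A $$ (j,i))"
  by (auto simp: adj_def)

lemma adj_dims [simp]: "dim_row (adj A) = dim_col A" "dim_col (adj A) = dim_row A"
  by (auto simp: adj_def)

lemma adj_adj [simp]: "adj (adj A) = A"
  by (rule eq_matI) (auto simp: adj_def)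

lemma adj_one [simp]: "adj (1\<^sub>m n) = 1\<^sub>m n"
  by (rule eq_matI) (auto simp: adj_def)

lemma adj_mult:
  assumes "A \<in> carrier_mat n m" "B \<in> carrier_mat m l"
  shows "adj (A * B) = adj B * adj A"
proof (rule eq_matI)
  fix i j assume "i < dim_row (adj B * adj A)" "j < dim_col (adj B * adj A)"
  then have "i < l" "j < n" using assms by auto
  then show "adj (A * B) $$ (i, j) = (adj B * adj A) $$ (i, j)"
    using assms mult_mat_index[OF assms, of j i] mult_mat_index[of "adj B" l m "adj A" n i j]
    by (auto simp: adj_index[of _ n l] adj_index[of _ n m] adj_index[of _ m l] mult.commute intro!: sum.cong)
qed (use assms in auto)

lemma adj_eq_self_index:
  assumes "A \<in> carrier_mat d d" "adj A = A" "i < d" "j < d"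
  shows "A $$ (i,j) = cnj (A $$ (j,i))"
  using adj_index[OF assms(1,3,4)] assms(2) by simp

section \<open>Diagonal matrices and their conjugates by unitary matrices\<close>

definition diag :: "nat \<Rightarrow> (nat \<Rightarrow> complex) \<Rightarrow> complex mat" where
  "diag d p = mat d d (\<lambda>(i,j). if i = j then p i else 0)"

lemma diag_carrier [simp]: "diag d p \<in> carrier_mat d d"
  by (simp add: diag_def)

lemma diag_index [simp]: "i < d \<Longrightarrow> j < d \<Longrightarrow> diag d p $$ (i,j) = (if i = j then p i else 0)"
  by (simp add: diag_def)

lemma adj_diag: "adj (diag d p) = diag d (\<lambda>i. cnj (p i))"
  by (rule eq_matI) (auto simp: adj_def diag_def)

lemma diag_mult: "diag d p * diag d q = diag d (\<lambda>i. p i * q i)"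
proof (rule eq_matI)
  fix i j assume "i < dim_row (diag d (\<lambda>i. p i * q i))" "j < dim_col (diag d (\<lambda>i. p i * q i))"
  then have ij: "i < d" "j < d" by (auto simp: diag_def)
  then have "(diag d p * diag d q) $$ (i,j) = (\<Sum>k<d. if i = k then p i * (if i = j then q i else 0) else 0)"
    by (subst mult_mat_index[of _ d d _ d], simp_all only: diag_carrier, intro sum.cong) auto
  also have "\<dots> = diag d (\<lambda>i. p i * q i) $$ (i,j)" using ij by simp
  finally show "(diag d p * diag d q) $$ (i,j) = diag d (\<lambda>i. p i * q i) $$ (i,j)" .
qed (auto simp: diag_def)

lemma diag_one: "diag d (\<lambda>_. 1) = 1\<^sub>m d"
  by (rule eq_matI) (auto simp: diag_def)

lemma conj_diag_index:
  assumes "U \<in> carrier_mat d d" "i < d" "j < d"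
  shows "(U * diag d p * adj U) $$ (i,j) = (\<Sum>l<d. U $$ (i,l) * p l * cnj (U $$ (j,l)))"
proof -
  have "(U * diag d p) $$ (i,l) = U $$ (i,l) * p l" if "l < d" for l
    using that assms by (subst mult_mat_index[of _ d d _ d]) (auto simp: if_distrib[of "\<lambda>x. _ * x"] cong: if_cong)
  then show ?thesis
    using assms by (subst mult_mat_index[of _ d d _ d]) auto
qed

text \<open>H is the reflection along u = v + ph e_0, with \<open>s\<close> equal to 2 / |u|^2.
  Taking \<open>ph\<close> as the phase of \<open>v 0\<close> makes the two contributions at index 0
  add up instead of cancelling, so |u|^2 = 2 (1 + r) cannot vanish. The price is the unit factor
  \<open>c\<close>, which is harmless for eigenvectors.\<close>

lemma householder:
  fixes v :: "nat \<Rightarrow> complex"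
  assumes d: "0 < d" and v: "(\<Sum>i<d. (cmod (v i))\<^sup>2) = 1"
  obtains H c where "H \<in> carrier_mat d d" "adj H = H" "H * H = 1\<^sub>m d" "cmod c = 1"
    "\<And>i. i < d \<Longrightarrow> H $$ (i,0) = c * v i"
proof -
  define r where "r = cmod (v 0)"
  \<comment> \<open>Any unit number works when \<open>v 0\<close> vanishes.\<close>
  define ph where "ph = (if v 0 = 0 then 1 else sgn (v 0))"
  have ph: "cmod ph = 1" by (simp add: ph_def norm_sgn)
  have v0: "v 0 = of_real r * ph"
    by (simp add: r_def ph_def sgn_div_norm scaleR_conv_of_real)
  have r0: "r \<ge> 0" by (simp add: r_def)
  have php: "ph * cnj ph = 1" using ph by (metis complex_norm_square of_real_1 one_power2)
  define u where "u i = v i + (if i = 0 then ph else 0)" for i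
  define s where "s = complex_of_real (1 / (1 + r))"
  have s1: "s * (1 + of_real r) = 1" 
    using r0 by (simp add: s_def) (metis add_nonneg_pos less_numeral_extra(1) less_numeral_extra(3) of_real_1 of_real_add of_real_eq_0_iff add.commute)
  define H where "H = mat d d (\<lambda>(i,j). (if i = j then 1 else 0) - s * u i * cnj (u j))"
  have H: "H \<in> carrier_mat d d" by (simp add: H_def)
  have vv: "(\<Sum>i<d. v i * cnj (v i)) = 1"
  proof -
    have "(\<Sum>i<d. v i * cnj (v i)) = (\<Sum>i<d. complex_of_real ((cmod (v i))\<^sup>2))"
      by (rule sum.cong) (auto simp: complex_norm_square simp del: of_real_power)
    also have "\<dots> = 1" using v by (metis of_real_1 of_real_sum)
    finally show ?thesis .
  qed
  have uu: "(\<Sum>i<d. cnj (u i) * u i) = 2 * (1 + of_real r)"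
  proof -
    have "(\<Sum>i<d. cnj (u i) * u i) = (\<Sum>i<d. v i * cnj (v i) + (if i = 0 then ph * cnj (v 0) + cnj ph * v 0 + ph * cnj ph else 0))"
      by (rule sum.cong) (auto simp: u_def algebra_simps)
    also have "\<dots> = 1 + (ph * cnj (v 0) + cnj ph * v 0 + ph * cnj ph)"
      using d by (simp add: sum.distrib vv)
    also have "\<dots> = 2 * (1 + of_real r)"
      using php by (simp add: v0 algebra_simps)
    finally show ?thesis .
  qed
  have "adj H = H"
    by (rule eq_matI) (auto simp: H_def adj_def s_def algebra_simps)
  moreover have "H * H = 1\<^sub>m d"
  proof (rule eq_matI)
    fix i j assume "i < dim_row (1\<^sub>m d :: complex mat)" "j < dim_col (1\<^sub>m d :: complex mat)"
    then have ij: "i < d" "j < d" by auto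
    have "(H * H) $$ (i,j) = (\<Sum>k<d. ((if i = k then 1 else 0) - s * u i * cnj (u k)) * ((if k = j then 1 else 0) - s * u k * cnj (u j)))"
      using ij by (subst mult_mat_index[OF H H]) (auto simp: H_def)
    also have "\<dots> = (\<Sum>k<d. (if i = k then (if i = j then 1 else 0) - s * u i * cnj (u j) else 0)
        - (if k = j then s * u i * cnj (u j) else 0) + s * s * u i * cnj (u j) * (cnj (u k) * u k))"
      by (rule sum.cong) (auto simp: algebra_simps)
    also have "\<dots> = (if i = j then 1 else 0) - 2 * s * u i * cnj (u j) + s * s * u i * cnj (u j) * (2 * (1 + of_real r))"
      using ij by (simp add: sum.distrib sum_subtractf sum_distrib_left[symmetric] uu)
    also have "\<dots> = (if i = j then 1 else 0) - 2 * s * u i * cnj (u j) + 2 * s * u i * cnj (u j) * (s * (1 + of_real r))"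
      by (simp only: mult_ac)
    also have "\<dots> = (if i = j then 1 else 0)" by (simp only: s1) simp
    finally show "(H * H) $$ (i,j) = 1\<^sub>m d $$ (i,j)" using ij by simp
  qed (use H in auto)
  moreover have "H $$ (i,0) = (- cnj ph) * v i" if "i < d" for i
  proof -
    have u0: "cnj (u 0) = cnj ph * (1 + of_real r)" by (simp add: u_def v0 algebra_simps)
    have "H $$ (i,0) = (if i = 0 then 1 else 0) - (s * (1 + of_real r)) * u i * cnj ph"
      using that d by (simp add: H_def u0 mult_ac)
    also have "\<dots> = - cnj ph * v i" using php by (simp only: s1) (simp add: u_def algebra_simps)
    finally show ?thesis .
  qed
  ultimately show ?thesis using that[of H "- cnj ph"] H ph by auto
qed

lemma hermitian_eigenvector:
  assumes A: "A \<in> carrier_mat d d" and d: "0 < d"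
  obtains v k where "(\<Sum>i<d. (cmod (v i))\<^sup>2) = 1" "\<And>i. i < d \<Longrightarrow> (\<Sum>j<d. A $$ (i,j) * v j) = k * v i"
proof -
  obtain k w where w: "w \<in> carrier_vec d" "w \<noteq> 0\<^sub>v d" "A *\<^sub>v w = k \<cdot>\<^sub>v w"
    using spectrum_non_empty[OF A d] A unfolding spectrum_def eigenvalue_def eigenvector_def by auto
  define S where "S = (\<Sum>i<d. (cmod (w $ i))\<^sup>2)"
  obtain i0 where i0: "i0 < d" "w $ i0 \<noteq> 0" using w by (metis carrier_vecD eq_vecI index_zero_vec(1) index_zero_vec(2))
  have S: "S > 0" unfolding S_def using i0 by (intro sum_pos2[of _ i0]) auto
  define v where "v i = w $ i / of_real (sqrt S)" for i
  have "(\<Sum>i<d. (cmod (v i))\<^sup>2) = (\<Sum>i<d. (cmod (w $ i))\<^sup>2 / S)"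
    using S by (intro sum.cong) (auto simp: v_def norm_divide power_divide)
  also have "\<dots> = 1" using S by (simp add: sum_divide_distrib[symmetric] S_def[symmetric])
  finally have 1: "(\<Sum>i<d. (cmod (v i))\<^sup>2) = 1" .
  have "(\<Sum>j<d. A $$ (i,j) * v j) = k * v i" if "i < d" for i
  proof -
    have "(\<Sum>j<d. A $$ (i,j) * w $ j) = (A *\<^sub>v w) $ i"
      using that A w(1) by (auto simp: scalar_prod_def atLeast0LessThan intro!: sum.cong)
    also have "\<dots> = k * w $ i" unfolding w(3) using that w(1) by simp
    finally have "(\<Sum>j<d. A $$ (i,j) * w $ j) = k * w $ i" .
    then show ?thesis by (simp add: v_def sum_divide_distrib[symmetric] del: index_mult_mat_vec)
  qed
  with 1 show ?thesis using that by blast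
qed

lemma unitary_left_right:
  fixes U :: "complex mat"
  assumes "U \<in> carrier_mat d d" "adj U * U = 1\<^sub>m d"
  shows "U * adj U = 1\<^sub>m d"
  using mat_mult_left_right_inverse[of "adj U" d U] assms by auto

text \<open>Deflation: the reflection H carries the first basis vector to an eigenvector up to a
  phase, so H A H splits into a 1 x 1 block and a hermitian block of size d, which is diagonalised
  by induction. The eigenvalue split off is real because it is a diagonal entry of a hermitian
  matrix.\<close>

lemma spectral_theorem:
  assumes "A \<in> carrier_mat d d" "adj A = A"
  shows "\<exists>U (p::nat \<Rightarrow> real). U \<in> carrier_mat d d \<and> adj U * U = 1\<^sub>m d \<and> U * adj U = 1\<^sub>m d
    \<and> A = U * diag d (\<lambda>i. of_real (p i)) * adj U"
  using assms
proof (induction d arbitrary: A)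
  case 0
  then show ?case by (intro exI[of _ "1\<^sub>m 0"] exI[of _ "\<lambda>_. 0"]) (auto intro!: eq_matI)
next
  case (Suc d)
  let ?n = "Suc d"
  note A = Suc.prems(1)
  obtain v k where v: "(\<Sum>i<?n. (cmod (v i))\<^sup>2) = 1"
      and ev: "\<And>i. i < ?n \<Longrightarrow> (\<Sum>j<?n. A $$ (i,j) * v j) = k * v i"
    using hermitian_eigenvector[OF A] by blast
  obtain H c where H: "H \<in> carrier_mat ?n ?n" "adj H = H" "H * H = 1\<^sub>m ?n" "cmod c = 1"
    and Hv: "\<And>i. i < ?n \<Longrightarrow> H $$ (i,0) = c * v i"
    using householder[OF _ v] by blast
  define B where "B = H * A * H"
  have B: "B \<in> carrier_mat ?n ?n" using H A by (auto simp: B_def)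
  have Bh: "adj B = B" using H A Suc.prems(2)
    by (simp add: B_def adj_mult[of _ ?n ?n _ ?n] assoc_mult_mat[of _ ?n ?n _ ?n _ ?n])
  have AH: "(A * H) $$ (i,0) = k * H $$ (i,0)" if "i < ?n" for i
  proof -
    have "(A * H) $$ (i,0) = c * (\<Sum>j<?n. A $$ (i,j) * v j)"
      using that by (subst mult_mat_index[OF A H(1)])
        (auto simp: Hv mult_ac sum_distrib_left simp del: sum.lessThan_Suc intro!: sum.cong)
    then show ?thesis using ev[OF that] Hv[OF that] by simp
  qed
  have B0: "B $$ (i,0) = (if i = 0 then k else 0)" if "i < ?n" for i
  proof -
    have AHc: "A * H \<in> carrier_mat ?n ?n" using A H(1) by auto
    have "B $$ (i,0) = (H * (A * H)) $$ (i,0)" unfolding B_def using assoc_mult_mat[OF H(1) A H(1)] by metis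
    also have "\<dots> = (\<Sum>j<?n. H $$ (i,j) * (A * H) $$ (j,0))"
      by (rule mult_mat_index[OF H(1) AHc that]) simp
    also have "\<dots> = (\<Sum>j<?n. k * (H $$ (i,j) * H $$ (j,0)))"
      by (rule sum.cong) (use AH in \<open>simp_all only: lessThan_iff mult.left_commute\<close>)
    also have "\<dots> = k * (H * H) $$ (i,0)"
      using mult_mat_index[OF H(1) H(1) that, of 0] by (simp only: sum_distrib_left zero_less_Suc)
    finally show ?thesis using that by (simp add: H(3))
  qed
  \<comment> \<open>Hermiticity transfers the zeros of column 0 to row 0, so B is block
    diagonal.\<close>
  have B0': "B $$ (0,i) = (if i = 0 then k else 0)" if "i < ?n" for i
  proof (cases "i = 0")
    case True
    then show ?thesis using B0[of 0] by simp
  next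
    case False
    then have "B $$ (i,0) = 0" using B0[OF that] by simp
    then show ?thesis using adj_eq_self_index[OF B Bh zero_less_Suc that] False by simp
  qed
  have "Im k = 0"
  proof -
    have "k = cnj k"
      using adj_eq_self_index[OF B Bh, of 0 0] B0[of 0] by (metis zero_less_Suc)
    then have "Im k = - Im k" by (metis cnj.simps(2))
    then show ?thesis by linarith
  qed
  then have kr: "of_real (Re k) = k" by (simp add: complex_eq_iff)
  define A3 where "A3 = mat d d (\<lambda>(i,j). B $$ (Suc i, Suc j))"
  have A3: "A3 \<in> carrier_mat d d" by (simp add: A3_def)
  have "adj A3 = A3"
  proof (rule eq_matI)
    fix i j assume "i < dim_row A3" "j < dim_col A3"
    then have ij: "i < d" "j < d" by (auto simp: A3_def)
    have "adj A3 $$ (i,j) = cnj (B $$ (Suc j, Suc i))" using ij by (simp add: adj_index[OF A3]) (simp add: A3_def)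
    also have "\<dots> = B $$ (Suc i, Suc j)" by (rule adj_eq_self_index[OF B Bh, symmetric]) (use ij in auto)
    also have "\<dots> = A3 $$ (i,j)" using ij by (simp add: A3_def)
    finally show "adj A3 $$ (i,j) = A3 $$ (i,j)" .
  qed (auto simp: A3_def)
  from Suc.IH[OF A3 this] obtain U3 p3 where U3: "U3 \<in> carrier_mat d d" "adj U3 * U3 = 1\<^sub>m d" "U3 * adj U3 = 1\<^sub>m d"
     and A3e: "A3 = U3 * diag d (\<lambda>i. of_real (p3 i)) * adj U3" by blast
  \<comment> \<open>\<open>T\<close> is the direct sum of the 1 x 1 identity and
    \<open>U3\<close>.\<close>
  define T where "T = mat ?n ?n (\<lambda>(i,j). case i of 0 \<Rightarrow> (if j = 0 then 1 else 0) | Suc i' \<Rightarrow> (case j of 0 \<Rightarrow> 0 | Suc j' \<Rightarrow> U3 $$ (i',j')))"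
  define p where "p i = (case i of 0 \<Rightarrow> Re k | Suc i' \<Rightarrow> p3 i')" for i
  have T: "T \<in> carrier_mat ?n ?n" by (simp add: T_def)
  have T0: "T $$ (0,0) = 1" "\<And>i. i < d \<Longrightarrow> T $$ (Suc i, 0) = 0" "\<And>i. i < d \<Longrightarrow> T $$ (0, Suc i) = 0"
     "\<And>i j. i < d \<Longrightarrow> j < d \<Longrightarrow> T $$ (Suc i, Suc j) = U3 $$ (i,j)"
    by (auto simp: T_def)
  have TT: "adj T * T = 1\<^sub>m ?n"
  proof (rule eq_matI)
    fix i j assume "i < dim_row (1\<^sub>m ?n :: complex mat)" "j < dim_col (1\<^sub>m ?n :: complex mat)"
    then have ij: "i < ?n" "j < ?n" by auto
    have "(adj U3 * U3) $$ (i', j') = (if i' = j' then 1 else 0)" if "i' < d" "j' < d" for i' j'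
      using that by (simp add: U3)
    then have *: "(\<Sum>l<d. cnj (U3 $$ (l,i')) * U3 $$ (l,j')) = (if i' = j' then 1 else 0)" if "i' < d" "j' < d" for i' j'
      using mult_mat_index[of "adj U3" d d U3 d i' j'] U3 that by auto
    have "(adj T * T) $$ (i,j) = (\<Sum>l<?n. cnj (T $$ (l,i)) * T $$ (l,j))"
      using ij T by (subst mult_mat_index[of _ ?n ?n _ ?n]) (auto simp: adj_index[OF T] simp del: sum.lessThan_Suc)
    also have "\<dots> = (if i = j then 1 else 0)"
      unfolding sum.lessThan_Suc_shift
      using ij * by (cases i; cases j) (auto simp: T0)
    finally show "(adj T * T) $$ (i,j) = 1\<^sub>m ?n $$ (i,j)" using ij by simp
  qed (use T in auto)
  have BT: "B = T * diag ?n (\<lambda>i. of_real (p i)) * adj T"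
  proof (rule eq_matI)
    fix i j assume "i < dim_row (T * diag ?n (\<lambda>i. of_real (p i)) * adj T)" "j < dim_col (T * diag ?n (\<lambda>i. of_real (p i)) * adj T)"
    then have ij: "i < ?n" "j < ?n" using T by auto
    have *: "(\<Sum>l<d. U3 $$ (i',l) * of_real (p3 l) * cnj (U3 $$ (j',l))) = B $$ (Suc i', Suc j')" if "i' < d" "j' < d" for i' j'
      using conj_diag_index[OF U3(1) that, of "\<lambda>i. of_real (p3 i)"] that unfolding A3e[symmetric] by (simp add: A3_def)
    have "(T * diag ?n (\<lambda>i. of_real (p i)) * adj T) $$ (i,j) = (\<Sum>l<?n. T $$ (i,l) * of_real (p l) * cnj (T $$ (j,l)))"
      by (rule conj_diag_index[OF T ij])
    also have "\<dots> = B $$ (i,j)"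
      unfolding sum.lessThan_Suc_shift
      using ij * B0[of i] B0'[of j] kr by (cases i; cases j) (auto simp: T0 p_def)
    finally show "B $$ (i,j) = (T * diag ?n (\<lambda>i. of_real (p i)) * adj T) $$ (i,j)" ..
  qed (use T B in auto)
  define U where "U = H * T"
  have U: "U \<in> carrier_mat ?n ?n" using H T by (auto simp: U_def)
  have "adj U * U = adj T * (H * H) * T" using H(1,2) T
    by (simp add: U_def adj_mult[of _ ?n ?n _ ?n] assoc_mult_mat[of _ ?n ?n _ ?n _ ?n])
  then have UU: "adj U * U = 1\<^sub>m ?n" using H T TT by simp
  have "A = (H * H) * A * (H * H)" using A H by simp
  also have "\<dots> = H * B * H" using A H(1) by (simp add: B_def assoc_mult_mat[of _ ?n ?n _ ?n _ ?n])
  also have "\<dots> = U * diag ?n (\<lambda>i. of_real (p i)) * adj U"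
    using H(1,2) T by (simp add: BT U_def adj_mult[of _ ?n ?n _ ?n] assoc_mult_mat[of _ ?n ?n _ ?n _ ?n])
  finally show ?case using U UU unitary_left_right[OF U UU] by blast
qed

subsection \<open>Operator bounds and trace norm bounds\<close>

lemma one_mult_square [simp]: "A \<in> carrier_mat d d \<Longrightarrow> 1\<^sub>m d * A = A" "A \<in> carrier_mat d d \<Longrightarrow> A * 1\<^sub>m d = A"
  for A :: "'a::semiring_1 mat"
  by (auto simp: left_mult_one_mat right_mult_one_mat)

definition vnorm :: "nat \<Rightarrow> (nat \<Rightarrow> complex) \<Rightarrow> real" where
  "vnorm d v = L2_set (\<lambda>i. cmod (v i)) {..<d}"

text \<open>Vectors are functions whose values from d on are ignored; restricting to a block or
  permuting the basis is then just composition with a map of indices.\<close>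

definition act :: "nat \<Rightarrow> complex mat \<Rightarrow> (nat \<Rightarrow> complex) \<Rightarrow> nat \<Rightarrow> complex" where
  "act d A v i = (\<Sum>j<d. A $$ (i,j) * v j)"

text \<open>The operator norm bound as an estimate of a bilinear form. Leaving out the conjugate on
  \<open>u\<close> changes nothing, since conjugation preserves \<open>vnorm\<close>. Sums and
  adjoints are read off from this form; \<open>op_boundI\<close> and \<open>op_boundD\<close>
  translate to vector norms, as products require.\<close>

definition op_bound :: "nat \<Rightarrow> complex mat \<Rightarrow> real \<Rightarrow> bool" where
  "op_bound d W w \<longleftrightarrow> W \<in> carrier_mat d d \<and> 0 \<le> w \<and>
     (\<forall>u v. cmod (\<Sum>i<d. u i * act d W v i) \<le> w * vnorm d u * vnorm d v)"

text \<open>The norm dual to the operator norm. Admitting every W with its bound w, rather than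
  contractions only, lets factors of X be moved onto the test matrix without rescaling.\<close>

definition tr_bound :: "nat \<Rightarrow> complex mat \<Rightarrow> real \<Rightarrow> bool" where
  "tr_bound d X b \<longleftrightarrow> X \<in> carrier_mat d d \<and> (\<forall>W w. op_bound d W w \<longrightarrow> cmod (mtrace (W * X)) \<le> w * b)"

lemma vnorm_nonneg [simp]: "0 \<le> vnorm d v"
  by (simp add: vnorm_def)

lemma vnorm_cong: "(\<And>i. i < d \<Longrightarrow> v i = w i) \<Longrightarrow> vnorm d v = vnorm d w"
  unfolding vnorm_def by (rule L2_set_cong) auto

lemma vnorm_cnj [simp]: "vnorm d (\<lambda>i. cnj (v i)) = vnorm d v"
  by (simp add: vnorm_def)

lemma vnorm_sq: "complex_of_real ((vnorm d v)\<^sup>2) = (\<Sum>i<d. cnj (v i) * v i)"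
proof -
  have "(vnorm d v)\<^sup>2 = (\<Sum>i<d. (cmod (v i))\<^sup>2)"
    by (simp add: vnorm_def L2_set_def sum_nonneg)
  then have "complex_of_real ((vnorm d v)\<^sup>2) = (\<Sum>i<d. complex_of_real ((cmod (v i))\<^sup>2))"
    by simp
  also have "\<dots> = (\<Sum>i<d. cnj (v i) * v i)"
    by (rule sum.cong) (auto simp only: complex_norm_square mult.commute)
  finally show ?thesis .
qed

lemma cauchy_schwarz: "cmod (\<Sum>i<d. u i * v i) \<le> vnorm d u * vnorm d v"
proof -
  have "cmod (\<Sum>i<d. u i * v i) \<le> (\<Sum>i<d. \<bar>cmod (u i)\<bar> * \<bar>cmod (v i)\<bar>)"
    by (rule order_trans[OF norm_sum]) (simp add: norm_mult)
  also have "\<dots> \<le> vnorm d u * vnorm d v" unfolding vnorm_def by (rule L2_set_mult_ineq)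
  finally show ?thesis .
qed

lemma act_mult:
  assumes "A \<in> carrier_mat d d" "B \<in> carrier_mat d d" "i < d"
  shows "act d (A * B) v i = act d A (act d B v) i"
proof -
  have "act d (A * B) v i = (\<Sum>j<d. \<Sum>k<d. A $$ (i,k) * (B $$ (k,j) * v j))"
    unfolding act_def using assms
    by (intro sum.cong refl) (simp add: mult_mat_index[OF assms(1,2)] sum_distrib_right mult.assoc del: index_mult_mat(1))
  also have "\<dots> = act d A (act d B v) i"
    unfolding act_def by (subst sum.swap) (simp add: sum_distrib_left)
  finally show ?thesis .
qed

lemma act_one: "i < d \<Longrightarrow> act d (1\<^sub>m d) v i = v i"
proof -
  assume "i < d"
  then have "act d (1\<^sub>m d) v i = (\<Sum>j<d. if i = j then v j else 0)"
    unfolding act_def by (intro sum.cong) auto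
  then show ?thesis using \<open>i < d\<close> by simp
qed

lemma act_add:
  assumes "A \<in> carrier_mat d d" "B \<in> carrier_mat d d" "i < d"
  shows "act d (A + B) v i = act d A v i + act d B v i"
  unfolding act_def using assms by (simp add: sum.distrib distrib_right)

lemma act_smult:
  assumes "A \<in> carrier_mat d d" "i < d"
  shows "act d (c \<cdot>\<^sub>m A) v i = c * act d A v i"
  unfolding act_def using assms by (simp add: sum_distrib_left mult.assoc)

lemma act_adj:
  assumes "A \<in> carrier_mat d d"
  shows "(\<Sum>i<d. cnj (act d A x i) * y i) = (\<Sum>j<d. cnj (x j) * act d (adj A) y j)"
proof -
  have "(\<Sum>i<d. cnj (act d A x i) * y i) = (\<Sum>i<d. \<Sum>j<d. cnj (x j) * (cnj (A $$ (i,j)) * y i))"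
    unfolding act_def by (simp add: sum_distrib_left sum_distrib_right mult_ac)
  also have "\<dots> = (\<Sum>j<d. cnj (x j) * act d (adj A) y j)"
    unfolding act_def using assms by (subst sum.swap) (simp add: sum_distrib_left)
  finally show ?thesis .
qed

lemma op_boundI:
  assumes W: "W \<in> carrier_mat d d" "0 \<le> w" and b: "\<And>v. vnorm d (act d W v) \<le> w * vnorm d v"
  shows "op_bound d W w"
  unfolding op_bound_def
proof (intro conjI allI W)
  fix u v
  have "cmod (\<Sum>i<d. u i * act d W v i) \<le> vnorm d u * vnorm d (act d W v)" by (rule cauchy_schwarz)
  also have "\<dots> \<le> vnorm d u * (w * vnorm d v)" by (intro mult_left_mono b) simp
  finally show "cmod (\<Sum>i<d. u i * act d W v i) \<le> w * vnorm d u * vnorm d v" by (simp add: mult_ac)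
qed

lemma op_bound_carrier: "op_bound d W w \<Longrightarrow> W \<in> carrier_mat d d"
  by (simp add: op_bound_def)

lemma op_bound_nonneg: "op_bound d W w \<Longrightarrow> 0 \<le> w"
  by (simp add: op_bound_def)

text \<open>The form is tested with the conjugate of W v itself, and one factor of its norm is
  cancelled.\<close>

lemma op_boundD:
  assumes "op_bound d W w"
  shows "vnorm d (act d W v) \<le> w * vnorm d v"
proof (cases "vnorm d (act d W v) = 0")
  case True
  then show ?thesis using op_bound_nonneg[OF assms] by simp
next
  case False
  have "(vnorm d (act d W v))\<^sup>2 = cmod (\<Sum>i<d. cnj (act d W v i) * act d W v i)"
    by (simp add: vnorm_sq[symmetric] norm_power)
  also have "\<dots> \<le> w * vnorm d (\<lambda>i. cnj (act d W v i)) * vnorm d v"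
    using assms by (simp add: op_bound_def del: vnorm_cnj)
  finally have "vnorm d (act d W v) * vnorm d (act d W v) \<le> vnorm d (act d W v) * (w * vnorm d v)"
    by (simp add: power2_eq_square mult_ac)
  moreover have "0 < vnorm d (act d W v)" using False vnorm_nonneg[of d "act d W v"] by linarith
  ultimately show ?thesis by (simp only: mult_le_cancel_left_pos)
qed

lemma op_bound_bound: "op_bound d W w \<Longrightarrow> cmod (\<Sum>i<d. u i * act d W v i) \<le> w * vnorm d u * vnorm d v"
  by (simp add: op_bound_def)

lemma op_bound_mono:
  assumes "op_bound d W w" "w \<le> w'"
  shows "op_bound d W w'"
proof (rule op_boundI)
  show "W \<in> carrier_mat d d" "0 \<le> w'" using assms op_bound_carrier op_bound_nonneg order_trans by blast+
  fix v
  show "vnorm d (act d W v) \<le> w' * vnorm d v"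
    using op_boundD[OF assms(1), of v] mult_right_mono[OF assms(2), of "vnorm d v"] by simp
qed

lemma op_bound_one: "op_bound d (1\<^sub>m d) 1"
proof (rule op_boundI)
  fix v show "vnorm d (act d (1\<^sub>m d) v) \<le> 1 * vnorm d v"
    using vnorm_cong[of d "act d (1\<^sub>m d) v" v] by (simp add: act_one)
qed auto

lemma op_bound_mult:
  assumes "op_bound d A a" "op_bound d B b"
  shows "op_bound d (A * B) (a * b)"
proof (rule op_boundI)
  note c = op_bound_carrier[OF assms(1)] op_bound_carrier[OF assms(2)]
  show "A * B \<in> carrier_mat d d" using c by simp
  show "0 \<le> a * b" using assms by (simp add: op_bound_nonneg)
  fix v
  have "vnorm d (act d (A * B) v) = vnorm d (act d A (act d B v))"
    by (rule vnorm_cong) (simp add: act_mult c)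
  also have "\<dots> \<le> a * vnorm d (act d B v)" by (rule op_boundD[OF assms(1)])
  also have "\<dots> \<le> a * (b * vnorm d v)" by (intro mult_left_mono op_boundD assms op_bound_nonneg[OF assms(1)])
  finally show "vnorm d (act d (A * B) v) \<le> a * b * vnorm d v" by (simp add: mult_ac)
qed

lemma op_bound_add:
  assumes "op_bound d A a" "op_bound d B b"
  shows "op_bound d (A + B) (a + b)"
  unfolding op_bound_def
proof (intro conjI allI)
  note c = op_bound_carrier[OF assms(1)] op_bound_carrier[OF assms(2)]
  show "A + B \<in> carrier_mat d d" using c by simp
  show "0 \<le> a + b" using assms by (simp add: op_bound_nonneg)
  fix u v
  have "(\<Sum>i<d. u i * act d (A + B) v i) = (\<Sum>i<d. u i * act d A v i) + (\<Sum>i<d. u i * act d B v i)"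
    by (simp add: act_add c distrib_left sum.distrib)
  also have "cmod \<dots> \<le> a * vnorm d u * vnorm d v + b * vnorm d u * vnorm d v"
    using assms by (intro order_trans[OF norm_triangle_ineq] add_mono) (auto simp: op_bound_def)
  finally show "cmod (\<Sum>i<d. u i * act d (A + B) v i) \<le> (a + b) * vnorm d u * vnorm d v"
    by (simp add: algebra_simps)
qed

lemma op_bound_adj:
  assumes "op_bound d A a"
  shows "op_bound d (adj A) a"
  unfolding op_bound_def
proof (intro conjI allI)
  note A = op_bound_carrier[OF assms]
  show "adj A \<in> carrier_mat d d" using A by simp
  show "0 \<le> a" using assms by (simp add: op_bound_nonneg)
  fix u v
  have "(\<Sum>i<d. u i * act d (adj A) v i) = (\<Sum>i<d. cnj (act d A (\<lambda>i. cnj (u i)) i) * v i)"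
    by (simp add: act_adj[OF A])
  also have "\<dots> = cnj (\<Sum>i<d. cnj (v i) * act d A (\<lambda>i. cnj (u i)) i)"
    by (simp add: mult.commute)
  also have "cmod \<dots> \<le> a * vnorm d (\<lambda>i. cnj (v i)) * vnorm d (\<lambda>i. cnj (u i))"
    unfolding complex_mod_cnj by (rule op_bound_bound[OF assms])
  finally show "cmod (\<Sum>i<d. u i * act d (adj A) v i) \<le> a * vnorm d u * vnorm d v"
    by (simp add: mult_ac)
qed

text \<open>The squared norm of Y v is the quadratic form of the Gram matrix at v. Isometries, and
  later the polar factor of a matrix, are bounded in this way.\<close>

lemma op_bound_gram:
  assumes Y: "Y \<in> carrier_mat d d" and g: "op_bound d (adj Y * Y) 1"
  shows "op_bound d Y 1"
proof (rule op_boundI)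
  fix v
  have "complex_of_real ((vnorm d (act d Y v))\<^sup>2) = (\<Sum>j<d. cnj (v j) * act d (adj Y) (act d Y v) j)"
    by (simp only: vnorm_sq act_adj[OF Y])
  also have "\<dots> = (\<Sum>j<d. cnj (v j) * act d (adj Y * Y) v j)"
    using Y by (intro sum.cong) (auto simp: act_mult)
  finally have "(vnorm d (act d Y v))\<^sup>2 = cmod (\<Sum>j<d. cnj (v j) * act d (adj Y * Y) v j)"
    by (metis norm_of_real abs_of_nonneg zero_le_power2)
  also have "\<dots> \<le> 1 * vnorm d (\<lambda>i. cnj (v i)) * vnorm d v" by (rule op_bound_bound[OF g])
  finally have "(vnorm d (act d Y v))\<^sup>2 \<le> (vnorm d v)\<^sup>2" by (simp add: power2_eq_square)
  then show "vnorm d (act d Y v) \<le> 1 * vnorm d v" by (simp add: power2_le_iff_abs_le)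
qed (use Y in auto)

lemma op_bound_isometry: "U \<in> carrier_mat d d \<Longrightarrow> adj U * U = 1\<^sub>m d \<Longrightarrow> op_bound d U 1"
  by (rule op_bound_gram) (auto simp: op_bound_one)

lemma op_bound_diag:
  assumes "0 \<le> k" "\<And>i. i < d \<Longrightarrow> cmod (p i) \<le> k"
  shows "op_bound d (diag d p) k"
proof (rule op_boundI)
  fix v
  have "vnorm d (act d (diag d p) v) = vnorm d (\<lambda>i. p i * v i)"
  proof (rule vnorm_cong)
    fix i assume "i < d"
    then have "act d (diag d p) v i = (\<Sum>j<d. if i = j then p i * v i else 0)"
      unfolding act_def by (intro sum.cong) auto
    then show "act d (diag d p) v i = p i * v i" using \<open>i < d\<close> by simp
  qed
  also have "\<dots> \<le> L2_set (\<lambda>i. k * cmod (v i)) {..<d}"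
    unfolding vnorm_def by (rule L2_set_mono) (auto simp: norm_mult assms intro!: mult_right_mono)
  also have "\<dots> = k * vnorm d v"
    unfolding vnorm_def using assms(1) by (simp add: L2_set_right_distrib)
  finally show "vnorm d (act d (diag d p) v) \<le> k * vnorm d v" .
qed (use assms in auto)

lemma op_bound_conj_diag:
  assumes "U \<in> carrier_mat d d" "adj U * U = 1\<^sub>m d" "0 \<le> k" "\<And>i. i < d \<Longrightarrow> cmod (p i) \<le> k"
  shows "op_bound d (U * diag d p * adj U) k"
  using op_bound_mult[OF op_bound_mult[OF op_bound_isometry[OF assms(1,2)] op_bound_diag[OF assms(3,4)]] op_bound_adj[OF op_bound_isometry[OF assms(1,2)]]]
  by simp

text \<open>Entries are values of the form on pairs of basis vectors, which have norm 1.\<close>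

lemma op_bound_entry:
  assumes "op_bound d W w" "i < d" "j < d"
  shows "cmod (W $$ (i,j)) \<le> w"
proof -
  define e where "e k = (\<lambda>l::nat. if l = k then 1 else 0 :: complex)" for k :: nat
  have n: "vnorm d (e k) = 1" if "k < d" for k
  proof -
    have "complex_of_real ((vnorm d (e k))\<^sup>2) = 1" using that by (simp add: vnorm_sq e_def if_distrib cong: if_cong del: of_real_power)
    then have "(vnorm d (e k))\<^sup>2 = 1" by (metis of_real_eq_1_iff)
    then show ?thesis using vnorm_nonneg[of d "e k"] by (auto simp: power2_eq_1_iff)
  qed
  have m: "act d W (e j) k = W $$ (k,j)" for k
    using assms by (simp add: act_def e_def if_distrib cong: if_cong)
  have "(\<Sum>l<d. e i l * act d W (e j) l) = W $$ (i,j)"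
    using assms unfolding m by (simp add: e_def if_distrib if_distribR cong: if_cong)
  then show ?thesis using assms n[OF assms(2)] n[OF assms(3)]
    unfolding op_bound_def by (metis mult.right_neutral)
qed

section \<open>Traces and the calculus of the dual norm\<close>

lemma mtrace_mult:
  assumes "A \<in> carrier_mat d d" "B \<in> carrier_mat d d"
  shows "mtrace (A * B) = (\<Sum>i<d. \<Sum>j<d. A $$ (i,j) * B $$ (j,i))"
  unfolding mtrace_def using assms by (auto simp: mult_mat_index[OF assms] simp del: index_mult_mat(1) intro!: sum.cong)

lemma mtrace_comm:
  assumes "A \<in> carrier_mat d d" "B \<in> carrier_mat d d"
  shows "mtrace (A * B) = mtrace (B * A)"
  using assms by (simp add: mtrace_mult[of _ d]) (subst sum.swap, simp add: mult.commute)

lemma mtrace_add: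
  assumes "A \<in> carrier_mat d d" "B \<in> carrier_mat d d"
  shows "mtrace (A + B) = mtrace A + mtrace B"
  unfolding mtrace_def using assms by (simp add: sum.distrib)

lemma mtrace_smult:
  assumes "A \<in> carrier_mat d d"
  shows "mtrace (c \<cdot>\<^sub>m A) = c * mtrace A"
  unfolding mtrace_def using assms by (simp add: sum_distrib_left)

text \<open>Cyclicity moves U onto W, after which only the diagonal of W in the new basis meets the
  values p.\<close>

lemma mtrace_conj_diag:
  assumes "U \<in> carrier_mat d d" "adj U * U = 1\<^sub>m d" "W \<in> carrier_mat d d"
  shows "mtrace (W * (U * diag d p * adj U)) = (\<Sum>l<d. (adj U * W * U) $$ (l,l) * p l)"
proof -
  have "mtrace (W * (U * diag d p * adj U)) = mtrace ((W * U * diag d p) * adj U)"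
    using assms by (simp add: assoc_mult_mat[of _ d d _ d _ d])
  also have "\<dots> = mtrace ((adj U * W * U) * diag d p)"
    using assms by (subst mtrace_comm[of _ d]) (auto simp: assoc_mult_mat[of _ d d _ d _ d])
  also have "\<dots> = (\<Sum>i<d. \<Sum>j<d. if j = i then (adj U * W * U) $$ (i,i) * p i else 0)"
    using assms by (subst mtrace_mult[of _ d], simp, simp, intro sum.cong refl) (simp del: index_mult_mat(1))
  also have "\<dots> = (\<Sum>l<d. (adj U * W * U) $$ (l,l) * p l)" by simp
  finally show ?thesis .
qed

lemma tr_bound_carrier: "tr_bound d X b \<Longrightarrow> X \<in> carrier_mat d d"
  by (simp add: tr_bound_def)

lemma tr_bound_bound: "tr_bound d X b \<Longrightarrow> op_bound d W w \<Longrightarrow> cmod (mtrace (W * X)) \<le> w * b"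
  by (simp add: tr_bound_def)

lemma tr_bound_mono: "tr_bound d X b \<Longrightarrow> b \<le> b' \<Longrightarrow> tr_bound d X b'"
  unfolding tr_bound_def by (meson op_bound_nonneg mult_left_mono order_trans)

lemma tr_bound_nonneg: "tr_bound d X b \<Longrightarrow> 0 \<le> b"
  unfolding tr_bound_def using op_bound_one[of d] norm_ge_zero order_trans by (metis mult_1)

lemma tr_bound_add:
  assumes "tr_bound d X a" "tr_bound d Y b"
  shows "tr_bound d (X + Y) (a + b)"
  unfolding tr_bound_def
proof (intro conjI allI impI)
  note c = tr_bound_carrier[OF assms(1)] tr_bound_carrier[OF assms(2)]
  show "X + Y \<in> carrier_mat d d" using c by simp
  fix W w assume W: "op_bound d W w"
  have "mtrace (W * (X + Y)) = mtrace (W * X) + mtrace (W * Y)"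
    using c op_bound_carrier[OF W] by (simp add: mult_add_distrib_mat[of _ d d] mtrace_add[of _ d])
  also have "cmod \<dots> \<le> w * a + w * b"
    using assms W by (intro order_trans[OF norm_triangle_ineq] add_mono) (auto simp: tr_bound_def)
  finally show "cmod (mtrace (W * (X + Y))) \<le> w * (a + b)" by (simp add: distrib_left)
qed

lemma tr_bound_smult:
  assumes "tr_bound d X a"
  shows "tr_bound d (c \<cdot>\<^sub>m X) (cmod c * a)"
  unfolding tr_bound_def
proof (intro conjI allI impI)
  note X = tr_bound_carrier[OF assms(1)]
  show "c \<cdot>\<^sub>m X \<in> carrier_mat d d" using X by simp
  fix W w assume W: "op_bound d W w"
  have "mtrace (W * (c \<cdot>\<^sub>m X)) = c * mtrace (W * X)"
    using X op_bound_carrier[OF W] by (simp add: mult_smult_distrib[of _ d d] mtrace_smult[of _ d])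
  then have "cmod (mtrace (W * (c \<cdot>\<^sub>m X))) = cmod c * cmod (mtrace (W * X))" by (simp add: norm_mult)
  also have "\<dots> \<le> cmod c * (w * a)" using assms W by (intro mult_left_mono) (auto simp: tr_bound_def)
  finally show "cmod (mtrace (W * (c \<cdot>\<^sub>m X))) \<le> w * (cmod c * a)" by (simp add: mult_ac)
qed

lemma tr_bound_diff:
  assumes "tr_bound d X a" "tr_bound d Y b"
  shows "tr_bound d (X - Y) (a + b)"
proof -
  have "X - Y = X + (-1) \<cdot>\<^sub>m Y"
    using tr_bound_carrier[OF assms(1)] tr_bound_carrier[OF assms(2)] by (intro eq_matI) auto
  then show ?thesis using tr_bound_add[OF assms(1) tr_bound_smult[OF assms(2), of "-1"]] by simp
qed

lemma tr_bound_left: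
  assumes "op_bound d A a" "tr_bound d X b"
  shows "tr_bound d (A * X) (a * b)"
  unfolding tr_bound_def
proof (intro conjI allI impI)
  note c = op_bound_carrier[OF assms(1)] tr_bound_carrier[OF assms(2)]
  show "A * X \<in> carrier_mat d d" using c by simp
  fix W w assume W: "op_bound d W w"
  have "W * (A * X) = (W * A) * X" using c op_bound_carrier[OF W] by (simp add: assoc_mult_mat[of _ d d _ d _ d])
  then show "cmod (mtrace (W * (A * X))) \<le> w * (a * b)"
    using tr_bound_bound[OF assms(2) op_bound_mult[OF W assms(1)]] by (simp add: mult.assoc)
qed

text \<open>By cyclicity of the trace, a factor on the right of X joins the test matrix as
  well.\<close>

lemma tr_bound_right:
  assumes "op_bound d A a" "tr_bound d X b"
  shows "tr_bound d (X * A) (a * b)"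
  unfolding tr_bound_def
proof (intro conjI allI impI)
  note c = op_bound_carrier[OF assms(1)] tr_bound_carrier[OF assms(2)]
  show "X * A \<in> carrier_mat d d" using c by simp
  fix W w assume W: "op_bound d W w"
  have "mtrace (W * (X * A)) = mtrace ((W * X) * A)"
    using c op_bound_carrier[OF W] by (simp add: assoc_mult_mat[of _ d d _ d _ d])
  also have "\<dots> = mtrace ((A * W) * X)"
    using c op_bound_carrier[OF W] by (subst mtrace_comm[of _ d]) (auto simp: assoc_mult_mat[of _ d d _ d _ d])
  finally show "cmod (mtrace (W * (X * A))) \<le> w * (a * b)"
    using tr_bound_bound[OF assms(2) op_bound_mult[OF assms(1) W]] by (simp add: mult_ac)
qed

section \<open>Positive matrices, square roots and the trace norm\<close>

lemma psd_form:
  assumes "A \<in> carrier_mat d d" "dim_vec v = d"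
  shows "(A *\<^sub>v v) \<bullet>c v = (\<Sum>i<d. cnj (v $ i) * act d A (\<lambda>i. v $ i) i)"
  using assms by (auto simp: scalar_prod_def act_def atLeast0LessThan mult.commute intro!: sum.cong)

lemma psd_gram:
  assumes Y: "Y \<in> carrier_mat d d"
  shows "psd d (adj Y * Y)"
  unfolding psd_def
proof (intro conjI allI impI)
  show "adj Y * Y \<in> carrier_mat d d" using Y by simp
  show "adj (adj Y * Y) = adj Y * Y" using Y by (simp add: adj_mult[of _ d d _ d])
  fix v :: "complex vec" assume v: "dim_vec v = d"
  let ?v = "\<lambda>i. v $ i"
  have "((adj Y * Y) *\<^sub>v v) \<bullet>c v = (\<Sum>i<d. cnj (v $ i) * act d (adj Y * Y) ?v i)"
    using Y v by (intro psd_form) auto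
  also have "\<dots> = (\<Sum>i<d. cnj (v $ i) * act d (adj Y) (act d Y ?v) i)"
    using Y by (intro sum.cong) (auto simp: act_mult)
  also have "\<dots> = complex_of_real ((vnorm d (act d Y ?v))\<^sup>2)"
    by (simp only: vnorm_sq act_adj[OF Y])
  finally show "0 \<le> Re (((adj Y * Y) *\<^sub>v v) \<bullet>c v)" by simp
qed

text \<open>The eigenvalue p l is the quadratic form of A at column l of U, a unit vector, and so
  inherits nonnegativity.\<close>

lemma psd_spectral:
  assumes "psd d A"
  obtains U p where "U \<in> carrier_mat d d" "adj U * U = 1\<^sub>m d" "U * adj U = 1\<^sub>m d"
    "A = U * diag d (\<lambda>i. complex_of_real (p i)) * adj U" "\<And>i. i < d \<Longrightarrow> 0 \<le> p i"
proof -
  have A: "A \<in> carrier_mat d d" "adj A = A" using assms by (auto simp: psd_def)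
  obtain U p where U: "U \<in> carrier_mat d d" "adj U * U = 1\<^sub>m d" "U * adj U = 1\<^sub>m d"
    and Ae: "A = U * diag d (\<lambda>i. complex_of_real (p i)) * adj U"
    using spectral_theorem[OF A] by blast
  have "0 \<le> p l" if l: "l < d" for l
  proof -
    let ?v = "vec d (\<lambda>i. U $$ (i,l))"
    have AU: "A * U = U * diag d (\<lambda>i. complex_of_real (p i))"
      using U by (simp add: Ae assoc_mult_mat[of _ d d _ d _ d])
    have m: "act d A (\<lambda>i. ?v $ i) i = of_real (p l) * U $$ (i,l)" if "i < d" for i
    proof -
      have "act d A (\<lambda>i. ?v $ i) i = (\<Sum>k<d. A $$ (i,k) * U $$ (k,l))"
        unfolding act_def by (intro sum.cong) auto
      also have "\<dots> = (A * U) $$ (i,l)" using mult_mat_index[OF A(1) U(1) that l] by simp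
      also have "\<dots> = (\<Sum>k<d. U $$ (i,k) * diag d (\<lambda>i. complex_of_real (p i)) $$ (k,l))"
        unfolding AU by (rule mult_mat_index[OF U(1) _ that l]) simp
      also have "\<dots> = (\<Sum>k<d. if k = l then U $$ (i,l) * of_real (p l) else 0)"
        using l by (intro sum.cong) auto
      finally show ?thesis using l by (simp add: mult.commute)
    qed
    have "(A *\<^sub>v ?v) \<bullet>c ?v = of_real (p l) * (\<Sum>i<d. cnj (U $$ (i,l)) * U $$ (i,l))"
      by (subst psd_form[OF A(1)]) (auto simp: m sum_distrib_left mult.left_commute intro!: sum.cong)
    also have "(\<Sum>i<d. cnj (U $$ (i,l)) * U $$ (i,l)) = (adj U * U) $$ (l,l)"
      using U(1) l by (subst mult_mat_index[of _ d d _ d]) (auto intro!: sum.cong)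
    also have "\<dots> = 1" using l unfolding U(2) by simp
    finally show ?thesis using assms by (auto simp: psd_def dest!: spec[of _ ?v])
  qed
  then show ?thesis using that U Ae by blast
qed

lemma conj_diag_mult:
  assumes "U \<in> carrier_mat d d" "adj U * U = 1\<^sub>m d"
  shows "(U * diag d p * adj U) * (U * diag d q * adj U) = U * diag d (\<lambda>i. p i * q i) * adj U"
proof -
  have "(U * diag d p * adj U) * (U * diag d q * adj U) = U * diag d p * (adj U * U) * diag d q * adj U"
    using assms(1) by (simp add: assoc_mult_mat[of _ d d _ d _ d])
  also have "\<dots> = U * (diag d p * diag d q) * adj U"
    unfolding assms(2) using assms(1) by (simp add: assoc_mult_mat[of _ d d _ d _ d])
  finally show ?thesis by (simp add: diag_mult)
qed

lemma conj_diag_adj: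
  assumes "U \<in> carrier_mat d d"
  shows "adj (U * diag d p * adj U) = U * diag d (\<lambda>i. cnj (p i)) * adj U"
  using assms by (simp add: adj_mult[of _ d d _ d] adj_diag assoc_mult_mat[of _ d d _ d _ d])

text \<open>The change of basis T between the two eigenbases intertwines the squared eigenvalues, so
  T at (i,j) vanishes unless (b i)^2 = (c j)^2. For nonnegative numbers this means b i = c j, so T
  intertwines the eigenvalues themselves. Uniqueness is what gives the definite description in
  \<open>psd_sqrt\<close> its value.\<close>

lemma psd_sqrt_unique:
  assumes "psd d B" "psd d C" "B * B = C * C"
  shows "B = C"
proof -
  obtain U b where U: "U \<in> carrier_mat d d" "adj U * U = 1\<^sub>m d" "U * adj U = 1\<^sub>m d"
    and B: "B = U * diag d (\<lambda>i. complex_of_real (b i)) * adj U" and b: "\<And>i. i < d \<Longrightarrow> 0 \<le> b i"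
    by (rule psd_spectral[OF assms(1)]) blast
  obtain V c where V: "V \<in> carrier_mat d d" "adj V * V = 1\<^sub>m d" "V * adj V = 1\<^sub>m d"
    and C: "C = V * diag d (\<lambda>i. complex_of_real (c i)) * adj V" and c: "\<And>i. i < d \<Longrightarrow> 0 \<le> c i"
    by (rule psd_spectral[OF assms(2)]) blast
  define T where "T = adj U * V"
  have T: "T \<in> carrier_mat d d" using U V by (simp add: T_def)
  have diagT: "(diag d p * T) $$ (i,j) = p i * T $$ (i,j)" if "i < d" "j < d" for i j p
  proof -
    have "(diag d p * T) $$ (i,j) = (\<Sum>k<d. diag d p $$ (i,k) * T $$ (k,j))"
      by (rule mult_mat_index[OF _ T that]) simp
    also have "\<dots> = (\<Sum>k<d. if i = k then p i * T $$ (i,j) else 0)"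
      using that by (intro sum.cong) auto
    finally show ?thesis using that by simp
  qed
  have Tdiag: "(T * diag d p) $$ (i,j) = T $$ (i,j) * p j" if "i < d" "j < d" for i j p
  proof -
    have "(T * diag d p) $$ (i,j) = (\<Sum>k<d. T $$ (i,k) * diag d p $$ (k,j))"
      by (rule mult_mat_index[OF T _ that]) simp
    also have "\<dots> = (\<Sum>k<d. if k = j then T $$ (i,j) * p j else 0)"
      using that by (intro sum.cong) auto
    finally show ?thesis using that by simp
  qed
  have "diag d (\<lambda>i. of_real (b i) * of_real (b i)) * T = adj U * (B * B) * V"
  proof -
    have "adj U * (B * B) * V = (adj U * U) * (diag d (\<lambda>i. of_real (b i) * of_real (b i)) * (adj U * V))"
      unfolding B conj_diag_mult[OF U(1,2)] using U(1) V(1) by (simp add: assoc_mult_mat[of _ d d _ d _ d])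
    then show ?thesis using T by (simp add: U(2) T_def[symmetric])
  qed
  also have "\<dots> = T * diag d (\<lambda>i. of_real (c i) * of_real (c i))"
  proof -
    have "adj U * (C * C) * V = adj U * V * (diag d (\<lambda>i. of_real (c i) * of_real (c i)) * (adj V * V))"
      unfolding C conj_diag_mult[OF V(1,2)] using U(1) V(1) by (simp add: assoc_mult_mat[of _ d d _ d _ d])
    then show ?thesis using T by (simp add: assms(3) V(2) T_def[symmetric])
  qed
  finally have e: "diag d (\<lambda>i. of_real (b i) * of_real (b i)) * T = T * diag d (\<lambda>i. of_real (c i) * of_real (c i))" .
  have "diag d (\<lambda>i. of_real (b i)) * T = T * diag d (\<lambda>i. of_real (c i))"
  proof (rule eq_matI)
    fix i j assume "i < dim_row (T * diag d (\<lambda>i. of_real (c i)))" "j < dim_col (T * diag d (\<lambda>i. of_real (c i)))"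
    then have ij: "i < d" "j < d" using T by (auto simp: diag_def)
    have "of_real (b i * b i) * T $$ (i,j) = T $$ (i,j) * of_real (c j * c j)"
      using arg_cong[OF e, of "\<lambda>M. M $$ (i,j)"] unfolding diagT[OF ij] Tdiag[OF ij] by simp
    then have "T $$ (i,j) = 0 \<or> complex_of_real (b i * b i) = complex_of_real (c j * c j)"
      by (metis mult.commute mult_cancel_left)
    then have "T $$ (i,j) = 0 \<or> b i * b i = c j * c j"
      unfolding of_real_eq_iff .
    then have "T $$ (i,j) = 0 \<or> b i = c j"
      using b[OF ij(1)] c[OF ij(2)] by (metis real_sqrt_mult_self abs_of_nonneg real_sqrt_abs2)
    then show "(diag d (\<lambda>i. of_real (b i)) * T) $$ (i,j) = (T * diag d (\<lambda>i. of_real (c i))) $$ (i,j)"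
      unfolding diagT[OF ij] Tdiag[OF ij] by auto
  qed (use T in \<open>auto simp: diag_def\<close>)
  note f = this
  have "B = U * (diag d (\<lambda>i. of_real (b i)) * T) * adj V"
  proof -
    have "U * (diag d (\<lambda>i. of_real (b i)) * T) * adj V = U * diag d (\<lambda>i. of_real (b i)) * adj U * (V * adj V)"
      using U(1) V(1) by (simp add: T_def assoc_mult_mat[of _ d d _ d _ d])
    then show ?thesis using U(1) by (simp add: V(3) B)
  qed
  also have "\<dots> = (U * adj U) * (V * diag d (\<lambda>i. of_real (c i)) * adj V)"
    unfolding f using U(1) V(1) by (simp add: T_def assoc_mult_mat[of _ d d _ d _ d])
  also have "\<dots> = C" using V(1) by (simp add: U(3) C)
  finally show ?thesis .
qed

text \<open>It is the Gram matrix of the conjugate with the square roots of s on the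
  diagonal.\<close>

lemma psd_conj_diag:
  assumes U: "U \<in> carrier_mat d d" "adj U * U = 1\<^sub>m d" and s: "\<And>i. i < d \<Longrightarrow> 0 \<le> s i"
  shows "psd d (U * diag d (\<lambda>i. complex_of_real (s i)) * adj U)"
proof -
  let ?R = "U * diag d (\<lambda>i. complex_of_real (sqrt (s i))) * adj U"
  have "diag d (\<lambda>i. complex_of_real (sqrt (s i)) * complex_of_real (sqrt (s i))) = diag d (\<lambda>i. complex_of_real (s i))"
    using s by (intro eq_matI) (auto simp: diag_def of_real_mult[symmetric] simp del: of_real_mult)
  then have "adj ?R * ?R = U * diag d (\<lambda>i. complex_of_real (s i)) * adj U"
    using U by (simp add: conj_diag_adj conj_diag_mult)
  then show ?thesis using psd_gram[of ?R d] U by simp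
qed

text \<open>Let S be the positive root of adj X X and G its pseudo-inverse. Then W = G adj X
  satisfies W X = S and is a contraction, being the adjoint of the partial isometry X G of the polar
  decomposition. Testing X against this single W yields the trace of S.\<close>

lemma trace_norm_le:
  assumes X: "tr_bound d X b"
  shows "trace_norm X \<le> b"
proof -
  note Xc = tr_bound_carrier[OF X]
  define A where "A = adj X * X"
  have Ac: "A \<in> carrier_mat d d" using Xc by (simp add: A_def)
  obtain U p where U: "U \<in> carrier_mat d d" "adj U * U = 1\<^sub>m d" "U * adj U = 1\<^sub>m d"
    and A: "A = U * diag d (\<lambda>i. complex_of_real (p i)) * adj U" and p: "\<And>i. i < d \<Longrightarrow> 0 \<le> p i"
    using psd_spectral[OF psd_gram[OF Xc]] unfolding A_def by blast
  define S where "S = U * diag d (\<lambda>i. complex_of_real (sqrt (p i))) * adj U"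
  have S: "psd d S" unfolding S_def by (rule psd_conj_diag[OF U(1,2)]) (use p in auto)
  have Sc: "S \<in> carrier_mat d d" using S by (simp add: psd_def)
  have dc: "diag d q = diag d q'" if "\<And>i. i < d \<Longrightarrow> q i = q' i" for q q'
    using that by (intro eq_matI) (auto simp: diag_def)
  have SS: "S * S = A"
    unfolding S_def A conj_diag_mult[OF U(1,2)]
    by (intro arg_cong[of _ _ "\<lambda>M. U * M * adj U"] dc) (use p in \<open>simp add: of_real_mult[symmetric] del: of_real_mult\<close>)
  have "psd_sqrt A = S"
    unfolding psd_sqrt_def
  proof (rule the_equality)
    show "psd (dim_row A) S \<and> S * S = A" using S SS Ac by simp
    fix B assume "psd (dim_row A) B \<and> B * B = A"
    then show "B = S" using psd_sqrt_unique[of d B S] S SS Ac by simp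
  qed
  then have tr: "trace_norm X = Re (mtrace S)" by (simp add: trace_norm_def A_def)
  \<comment> \<open>The value 0 on the kernel makes G a pseudo-inverse: the square root is inverted
    on its support only.\<close>
  define g where "g i = complex_of_real (if p i = 0 then 0 else 1 / sqrt (p i))" for i
  define G where "G = U * diag d g * adj U"
  have gc: "cnj (g i) = g i" for i by (simp add: g_def)
  have G: "G \<in> carrier_mat d d" "adj G = G"
    unfolding G_def conj_diag_adj[OF U(1)] gc using U(1) by simp_all
  have "G * A = S"
    unfolding G_def S_def A conj_diag_mult[OF U(1,2)]
    by (intro arg_cong[of _ _ "\<lambda>M. U * M * adj U"] dc)
      (use p in \<open>auto simp: g_def of_real_mult[symmetric] real_div_sqrt simp del: of_real_mult\<close>)
  then have GX: "(G * adj X) * X = S"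
    using G Xc by (simp add: A_def assoc_mult_mat[of _ d d _ d _ d])
  have "adj (X * G) * (X * G) = (G * A) * G"
    using G Xc by (simp add: adj_mult[of _ d d _ d] A_def assoc_mult_mat[of _ d d _ d _ d])
  also have "\<dots> = U * diag d (\<lambda>i. complex_of_real (sqrt (p i)) * g i) * adj U"
    unfolding \<open>G * A = S\<close> unfolding S_def G_def conj_diag_mult[OF U(1,2)] ..
  finally have e: "adj (X * G) * (X * G) = U * diag d (\<lambda>i. complex_of_real (sqrt (p i)) * g i) * adj U" .
  \<comment> \<open>The Gram matrix of X G is the projection onto the support of X; its eigenvalues
    are among 0 and 1.\<close>
  have "op_bound d (adj (X * G) * (X * G)) 1"
    unfolding e
  proof (rule op_bound_conj_diag[OF U(1,2)])
    fix i
    have "complex_of_real (sqrt (p i)) * g i = of_real (if p i = 0 then 0 else 1)"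
      by (simp add: g_def)
    then show "cmod (complex_of_real (sqrt (p i)) * g i) \<le> 1" by simp
  qed simp
  then have "op_bound d (X * G) 1" by (rule op_bound_gram[rotated]) (use G(1) Xc in simp)
  then have "op_bound d (G * adj X) 1"
    using op_bound_adj[of d "X * G" 1] adj_mult[OF Xc G(1)] unfolding G(2) by simp
  then have "cmod (mtrace S) \<le> b" using X unfolding tr_bound_def by (metis GX mult_1)
  then show ?thesis unfolding tr using complex_Re_le_cmod order_trans by blast
qed

text \<open>The trace is the sum of the eigenvalues, so these form a probability distribution. That
  each is at most 1 is what makes \<sigma> a contraction later.\<close>

lemma density_spectral:
  assumes "density d \<sigma>"
  obtains U p where "U \<in> carrier_mat d d" "adj U * U = 1\<^sub>m d"
    "\<sigma> = U * diag d (\<lambda>i. complex_of_real (p i)) * adj U" "\<And>i. i < d \<Longrightarrow> 0 \<le> p i \<and> p i \<le> 1" "(\<Sum>l<d. p l) = 1"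
proof -
  have P: "psd d \<sigma>" and t: "mtrace \<sigma> = 1" using assms by (auto simp: density_def)
  have R: "\<sigma> \<in> carrier_mat d d" using P by (simp add: psd_def)
  obtain U p where U: "U \<in> carrier_mat d d" "adj U * U = 1\<^sub>m d" "U * adj U = 1\<^sub>m d"
    and r: "\<sigma> = U * diag d (\<lambda>i. complex_of_real (p i)) * adj U" and p: "\<And>i. i < d \<Longrightarrow> 0 \<le> p i"
    by (rule psd_spectral[OF P]) blast
  have "mtrace (1\<^sub>m d * \<sigma>) = (\<Sum>l<d. (adj U * 1\<^sub>m d * U) $$ (l,l) * of_real (p l))"
    unfolding r by (rule mtrace_conj_diag[OF U(1,2)]) simp
  then have "of_real (\<Sum>l<d. p l) = (1::complex)" using R U(1,2) t by simp
  then have sp: "(\<Sum>l<d. p l) = 1" by (metis of_real_eq_1_iff)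
  have "p i \<le> 1" if "i < d" for i
    unfolding sp[symmetric] by (rule member_le_sum) (use that p in auto)
  then show ?thesis using that U r p sp by blast
qed

text \<open>The trace of W \<rho> is an average, weighted by the eigenvalues of \<rho>, of diagonal
  entries of W in the eigenbasis, each of modulus at most w.\<close>

lemma tr_bound_density:
  assumes "density d \<rho>"
  shows "tr_bound d \<rho> 1"
  unfolding tr_bound_def
proof (intro conjI allI impI)
  show R: "\<rho> \<in> carrier_mat d d" using assms by (simp add: density_def psd_def)
  fix W w assume W: "op_bound d W w"
  obtain U p where U: "U \<in> carrier_mat d d" "adj U * U = 1\<^sub>m d"
    and r: "\<rho> = U * diag d (\<lambda>i. complex_of_real (p i)) * adj U" and p: "\<And>i. i < d \<Longrightarrow> 0 \<le> p i \<and> p i \<le> 1"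
    and sp: "(\<Sum>l<d. p l) = 1"
    by (rule density_spectral[OF assms]) blast
  have "op_bound d (adj U * W * U) (1 * w * 1)"
    by (intro op_bound_mult op_bound_adj op_bound_isometry U W)
  then have e: "cmod ((adj U * W * U) $$ (l,l)) \<le> w" if "l < d" for l
    using op_bound_entry[of d _ w l l] that by simp
  have "cmod (mtrace (W * \<rho>)) = cmod (\<Sum>l<d. (adj U * W * U) $$ (l,l) * of_real (p l))"
    unfolding r by (subst mtrace_conj_diag[OF U(1,2) op_bound_carrier[OF W]]) simp
  also have "\<dots> \<le> (\<Sum>l<d. w * p l)"
    by (rule order_trans[OF norm_sum]) (auto simp: norm_mult p intro!: sum_mono mult_right_mono e simp del: index_mult_mat(1))
  also have "\<dots> = w * 1" by (simp only: sum_distrib_left[symmetric] sp)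
  finally show "cmod (mtrace (W * \<rho>)) \<le> w * 1" .
qed

text \<open>Conjugation passes through powers, so each entry of the series is a finite combination
  of convergent scalar exponential series.\<close>

lemma mat_exp_conj_diag:
  assumes U: "U \<in> carrier_mat d d" "adj U * U = 1\<^sub>m d" "U * adj U = 1\<^sub>m d"
  shows "mat_exp (c \<cdot>\<^sub>m (U * diag d p * adj U)) = U * diag d (\<lambda>i. exp (c * p i)) * adj U"
proof -
  have sm: "c \<cdot>\<^sub>m (U * diag d p * adj U) = U * diag d (\<lambda>i. c * p i) * adj U"
    using U by (intro eq_matI) (auto simp: conj_diag_index sum_distrib_left mult_ac simp del: index_mult_mat(1) intro!: sum.cong)
  have pw: "(U * diag d (\<lambda>i. c * p i) * adj U) ^\<^sub>m k = U * diag d (\<lambda>i. (c * p i) ^ k) * adj U" for k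
  proof (induction k)
    case 0
    then show ?case using U by (simp add: diag_one)
  next
    case (Suc k)
    then show ?case using U by (simp add: conj_diag_mult mult.commute)
  qed
  show ?thesis
  proof (rule eq_matI)
    fix i j assume "i < dim_row (U * diag d (\<lambda>i. exp (c * p i)) * adj U)" "j < dim_col (U * diag d (\<lambda>i. exp (c * p i)) * adj U)"
    then have ij: "i < d" "j < d" using U by auto
    have "(\<lambda>k. \<Sum>l<d. U $$ (i,l) * ((c * p l) ^ k /\<^sub>R fact k) * cnj (U $$ (j,l))) sums
        (\<Sum>l<d. U $$ (i,l) * exp (c * p l) * cnj (U $$ (j,l)))"
      by (intro sums_sum sums_mult sums_mult2 exp_converges)
    moreover have "(\<Sum>l<d. U $$ (i,l) * ((c * p l) ^ k /\<^sub>R fact k) * cnj (U $$ (j,l)))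
        = (U * diag d (\<lambda>i. (c * p i) ^ k) * adj U) $$ (i,j) / of_nat (fact k)" for k
      unfolding conj_diag_index[OF U(1) ij]
      by (simp add: sum_distrib_left scaleR_conv_of_real divide_inverse mult_ac)
    ultimately have ex: "(\<Sum>k. (U * diag d (\<lambda>i. (c * p i) ^ k) * adj U) $$ (i,j) / of_nat (fact k))
      = (\<Sum>l<d. U $$ (i,l) * exp (c * p l) * cnj (U $$ (j,l)))"
      by (simp add: sums_iff del: index_mult_mat(1))
    have "mat_exp (c \<cdot>\<^sub>m (U * diag d p * adj U)) $$ (i,j)
        = (\<Sum>k. (U * diag d (\<lambda>i. (c * p i) ^ k) * adj U) $$ (i,j) / of_nat (fact k))"
      unfolding sm mat_exp_def pw using ij U(1) by (simp del: index_mult_mat(1))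
    also note ex
    also note conj_diag_index[OF U(1) ij, symmetric]
    finally show "mat_exp (c \<cdot>\<^sub>m (U * diag d p * adj U)) $$ (i,j) = (U * diag d (\<lambda>i. exp (c * p i)) * adj U) $$ (i,j)" .
  qed (use U in \<open>auto simp: mat_exp_def\<close>)
qed

subsection \<open>The channel of a single partial swap\<close>

lemma sum_lessThan_mult:
  fixes f :: "nat \<Rightarrow> 'a::comm_monoid_add"
  shows "(\<Sum>i<B*D. f i) = (\<Sum>b<B. \<Sum>s<D. f (b*D+s))"
proof -
  have "sum f {b*D..<b*D+D} = (\<Sum>s<D. f (b*D+s))" for b
    using sum.atLeastLessThan_shift_0[of f "b*D" "b*D+D"] by (simp add: atLeast0LessThan comp_def)
  then show ?thesis using sum.nat_group[of f D B] by simp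
qed

lemma block_index_less: "b < B \<Longrightarrow> s < D \<Longrightarrow> b * D + s < B * (D::nat)"
proof -
  assume "b < B" "s < D"
  then have "b * D + s < Suc b * D" by simp
  also have "\<dots> \<le> B * D" using \<open>b < B\<close> by (intro mult_right_mono) auto
  finally show ?thesis .
qed

lemma block_index_div: "s < D \<Longrightarrow> (b * D + s) div D = (b::nat)"
  by simp

text \<open>With \<open>B = 1\<close> the operation is uncontrolled, with \<open>B = 2\<close> it is controlled by the leading
  qubit: in both cases \<open>X\<close> acts when the leading digit is \<open>B - 1\<close>.\<close>
definition ctl :: "nat \<Rightarrow> nat \<Rightarrow> complex \<Rightarrow> complex mat \<Rightarrow> complex mat" where
  "ctl B D x X = mat (B*D) (B*D) (\<lambda>(i,j). if i div D = j div D then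
     (if i div D = B - 1 then X $$ (i mod D, j mod D) else if i mod D = j mod D then x else 0) else 0)"

lemma ctl_carrier [simp]: "ctl B D x X \<in> carrier_mat (B*D) (B*D)"
  by (simp add: ctl_def)

lemma ctl_dims [simp]: "dim_row (ctl B D x X) = B * D" "dim_col (ctl B D x X) = B * D"
  by (simp_all add: ctl_def)

lemma ctl_index:
  assumes "b < B" "s < D" "b' < B" "s' < D"
  shows "ctl B D x X $$ (b*D+s, b'*D+s') =
    (if b = b' then (if b = B - 1 then X $$ (s,s') else if s = s' then x else 0) else 0)"
  using assms block_index_less[of b B s D] block_index_less[of b' B s' D] by (simp add: ctl_def)

lemma eq_mat_blockI:
  assumes "X \<in> carrier_mat (B*D) (B*D)" "Y \<in> carrier_mat (B*D) (B*D)"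
    and "\<And>b s b' s'. b < B \<Longrightarrow> s < D \<Longrightarrow> b' < B \<Longrightarrow> s' < D \<Longrightarrow> X $$ (b*D+s, b'*D+s') = Y $$ (b*D+s, b'*D+s')"
  shows "X = Y"
proof (rule eq_matI)
  fix i j assume "i < dim_row Y" "j < dim_col Y"
  then have ij: "i < B*D" "j < B*D" using assms by auto
  then have "D > 0" by (cases D) auto
  have "i div D < B" "j div D < B" using ij by (simp_all add: less_mult_imp_div_less)
  then show "X $$ (i,j) = Y $$ (i,j)"
    using assms(3)[of "i div D" "i mod D" "j div D" "j mod D"] \<open>D > 0\<close> by simp
qed (use assms in auto)

lemma act_ctl:
  assumes "b < B" "s < D"
  shows "act (B*D) (ctl B D x X) v (b*D+s) =
    (if b = B - 1 then act D X (\<lambda>s. v (b*D+s)) s else x * v (b*D+s))"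
proof -
  have "act (B*D) (ctl B D x X) v (b*D+s) = (\<Sum>b'<B. \<Sum>s'<D. ctl B D x X $$ (b*D+s, b'*D+s') * v (b'*D+s'))"
    unfolding act_def by (rule sum_lessThan_mult)
  also have "\<dots> = (\<Sum>b'<B. if b' = b then (\<Sum>s'<D. (if b = B - 1 then X $$ (s,s') else if s = s' then x else 0) * v (b*D+s')) else 0)"
    using assms by (intro sum.cong refl) (auto simp: ctl_index intro!: sum.cong sum.neutral)
  also have "\<dots> = (\<Sum>s'<D. (if b = B - 1 then X $$ (s,s') else if s = s' then x else 0) * v (b*D+s'))"
    using assms by simp
  also have "\<dots> = (if b = B - 1 then act D X (\<lambda>s. v (b*D+s)) s else x * v (b*D+s))"
  proof (cases "b = B - 1")
    case True
    then show ?thesis by (simp add: act_def)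
  next
    case False
    then have "(\<Sum>s'<D. (if b = B - 1 then X $$ (s,s') else if s = s' then x else 0) * v (b*D+s'))
      = (\<Sum>s'<D. if s' = s then x * v (b*D+s) else 0)" by (intro sum.cong) auto
    then show ?thesis using False assms by simp
  qed
  finally show ?thesis .
qed

lemma vnorm_block: "(vnorm (B*D) v)\<^sup>2 = (\<Sum>b<B. (vnorm D (\<lambda>s. v (b*D+s)))\<^sup>2)"
  by (simp add: vnorm_def L2_set_def sum_nonneg sum_lessThan_mult)

lemma vnorm_scale: "vnorm d (\<lambda>i. x * v i) = cmod x * vnorm d v"
  by (simp add: vnorm_def norm_mult L2_set_right_distrib)

text \<open>The blocks act on orthogonal subspaces: their squared norms add up, and each block
  stretches by at most w.\<close>

lemma op_bound_ctl:
  assumes X: "op_bound D X w" and x: "cmod x \<le> w"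
  shows "op_bound (B*D) (ctl B D x X) w"
proof (rule op_boundI)
  show w: "0 \<le> w" by (rule op_bound_nonneg[OF X])
  fix v
  have "(vnorm (B*D) (act (B*D) (ctl B D x X) v))\<^sup>2
      = (\<Sum>b<B. (vnorm D (\<lambda>s. act (B*D) (ctl B D x X) v (b*D+s)))\<^sup>2)" by (rule vnorm_block)
  also have "\<dots> \<le> (\<Sum>b<B. (w * vnorm D (\<lambda>s. v (b*D+s)))\<^sup>2)"
  proof (intro sum_mono power_mono)
    fix b assume "b \<in> {..<B}"
    then have b: "b < B" by simp
    show "vnorm D (\<lambda>s. act (B*D) (ctl B D x X) v (b*D+s)) \<le> w * vnorm D (\<lambda>s. v (b*D+s))"
    proof (cases "b = B - 1")
      case True
      then have "vnorm D (\<lambda>s. act (B*D) (ctl B D x X) v (b*D+s)) = vnorm D (act D X (\<lambda>s. v (b*D+s)))"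
        using b by (intro vnorm_cong) (simp add: act_ctl)
      then show ?thesis using op_boundD[OF X] by simp
    next
      case False
      then have "vnorm D (\<lambda>s. act (B*D) (ctl B D x X) v (b*D+s)) = vnorm D (\<lambda>s. x * v (b*D+s))"
        using b by (intro vnorm_cong) (simp add: act_ctl)
      then show ?thesis using x by (simp add: vnorm_scale mult_right_mono)
    qed
  qed simp
  also have "\<dots> = (w * vnorm (B*D) v)\<^sup>2"
    by (simp add: power_mult_distrib vnorm_block sum_distrib_left)
  finally show "vnorm (B*D) (act (B*D) (ctl B D x X) v) \<le> w * vnorm (B*D) v"
    using w by (simp add: power2_le_iff_abs_le)
qed simp

lemma mult_index_act:
  assumes "A \<in> carrier_mat d d" "M \<in> carrier_mat d d" "i < d" "j < d"
  shows "(A * M) $$ (i,j) = act d A (\<lambda>u. M $$ (u,j)) i"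
  using mult_mat_index[OF assms] by (simp add: act_def)

lemma mult_adj_index_act:
  assumes "A \<in> carrier_mat d d" "M \<in> carrier_mat d d" "i < d" "j < d"
  shows "(M * adj A) $$ (i,j) = cnj (act d A (\<lambda>v. cnj (M $$ (i,v))) j)"
  using mult_mat_index[OF assms(2) adj_carrier[OF assms(1)] assms(3,4)] assms
  by (simp add: act_def mult.commute del: index_mult_mat(1))

lemma ctl_mult:
  assumes "X \<in> carrier_mat D D" "Y \<in> carrier_mat D D"
  shows "ctl B D x X * ctl B D y Y = ctl B D (x * y) (X * Y)"
proof (rule eq_mat_blockI)
  fix b s b' s' assume b: "b < B" "s < D" "b' < B" "s' < D"
  note l = block_index_less[OF b(1,2)] block_index_less[OF b(3,4)]
  have "(ctl B D x X * ctl B D y Y) $$ (b*D+s, b'*D+s')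
    = (if b = B - 1 then act D X (\<lambda>s. ctl B D y Y $$ (b*D+s, b'*D+s')) s else x * ctl B D y Y $$ (b*D+s, b'*D+s'))"
    using l by (subst mult_index_act[of _ "B*D"]) (simp_all add: act_ctl b)
  also have "\<dots> = ctl B D (x * y) (X * Y) $$ (b*D+s, b'*D+s')"
  proof (cases "b = B - 1 \<and> b' = b")
    case True
    have "act D X (\<lambda>s. ctl B D y Y $$ (b*D+s, b'*D+s')) s = act D X (\<lambda>s. Y $$ (s, s')) s"
      unfolding act_def using b True by (intro sum.cong) (auto simp: ctl_index)
    then show ?thesis using True b assms by (simp add: ctl_index mult_index_act[of _ D] del: index_mult_mat(1))
  next
    case False
    have "act D X (\<lambda>s. ctl B D y Y $$ (b*D+s, b'*D+s')) s = 0" if "b' \<noteq> b"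
      unfolding act_def using b that by (intro sum.neutral) (auto simp: ctl_index)
    then show ?thesis using False b by (auto simp: ctl_index)
  qed
  finally show "(ctl B D x X * ctl B D y Y) $$ (b*D+s, b'*D+s') = ctl B D (x * y) (X * Y) $$ (b*D+s, b'*D+s')" .
qed simp_all

text \<open>The corner is W compressed to a coordinate subspace; extending a vector by zero keeps
  its norm.\<close>

lemma op_bound_corner:
  assumes W: "op_bound (B*D) W w" and B: "0 < B"
  shows "op_bound D (mat D D (\<lambda>(s,s'). W $$ ((B-1)*D+s, (B-1)*D+s'))) w" (is "op_bound D ?W w")
  unfolding op_bound_def
proof (intro conjI allI)
  show "?W \<in> carrier_mat D D" by simp
  show "0 \<le> w" by (rule op_bound_nonneg[OF W])
  fix u v :: "nat \<Rightarrow> complex"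
  define ext where "ext u i = (if i div D = B - 1 then u (i mod D) else 0)" for u :: "nat \<Rightarrow> complex" and i
  have ext: "ext u (b*D+s) = (if b = B - 1 then u s else 0)" if "s < D" for u b s
    using that by (simp add: ext_def)
  have n: "vnorm (B*D) (ext u) = vnorm D u" for u
  proof -
    have "(vnorm (B*D) (ext u))\<^sup>2 = (\<Sum>b<B. if b = B - 1 then (vnorm D u)\<^sup>2 else 0)"
      unfolding vnorm_block
    proof (rule sum.cong)
      fix b
      have "vnorm D (\<lambda>s. ext u (b*D+s)) = vnorm D (\<lambda>s. if b = B - 1 then u s else 0)"
        by (rule vnorm_cong) (simp add: ext)
      also have "\<dots> = (if b = B - 1 then vnorm D u else 0)" by (simp add: vnorm_def L2_set_0')
      finally show "(vnorm D (\<lambda>s. ext u (b*D+s)))\<^sup>2 = (if b = B - 1 then (vnorm D u)\<^sup>2 else 0)" by simp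
    qed simp
    then show ?thesis using B by (simp add: power2_eq_iff_nonneg)
  qed
  have m: "act (B*D) W (ext v) ((B-1)*D+s) = act D ?W v s" if "s < D" for s
  proof -
    have "act (B*D) W (ext v) ((B-1)*D+s) = (\<Sum>b<B. \<Sum>s'<D. W $$ ((B-1)*D+s, b*D+s') * ext v (b*D+s'))"
      unfolding act_def by (rule sum_lessThan_mult)
    also have "\<dots> = (\<Sum>b<B. if b = B - 1 then act D ?W v s else 0)"
      unfolding act_def using that by (intro sum.cong refl) (auto simp: ext intro!: sum.cong sum.neutral)
    finally show ?thesis using B by simp
  qed
  have "(\<Sum>i<B*D. ext u i * act (B*D) W (ext v) i) = (\<Sum>b<B. \<Sum>s<D. ext u (b*D+s) * act (B*D) W (ext v) (b*D+s))"
    by (rule sum_lessThan_mult)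
  also have "\<dots> = (\<Sum>b<B. if b = B - 1 then (\<Sum>s<D. u s * act D ?W v s) else 0)"
    by (intro sum.cong refl) (auto simp: ext m[unfolded One_nat_def] intro!: sum.cong sum.neutral)
  also have "\<dots> = (\<Sum>s<D. u s * act D ?W v s)" using B by simp
  finally show "cmod (\<Sum>s<D. u s * act D ?W v s) \<le> w * vnorm D u * vnorm D v"
    using op_bound_bound[OF W, of "ext u" "ext v"] by (simp add: n)
qed

text \<open>Dual to the compression: a test of the padded matrix sees only the corner of W.\<close>

lemma tr_bound_ctl0:
  assumes S: "tr_bound D \<sigma> r" and B: "0 < B"
  shows "tr_bound (B*D) (ctl B D 0 \<sigma>) r"
  unfolding tr_bound_def
proof (intro conjI allI impI)
  fix W w assume W: "op_bound (B*D) W w"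
  let ?W = "mat D D (\<lambda>(s,s'). W $$ ((B-1)*D+s, (B-1)*D+s'))"
  have "mtrace (W * ctl B D 0 \<sigma>) = (\<Sum>b<B. \<Sum>s<D. \<Sum>b'<B. \<Sum>s'<D. W $$ (b*D+s,b'*D+s') * ctl B D 0 \<sigma> $$ (b'*D+s', b*D+s))"
    using op_bound_carrier[OF W] by (simp add: mtrace_mult[of _ "B*D"] sum_lessThan_mult)
  also have "\<dots> = (\<Sum>b<B. \<Sum>s<D. \<Sum>b'<B. if b' = b then (if b = B - 1 then (\<Sum>s'<D. W $$ (b*D+s,b*D+s') * \<sigma> $$ (s', s)) else 0) else 0)"
    by (intro sum.cong refl) (auto simp: ctl_index intro!: sum.neutral sum.cong)
  also have "\<dots> = (\<Sum>b<B. if b = B - 1 then (\<Sum>s<D. \<Sum>s'<D. ?W $$ (s,s') * \<sigma> $$ (s', s)) else 0)"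
    by (intro sum.cong refl) (auto intro!: sum.neutral sum.cong)
  also have "\<dots> = mtrace (?W * \<sigma>)"
    using B tr_bound_carrier[OF S] by (subst mtrace_mult[of _ D]) auto
  finally show "cmod (mtrace (W * ctl B D 0 \<sigma>)) \<le> w * r"
    using tr_bound_bound[OF S op_bound_corner[OF W B]] by simp
qed simp

text \<open>The effect on the register of one partial swap with a copy of \<open>\<sigma>\<close> that is traced out
  afterwards: the amplitudes \<open>\<alpha>\<close> and \<open>\<beta>\<close> belong to not swapping and to swapping and depend on the
  value of the control qubit.\<close>
definition swap_channel :: "nat \<Rightarrow> nat \<Rightarrow> complex mat \<Rightarrow> (nat \<Rightarrow> complex) \<Rightarrow> (nat \<Rightarrow> complex) \<Rightarrow> complex mat \<Rightarrow> complex mat" where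
  "swap_channel B D \<sigma> \<alpha> \<beta> \<rho> = mat (B*D) (B*D) (\<lambda>(i,j).
     let b = i div D; s = i mod D; b' = j div D; s' = j mod D in
     \<alpha> b * cnj (\<alpha> b') * \<rho> $$ (i,j)
     + \<alpha> b * cnj (\<beta> b') * (\<Sum>e<D. \<rho> $$ (i, b'*D+e) * \<sigma> $$ (e,s'))
     + \<beta> b * cnj (\<alpha> b') * (\<Sum>e<D. \<sigma> $$ (s,e) * \<rho> $$ (b*D+e, j))
     + \<beta> b * cnj (\<beta> b') * (\<sigma> $$ (s,s') * (\<Sum>e<D. \<rho> $$ (b*D+e, b'*D+e))))"

lemma swap_channel_carrier [simp]: "swap_channel B D \<sigma> \<alpha> \<beta> \<rho> \<in> carrier_mat (B*D) (B*D)"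
  by (simp add: swap_channel_def)

lemma swap_channel_index:
  assumes "b < B" "s < D" "b' < B" "s' < D"
  shows "swap_channel B D \<sigma> \<alpha> \<beta> \<rho> $$ (b*D+s, b'*D+s') =
     \<alpha> b * cnj (\<alpha> b') * \<rho> $$ (b*D+s, b'*D+s')
     + \<alpha> b * cnj (\<beta> b') * (\<Sum>e<D. \<rho> $$ (b*D+s, b'*D+e) * \<sigma> $$ (e,s'))
     + \<beta> b * cnj (\<alpha> b') * (\<Sum>e<D. \<sigma> $$ (s,e) * \<rho> $$ (b*D+e, b'*D+s'))
     + \<beta> b * cnj (\<beta> b') * (\<sigma> $$ (s,s') * (\<Sum>e<D. \<rho> $$ (b*D+e, b'*D+e)))"
  using assms block_index_less[of b B s D] block_index_less[of b' B s' D]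
  by (simp add: swap_channel_def Let_def)

text \<open>Since the swap squares to the identity, exp (-i \<delta> SWAP) = cos \<delta> - i sin
  \<delta> SWAP. \<open>amp0\<close> and \<open>amp1\<close> are these two coefficients when the
  control is on, and 1 and 0 otherwise.\<close>

definition amp0 :: "nat \<Rightarrow> real \<Rightarrow> nat \<Rightarrow> complex" where
  "amp0 B \<delta> b = (if b = B - 1 then of_real (cos \<delta>) else 1)"

definition amp1 :: "nat \<Rightarrow> real \<Rightarrow> nat \<Rightarrow> complex" where
  "amp1 B \<delta> b = (if b = B - 1 then - \<i> * of_real (sin \<delta>) else 0)"

text \<open>Covers the three functions of \<sigma> that occur, namely cos \<delta> - i sin \<delta>
  \<sigma>, \<sigma> and the identity, so that one pair of index lemmas suffices.\<close>

definition affine :: "nat \<Rightarrow> complex mat \<Rightarrow> complex \<Rightarrow> complex \<Rightarrow> complex mat" where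
  "affine D \<sigma> c k = c \<cdot>\<^sub>m 1\<^sub>m D + k \<cdot>\<^sub>m \<sigma>"

lemma affine_carrier [simp]: "\<sigma> \<in> carrier_mat D D \<Longrightarrow> affine D \<sigma> c k \<in> carrier_mat D D"
  by (simp add: affine_def)

lemma act_affine:
  assumes "\<sigma> \<in> carrier_mat D D" "s < D"
  shows "act D (affine D \<sigma> c k) v s = c * v s + k * act D \<sigma> v s"
  using assms by (simp add: affine_def act_add act_smult act_one)

lemma ctl_affine_mult_index:
  assumes "\<sigma> \<in> carrier_mat D D" "M \<in> carrier_mat (B*D) (B*D)" "b < B" "s < D" "j < B * D"
  shows "(ctl B D x (affine D \<sigma> c k) * M) $$ (b*D+s, j) =
    (if b = B - 1 then c else x) * M $$ (b*D+s,j) + (if b = B - 1 then k else 0) * (\<Sum>e<D. \<sigma> $$ (s,e) * M $$ (b*D+e,j))"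
  using assms block_index_less[OF assms(3,4)]
  by (subst mult_index_act[of _ "B*D"]) (auto simp: act_ctl act_affine act_def[of D \<sigma>])

lemma mult_adj_ctl_affine_index:
  assumes "\<sigma> \<in> carrier_mat D D" "adj \<sigma> = \<sigma>" "M \<in> carrier_mat (B*D) (B*D)" "b < B" "s < D" "i < B * D"
  shows "(M * adj (ctl B D x (affine D \<sigma> c k))) $$ (i, b*D+s) =
    cnj (if b = B - 1 then c else x) * M $$ (i,b*D+s) + cnj (if b = B - 1 then k else 0) * (\<Sum>e<D. M $$ (i,b*D+e) * \<sigma> $$ (e,s))"
proof -
  have "cnj (act D \<sigma> (\<lambda>e. cnj (M $$ (i,b*D+e))) s) = (\<Sum>e<D. M $$ (i,b*D+e) * cnj (\<sigma> $$ (s,e)))"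
    by (simp add: act_def mult.commute)
  also have "\<dots> = (\<Sum>e<D. M $$ (i,b*D+e) * \<sigma> $$ (e,s))"
    using adj_eq_self_index[OF assms(1,2) _ assms(5)] by (intro sum.cong) auto
  finally show ?thesis
    using assms block_index_less[OF assms(4,5)]
    by (subst mult_adj_index_act[of _ "B*D"]) (auto simp: act_ctl act_affine)
qed

text \<open>Conjugation by L reproduces the three terms in which at least one side is not swapped.
  Where both sides are swapped, the channel gives \<tau> \<sigma> but the conjugation gives \<sigma>
  \<rho> \<sigma> on the controlled block; the correction of size (sin \<delta>)^2 exchanges the
  two.\<close>

lemma swap_channel_eq:
  fixes \<delta> :: real
  assumes sg: "\<sigma> \<in> carrier_mat D D" "adj \<sigma> = \<sigma>" and R: "\<rho> \<in> carrier_mat (B*D) (B*D)"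
  defines "L \<equiv> ctl B D 1 (affine D \<sigma> (of_real (cos \<delta>)) (- \<i> * of_real (sin \<delta>)))"
    and "S \<equiv> ctl B D 0 (affine D \<sigma> 0 1)"
    and "\<tau> \<equiv> (\<Sum>e<D. \<rho> $$ ((B-1)*D+e, (B-1)*D+e))"
  shows "swap_channel B D \<sigma> (amp0 B \<delta>) (amp1 B \<delta>) \<rho> =
    L * \<rho> * adj L + of_real ((sin \<delta>)\<^sup>2) \<cdot>\<^sub>m (\<tau> \<cdot>\<^sub>m S - S * \<rho> * adj S)"
proof (rule eq_mat_blockI)
  have LS: "L \<in> carrier_mat (B*D) (B*D)" "S \<in> carrier_mat (B*D) (B*D)" by (simp_all add: L_def S_def)
  show "L * \<rho> * adj L + of_real ((sin \<delta>)\<^sup>2) \<cdot>\<^sub>m (\<tau> \<cdot>\<^sub>m S - S * \<rho> * adj S) \<in> carrier_mat (B*D) (B*D)"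
    using LS R by (auto intro!: add_carrier_mat minus_carrier_mat)
  fix b s b' s' assume b: "b < B" "s < D" "b' < B" "s' < D"
  note l = block_index_less[OF b(1,2)] block_index_less[OF b(3,4)]
  have LRS: "L * \<rho> \<in> carrier_mat (B*D) (B*D)" "S * \<rho> \<in> carrier_mat (B*D) (B*D)" using LS R by simp_all
  have LR: "(L * \<rho>) $$ (b*D+s, j) = amp0 B \<delta> b * \<rho> $$ (b*D+s, j) + amp1 B \<delta> b * (\<Sum>e<D. \<sigma> $$ (s,e) * \<rho> $$ (b*D+e,j))"
    if "j < B*D" for j
    unfolding L_def amp0_def amp1_def by (rule ctl_affine_mult_index[OF sg(1) R b(1,2) that])
  have SR: "(S * \<rho>) $$ (b*D+s, j) = (if b = B - 1 then (\<Sum>e<D. \<sigma> $$ (s,e) * \<rho> $$ (b*D+e,j)) else 0)"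
    if "j < B*D" for j
    unfolding S_def using ctl_affine_mult_index[OF sg(1) R b(1,2) that, of 0 0 1] by simp
  have "(L * \<rho> * adj L) $$ (b*D+s, b'*D+s') =
     cnj (amp0 B \<delta> b') * (L * \<rho>) $$ (b*D+s, b'*D+s') + cnj (amp1 B \<delta> b') * (\<Sum>e<D. (L * \<rho>) $$ (b*D+s, b'*D+e) * \<sigma> $$ (e,s'))"
    unfolding amp0_def amp1_def
    by (rule mult_adj_ctl_affine_index[OF sg LRS(1) b(3,4) l(1), where x = 1 and c = "of_real (cos \<delta>)" and k = "- \<i> * of_real (sin \<delta>)", folded L_def])
  also have "\<dots> = cnj (amp0 B \<delta> b') * (amp0 B \<delta> b * \<rho> $$ (b*D+s, b'*D+s') + amp1 B \<delta> b * (\<Sum>e<D. \<sigma> $$ (s,e) * \<rho> $$ (b*D+e,b'*D+s')))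
     + cnj (amp1 B \<delta> b') * (\<Sum>e'<D. (amp0 B \<delta> b * \<rho> $$ (b*D+s, b'*D+e') + amp1 B \<delta> b * (\<Sum>e<D. \<sigma> $$ (s,e) * \<rho> $$ (b*D+e,b'*D+e'))) * \<sigma> $$ (e',s'))"
    using LR l(2) block_index_less[OF b(3)] by (simp del: index_mult_mat(1))
  also have "\<dots> = cnj (amp0 B \<delta> b') * amp0 B \<delta> b * \<rho> $$ (b*D+s, b'*D+s')
     + cnj (amp0 B \<delta> b') * amp1 B \<delta> b * (\<Sum>e<D. \<sigma> $$ (s,e) * \<rho> $$ (b*D+e,b'*D+s'))
     + cnj (amp1 B \<delta> b') * amp0 B \<delta> b * (\<Sum>e'<D. \<rho> $$ (b*D+s, b'*D+e') * \<sigma> $$ (e',s'))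
     + cnj (amp1 B \<delta> b') * amp1 B \<delta> b * (\<Sum>e'<D. (\<Sum>e<D. \<sigma> $$ (s,e) * \<rho> $$ (b*D+e,b'*D+e')) * \<sigma> $$ (e',s'))"
    by (simp add: distrib_left distrib_right sum.distrib mult.assoc flip: sum_distrib_left)
  finally have LL: "(L * \<rho> * adj L) $$ (b*D+s, b'*D+s') = \<dots>" .
  have "(S * \<rho> * adj S) $$ (b*D+s, b'*D+s') =
     cnj (if b' = B - 1 then 0 else 0) * (S * \<rho>) $$ (b*D+s, b'*D+s') + cnj (if b' = B - 1 then 1 else 0) * (\<Sum>e<D. (S * \<rho>) $$ (b*D+s, b'*D+e) * \<sigma> $$ (e,s'))"
    by (rule mult_adj_ctl_affine_index[OF sg LRS(2) b(3,4) l(1), where x = 0 and c = 0 and k = 1, folded S_def])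
  also have "\<dots> = (if b = B - 1 \<and> b' = B - 1 then (\<Sum>e'<D. (\<Sum>e<D. \<sigma> $$ (s,e) * \<rho> $$ (b*D+e,b'*D+e')) * \<sigma> $$ (e',s')) else 0)"
    using SR l(2) block_index_less[OF b(3)] by (simp del: index_mult_mat(1))
  finally have SS: "(S * \<rho> * adj S) $$ (b*D+s, b'*D+s') = \<dots>" .
  have "S $$ (b*D+s, b'*D+s') = (if b = b' \<and> b = B - 1 then \<sigma> $$ (s,s') else 0)"
    unfolding S_def using b sg by (auto simp: ctl_index affine_def)
  then have TS: "(\<tau> \<cdot>\<^sub>m S) $$ (b*D+s, b'*D+s') = (if b = B - 1 \<and> b' = B - 1 then \<sigma> $$ (s,s') * (\<Sum>e<D. \<rho> $$ (b*D+e, b'*D+e)) else 0)"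
    using l LS by (auto simp: \<tau>_def mult.commute)
  have aa: "cnj (amp1 B \<delta> b') * amp1 B \<delta> b = (if b = B - 1 \<and> b' = B - 1 then of_real ((sin \<delta>)\<^sup>2) else 0)"
    by (simp add: amp1_def power2_eq_square complex_eq_iff)
  have "(L * \<rho> * adj L + of_real ((sin \<delta>)\<^sup>2) \<cdot>\<^sub>m (\<tau> \<cdot>\<^sub>m S - S * \<rho> * adj S)) $$ (b*D+s, b'*D+s')
    = (L * \<rho> * adj L) $$ (b*D+s, b'*D+s') + of_real ((sin \<delta>)\<^sup>2) * ((\<tau> \<cdot>\<^sub>m S) $$ (b*D+s, b'*D+s') - (S * \<rho> * adj S) $$ (b*D+s, b'*D+s'))"
    using l LS R by (simp del: index_mult_mat(1))
  also have "\<dots> = swap_channel B D \<sigma> (amp0 B \<delta>) (amp1 B \<delta>) \<rho> $$ (b*D+s, b'*D+s')"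
    unfolding swap_channel_index[OF b] LL SS TS aa
    using aa by (auto simp: algebra_simps)
  finally show "swap_channel B D \<sigma> (amp0 B \<delta>) (amp1 B \<delta>) \<rho> $$ (b*D+s, b'*D+s') =
    (L * \<rho> * adj L + of_real ((sin \<delta>)\<^sup>2) \<cdot>\<^sub>m (\<tau> \<cdot>\<^sub>m S - S * \<rho> * adj S)) $$ (b*D+s, b'*D+s')" ..
qed simp


text \<open>Both expressions are 1 - i \<delta> p up to second order. The cosines contribute
  \<delta>^2, one half from each, and the sines 2 \<delta>^2, which makes 3.\<close>

lemma partial_swap_scalar:
  fixes \<delta> p :: real
  assumes "\<bar>\<delta>\<bar> \<le> 1" "0 \<le> p" "p \<le> 1"
  shows "cmod (of_real (cos \<delta>) - \<i> * of_real (sin \<delta>) * of_real p - exp (- \<i> * of_real (\<delta> * p))) \<le> 3 * \<delta>\<^sup>2"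
proof -
  have s: "\<bar>sin x - x\<bar> \<le> x\<^sup>2" if "\<bar>x\<bar> \<le> 1" for x :: real
  proof -
    have "\<bar>sin x - (\<Sum>m<2. sin_coeff m * x ^ m)\<bar> \<le> inverse (fact 2) * \<bar>x\<bar> ^ 2"
      by (rule Maclaurin_sin_bound)
    then have "\<bar>sin x - x\<bar> \<le> x\<^sup>2 / 2" by (simp add: numeral_2_eq_2 sin_coeff_def)
    then show ?thesis using zero_le_power2[of x] by linarith
  qed
  have c: "\<bar>cos x - 1\<bar> \<le> x\<^sup>2 / 2" for x :: real
  proof -
    have "cos x \<le> 1" by simp
    moreover have "(sin (x / 2))\<^sup>2 \<le> (x / 2)\<^sup>2"
      using abs_sin_x_le_abs_x[of "x / 2"] by (simp only: abs_le_square_iff)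
    then have "1 - x\<^sup>2 / 2 \<le> cos x" using cos_double_sin[of "x / 2"] by (simp add: power_divide)
    ultimately show ?thesis by linarith
  qed
  have p2: "(\<delta> * p)\<^sup>2 \<le> \<delta>\<^sup>2"
    using assms by (simp add: power_mult_distrib mult_left_le power_le_one)
  have dp: "\<bar>\<delta> * p\<bar> \<le> 1" using assms by (simp add: abs_mult mult_le_one)
  have e: "exp (- \<i> * of_real (\<delta> * p)) = of_real (cos (\<delta> * p)) - \<i> * of_real (sin (\<delta> * p))"
    using cis_conv_exp[of "- (\<delta> * p)"] by (simp add: cis.ctr complex_eq_iff)
  have "cmod (of_real (cos \<delta>) - \<i> * of_real (sin \<delta>) * of_real p - exp (- \<i> * of_real (\<delta> * p)))
    = cmod (of_real (cos \<delta> - cos (\<delta> * p)) - \<i> * of_real (p * (sin \<delta> - \<delta>) - (sin (\<delta> * p) - \<delta> * p)))"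
    unfolding e by (simp add: algebra_simps)
  also have "\<dots> \<le> \<bar>cos \<delta> - cos (\<delta> * p)\<bar> + \<bar>p * (sin \<delta> - \<delta>) - (sin (\<delta> * p) - \<delta> * p)\<bar>"
    by (rule order_trans[OF norm_triangle_ineq4]) (simp add: norm_mult del: of_real_diff of_real_mult)
  also have "\<dots> \<le> (\<delta>\<^sup>2 / 2 + \<delta>\<^sup>2 / 2) + (\<delta>\<^sup>2 + \<delta>\<^sup>2)"
  proof (rule add_mono)
    show "\<bar>cos \<delta> - cos (\<delta> * p)\<bar> \<le> \<delta>\<^sup>2 / 2 + \<delta>\<^sup>2 / 2"
      using c[of \<delta>] c[of "\<delta> * p"] p2 by linarith
    have "\<bar>p * (sin \<delta> - \<delta>)\<bar> \<le> 1 * \<delta>\<^sup>2"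
      unfolding abs_mult using assms s[OF assms(1)] by (intro mult_mono) auto
    then show "\<bar>p * (sin \<delta> - \<delta>) - (sin (\<delta> * p) - \<delta> * p)\<bar> \<le> \<delta>\<^sup>2 + \<delta>\<^sup>2"
      using s[OF dp] p2 by linarith
  qed
  finally show ?thesis by simp
qed

definition evolution :: "nat \<Rightarrow> complex mat \<Rightarrow> (nat \<Rightarrow> real) \<Rightarrow> real \<Rightarrow> complex mat" where
  "evolution D U p t = U * diag D (\<lambda>i. exp (- \<i> * of_real (t * p i))) * adj U"

text \<open>With L = V + E and E of norm at most 3 \<delta>^2, the deviation is E \<rho> adj L + V
  \<rho> adj E plus the correction for swapping on both sides. As |\<delta>| \<le> 1, L has norm at
  most 4, and the three parts contribute 12, 3 and 2 to the 17.\<close>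

lemma swap_channel_step_bound:
  fixes \<delta> :: real
  assumes U: "U \<in> carrier_mat D D" "adj U * U = 1\<^sub>m D" "U * adj U = 1\<^sub>m D"
    and p: "\<And>i. i < D \<Longrightarrow> 0 \<le> p i \<and> p i \<le> 1"
    and sg: "\<sigma> = U * diag D (\<lambda>i. complex_of_real (p i)) * adj U"
    and tns: "tr_bound D \<sigma> 1" and d: "\<bar>\<delta>\<bar> \<le> 1" and B: "0 < B" and R: "tr_bound (B*D) \<rho> r"
  defines "V \<equiv> ctl B D 1 (evolution D U p \<delta>)"
  shows "tr_bound (B*D) (swap_channel B D \<sigma> (amp0 B \<delta>) (amp1 B \<delta>) \<rho> - V * \<rho> * adj V) (17 * \<delta>\<^sup>2 * r)"
proof -
  define L where "L = ctl B D 1 (affine D \<sigma> (of_real (cos \<delta>)) (- \<i> * of_real (sin \<delta>)))"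
  define S where "S = ctl B D 0 (affine D \<sigma> 0 1)"
  define \<tau> where "\<tau> = (\<Sum>e<D. \<rho> $$ ((B-1)*D+e, (B-1)*D+e))"
  define f where "f i = of_real (cos \<delta>) - \<i> * of_real (sin \<delta>) * of_real (p i) - exp (- \<i> * of_real (\<delta> * p i))" for i
  define E0 where "E0 = U * diag D f * adj U"
  define E where "E = ctl B D 0 E0"
  note Rc = tr_bound_carrier[OF R]
  have r: "0 \<le> r" by (rule tr_bound_nonneg[OF R])
  have sc: "\<sigma> \<in> carrier_mat D D" "adj \<sigma> = \<sigma>" using U(1) by (simp_all add: sg conj_diag_adj)
  have ev: "evolution D U p \<delta> \<in> carrier_mat D D" using U(1) by (simp add: evolution_def)
  have E0: "E0 \<in> carrier_mat D D" using U(1) by (simp add: E0_def)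
  have c: "V \<in> carrier_mat (B*D) (B*D)" "L \<in> carrier_mat (B*D) (B*D)" "S \<in> carrier_mat (B*D) (B*D)" "E \<in> carrier_mat (B*D) (B*D)"
    by (simp_all add: V_def L_def S_def E_def)
  have affine: "affine D \<sigma> (of_real (cos \<delta>)) (- \<i> * of_real (sin \<delta>)) $$ (i,j) = evolution D U p \<delta> $$ (i,j) + E0 $$ (i,j)"
    if ij: "i < D" "j < D" for i j
  proof -
    have "1\<^sub>m D = U * diag D (\<lambda>_. 1) * adj U" using U by (simp add: diag_one)
    then have "affine D \<sigma> (of_real (cos \<delta>)) (- \<i> * of_real (sin \<delta>)) $$ (i,j)
        = of_real (cos \<delta>) * (U * diag D (\<lambda>_. 1) * adj U) $$ (i,j) - \<i> * of_real (sin \<delta>) * \<sigma> $$ (i,j)"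
      using ij sc U(1) unfolding affine_def by (simp del: index_mult_mat(1))
    then show ?thesis
      unfolding sg evolution_def E0_def conj_diag_index[OF U(1) ij]
      by (simp add: f_def sum_distrib_left sum_subtractf[symmetric] sum.distrib[symmetric] algebra_simps)
  qed
  have LVE: "L = V + E"
  proof (rule eq_mat_blockI)
    fix b s b' s' assume b: "b < B" "s < D" "b' < B" "s' < D"
    show "L $$ (b * D + s, b' * D + s') = (V + E) $$ (b * D + s, b' * D + s')"
      using b block_index_less[OF b(1,2)] block_index_less[OF b(3,4)] c
      by (auto simp: V_def E_def L_def ctl_index affine[unfolded mult_minus_left])
  qed (use c in auto)
  have oV: "op_bound (B*D) V 1" unfolding V_def
    by (rule op_bound_ctl) (auto simp: evolution_def intro!: op_bound_conj_diag U)
  have oE: "op_bound (B*D) E (3 * \<delta>\<^sup>2)" unfolding E_def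
  proof (rule op_bound_ctl)
    show "op_bound D E0 (3 * \<delta>\<^sup>2)" unfolding E0_def
      by (rule op_bound_conj_diag[OF U(1,2)]) (use partial_swap_scalar[OF d] p in \<open>auto simp: f_def\<close>)
  qed simp
  have d2: "\<delta>\<^sup>2 \<le> 1" using d by (simp add: abs_square_le_1)
  have oL: "op_bound (B*D) L 4" unfolding LVE
    by (rule op_bound_mono[OF op_bound_add[OF oV oE]]) (use d2 in simp)
  have lS: "affine D \<sigma> 0 1 = \<sigma>" using sc by (intro eq_matI) (auto simp: affine_def)
  have oS: "op_bound (B*D) S 1" unfolding S_def lS
    by (rule op_bound_ctl) (use p in \<open>auto simp: sg intro!: op_bound_conj_diag U\<close>)
  have tS: "tr_bound (B*D) S 1" unfolding S_def lS by (rule tr_bound_ctl0[OF tns B])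
  \<comment> \<open>\<tau> is the trace of \<rho> against the projection onto the controlled block.
    The projection is a contraction, so the bound needs no positivity of \<rho>.\<close>
  have t\<tau>: "cmod \<tau> \<le> r"
  proof -
    define P where "P = ctl B D 0 (affine D \<sigma> 1 0)"
    have oP: "op_bound (B*D) P 1"
    proof -
      have "affine D \<sigma> 1 0 = 1\<^sub>m D" using sc by (intro eq_matI) (auto simp: affine_def)
      then show ?thesis unfolding P_def by (intro op_bound_ctl) (auto simp: op_bound_one)
    qed
    have P: "P \<in> carrier_mat (B*D) (B*D)" by (simp add: P_def)
    have "mtrace (P * \<rho>) = (\<Sum>b<B. \<Sum>s<D. (P * \<rho>) $$ (b*D+s,b*D+s))"
      unfolding mtrace_def using P by (simp add: sum_lessThan_mult del: index_mult_mat(1))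
    also have "\<dots> = (\<Sum>b<B. \<Sum>s<D. if b = B - 1 then \<rho> $$ (b*D+s,b*D+s) else 0)"
    proof (intro sum.cong refl)
      fix b s assume "b \<in> {..<B}" "s \<in> {..<D}"
      then have b: "b < B" "s < D" by auto
      show "(P * \<rho>) $$ (b*D+s,b*D+s) = (if b = B - 1 then \<rho> $$ (b*D+s,b*D+s) else 0)"
        unfolding P_def by (subst ctl_affine_mult_index[OF sc(1) Rc b block_index_less[OF b]]) simp
    qed
    also have "\<dots> = (\<Sum>b<B. if b = B - 1 then \<tau> else 0)"
      unfolding \<tau>_def by (intro sum.cong refl) (auto intro!: sum.neutral)
    also have "\<dots> = \<tau>" using B by simp
    finally show ?thesis using tr_bound_bound[OF R oP] by simp
  qed
  have ch: "swap_channel B D \<sigma> (amp0 B \<delta>) (amp1 B \<delta>) \<rho> = L * \<rho> * adj L + of_real ((sin \<delta>)\<^sup>2) \<cdot>\<^sub>m (\<tau> \<cdot>\<^sub>m S - S * \<rho> * adj S)"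
    unfolding L_def S_def \<tau>_def by (rule swap_channel_eq[OF sc Rc])
  have aL: "adj L = adj V + adj E" unfolding LVE using c by (intro eq_matI) (auto simp: adj_def)
  have "L * \<rho> * adj L = E * \<rho> * adj L + V * \<rho> * adj L"
  proof -
    have "L * \<rho> * adj L = (V + E) * \<rho> * adj L" by (simp only: LVE)
    also have "\<dots> = (V * \<rho> + E * \<rho>) * adj L" using c Rc by (simp add: add_mult_distrib_mat[of _ "B*D" "B*D"])
    also have "\<dots> = V * \<rho> * adj L + E * \<rho> * adj L"
      using c Rc by (intro add_mult_distrib_mat[of _ "B*D" "B*D"]) auto
    also have "\<dots> = E * \<rho> * adj L + V * \<rho> * adj L"
      using c Rc by (intro comm_add_mat[of _ "B*D" "B*D"]) auto
    finally show ?thesis .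
  qed
  also have "V * \<rho> * adj L = V * \<rho> * adj V + V * \<rho> * adj E"
    unfolding aL using c Rc by (intro mult_add_distrib_mat[of _ "B*D" "B*D"]) auto
  finally have eq: "swap_channel B D \<sigma> (amp0 B \<delta>) (amp1 B \<delta>) \<rho> - V * \<rho> * adj V
    = (E * \<rho> * adj L + V * \<rho> * adj E) + of_real ((sin \<delta>)\<^sup>2) \<cdot>\<^sub>m (\<tau> \<cdot>\<^sub>m S - S * \<rho> * adj S)"
    unfolding ch using c Rc by (intro eq_matI) (auto simp del: index_mult_mat(1))
  have T: "tr_bound (B*D) ((E * \<rho> * adj L + V * \<rho> * adj E) + of_real ((sin \<delta>)\<^sup>2) \<cdot>\<^sub>m (\<tau> \<cdot>\<^sub>m S - S * \<rho> * adj S)) ((4 * (3 * \<delta>\<^sup>2 * r) + 3 * \<delta>\<^sup>2 * (1 * r)) + cmod (of_real ((sin \<delta>)\<^sup>2)) * (cmod \<tau> * 1 + 1 * (1 * r)))"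
    by (intro tr_bound_add tr_bound_smult tr_bound_diff tr_bound_right tr_bound_left op_bound_adj oL oV oE oS tS R)
  have le: "(4 * (3 * \<delta>\<^sup>2 * r) + 3 * \<delta>\<^sup>2 * (1 * r)) + cmod (of_real ((sin \<delta>)\<^sup>2)) * (cmod \<tau> * 1 + 1 * (1 * r)) \<le> 17 * \<delta>\<^sup>2 * r"
  proof -
    have "(sin \<delta>)\<^sup>2 \<le> \<delta>\<^sup>2" using abs_sin_x_le_abs_x[of \<delta>] by (simp add: abs_le_square_iff)
    then have "(sin \<delta>)\<^sup>2 * (cmod \<tau> + r) \<le> \<delta>\<^sup>2 * (r + r)"
      using t\<tau> r by (intro mult_mono) auto
    then have "(sin \<delta>)\<^sup>2 * cmod \<tau> + (sin \<delta>)\<^sup>2 * r \<le> \<delta>\<^sup>2 * r + \<delta>\<^sup>2 * r"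
      by (simp only: distrib_left)
    then show ?thesis by (simp only: norm_of_real abs_power2 mult_1 mult_1_right distrib_left)
  qed
  show ?thesis unfolding eq by (rule tr_bound_mono[OF T le])
qed

section \<open>Accumulation of the error over the steps\<close>

lemma evolution_carrier [simp]: "U \<in> carrier_mat D D \<Longrightarrow> evolution D U p t \<in> carrier_mat D D"
  by (simp add: evolution_def)

lemma evolution_add:
  assumes "U \<in> carrier_mat D D" "adj U * U = 1\<^sub>m D"
  shows "evolution D U p s * evolution D U p t = evolution D U p (s + t)"
  unfolding evolution_def conj_diag_mult[OF assms]
  by (simp add: exp_add[symmetric] algebra_simps)

lemma op_bound_ctl_evolution:
  assumes "U \<in> carrier_mat D D" "adj U * U = 1\<^sub>m D"
  shows "op_bound (B*D) (ctl B D 1 (evolution D U p t)) 1"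
  by (rule op_bound_ctl) (auto simp: evolution_def intro!: op_bound_conj_diag assms)

text \<open>Telescoping against the unitary evolution only uses that conjugation by a unitary does not
  increase the trace norm; the intermediate states are not known to be density matrices, whence
  the geometric growth.\<close>
lemma swap_channel_iterate_bound:
  fixes \<delta> :: real
  assumes U: "U \<in> carrier_mat D D" "adj U * U = 1\<^sub>m D" "U * adj U = 1\<^sub>m D"
    and p: "\<And>i. i < D \<Longrightarrow> 0 \<le> p i \<and> p i \<le> 1"
    and sg: "\<sigma> = U * diag D (\<lambda>i. complex_of_real (p i)) * adj U"
    and tns: "tr_bound D \<sigma> 1" and d: "\<bar>\<delta>\<bar> \<le> 1" and B: "0 < B" and R: "tr_bound (B*D) \<rho> 1"
  shows "tr_bound (B*D) ((swap_channel B D \<sigma> (amp0 B \<delta>) (amp1 B \<delta>) ^^ j) \<rho>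
     - ctl B D 1 (evolution D U p (real j * \<delta>)) * \<rho> * adj (ctl B D 1 (evolution D U p (real j * \<delta>)))) ((1 + 17 * \<delta>\<^sup>2) ^ j - 1)"
proof (induction j)
  case 0
  have "ctl B D 1 (evolution D U p 0) = 1\<^sub>m (B*D)"
  proof -
    have "evolution D U p 0 = 1\<^sub>m D" using U by (simp add: evolution_def diag_one)
    moreover have "b * D + s = b' * D + s' \<longleftrightarrow> b = b' \<and> s = s'" if "s < D" "s' < D" for b s b' s'
      using that by (metis add_left_cancel block_index_div)
    ultimately show ?thesis
      by (intro eq_mat_blockI[of _ B D]) (auto simp: ctl_index block_index_less)
  qed
  moreover have "\<rho> - \<rho> = 0 \<cdot>\<^sub>m \<rho>" using tr_bound_carrier[OF R] by (intro eq_matI) auto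
  ultimately show ?case using tr_bound_smult[OF R, of 0] tr_bound_carrier[OF R] by simp
next
  case (Suc j)
  let ?\<Phi> = "swap_channel B D \<sigma> (amp0 B \<delta>) (amp1 B \<delta>)"
  let ?K = "17 * \<delta>\<^sup>2"
  define V where "V = ctl B D 1 (evolution D U p \<delta>)"
  define Vj where "Vj = ctl B D 1 (evolution D U p (real j * \<delta>))"
  define X where "X = Vj * \<rho> * adj Vj"
  define \<rho>j where "\<rho>j = (?\<Phi> ^^ j) \<rho>"
  have oV: "op_bound (B*D) V 1" and oVj: "op_bound (B*D) Vj 1" unfolding V_def Vj_def by (intro op_bound_ctl_evolution U)+
  have V: "V \<in> carrier_mat (B*D) (B*D)" "Vj \<in> carrier_mat (B*D) (B*D)" by (simp_all add: V_def Vj_def)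
  have Rc: "\<rho> \<in> carrier_mat (B*D) (B*D)" by (rule tr_bound_carrier[OF R])
  have IH: "tr_bound (B*D) (\<rho>j - X) ((1 + ?K) ^ j - 1)" using Suc.IH unfolding \<rho>j_def X_def Vj_def .
  have tX: "tr_bound (B*D) X 1" unfolding X_def using tr_bound_right[OF op_bound_adj[OF oVj] tr_bound_left[OF oVj R]] by simp
  have rc: "\<rho>j \<in> carrier_mat (B*D) (B*D)" unfolding \<rho>j_def using Rc by (cases j) auto
  have Xc: "X \<in> carrier_mat (B*D) (B*D)" by (rule tr_bound_carrier[OF tX])
  \<comment> \<open>The norm of the actual state is controlled by that of the ideal state X, at most
    1, and the error so far; it enters the bound of the next step as a factor.\<close>
  have "\<rho>j = (\<rho>j - X) + X" using rc Xc by (intro eq_matI) auto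
  then have tr: "tr_bound (B*D) \<rho>j ((1 + ?K) ^ j)" using tr_bound_add[OF IH tX] by simp
  have 1: "tr_bound (B*D) (?\<Phi> \<rho>j - V * \<rho>j * adj V) (?K * (1 + ?K) ^ j)"
    unfolding V_def by (rule swap_channel_step_bound[OF U p sg tns d B tr])
  have 2: "tr_bound (B*D) (V * (\<rho>j - X) * adj V) ((1 + ?K) ^ j - 1)"
    using tr_bound_right[OF op_bound_adj[OF oV] tr_bound_left[OF oV IH]] by simp
  have VV: "ctl B D 1 (evolution D U p (real (Suc j) * \<delta>)) = V * Vj"
    unfolding V_def Vj_def using U by (simp add: ctl_mult evolution_add algebra_simps)
  have "V * X * adj V = (V * Vj) * \<rho> * adj (V * Vj)"
    using V Rc by (simp add: X_def adj_mult[of _ "B*D" "B*D" _ "B*D"] assoc_mult_mat[of _ "B*D" "B*D" _ "B*D" _ "B*D"])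
  moreover have "V * (\<rho>j - X) * adj V = V * \<rho>j * adj V - V * X * adj V"
    using V(1) rc Xc mult_minus_distrib_mat[OF V(1) rc Xc] minus_mult_distrib_mat[of "V * \<rho>j" "B*D" "B*D" "V * X" "adj V" "B*D"] by simp
  ultimately have "?\<Phi> \<rho>j - (V * Vj) * \<rho> * adj (V * Vj) = (?\<Phi> \<rho>j - V * \<rho>j * adj V) + V * (\<rho>j - X) * adj V"
    using V rc Xc by (intro eq_matI) (auto simp del: index_mult_mat(1))
  \<comment> \<open>With a = (1 + K)^j the new error is K a + (a - 1) = (1 + K) a - 1, which is the
    claimed form for the next step.\<close>
  then have "tr_bound (B*D) (?\<Phi> \<rho>j - (V * Vj) * \<rho> * adj (V * Vj)) (?K * (1 + ?K) ^ j + ((1 + ?K) ^ j - 1))"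
    using tr_bound_add[OF 1 2] by simp
  then show ?case unfolding VV by (simp add: \<rho>j_def algebra_simps)
qed

subsection \<open>Gates as maps on basis indices\<close>

text \<open>Qubits are numbered from the most significant end and bits from the least. In particular
  the last qubit, which will be the ancilla in |+>, is bit 0.\<close>

lemma qbit_eq_bit: "qbit N x k = of_bool (bit x (N - 1 - k))"
  by (simp add: qbit_def bit_iff_odd mod2_eq_if)

lemma qbit_iffs:
  "qbit N x k = qbit N y l \<longleftrightarrow> bit x (N - 1 - k) = bit y (N - 1 - l)"
  "qbit N x k = 1 \<longleftrightarrow> bit x (N - 1 - k)"
  by (simp_all add: qbit_eq_bit)

lemma less_exp_iff_bits: "(x::nat) < 2 ^ N \<longleftrightarrow> (\<forall>p\<ge>N. \<not> bit x p)"
proof -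
  have "x < 2 ^ N \<longleftrightarrow> take_bit N x = x" by (simp add: take_bit_nat_eq_self_iff)
  also have "\<dots> \<longleftrightarrow> (\<forall>p\<ge>N. \<not> bit x p)"
  proof
    assume e: "take_bit N x = x"
    show "\<forall>p\<ge>N. \<not> bit x p"
    proof (intro allI impI)
      fix p assume "N \<le> p"
      then have "\<not> bit (take_bit N x) p" by (simp add: bit_take_bit_iff)
      then show "\<not> bit x p" unfolding e .
    qed
  next
    assume "\<forall>p\<ge>N. \<not> bit x p"
    then show "take_bit N x = x"
      by (intro bit_eqI) (metis bit_take_bit_iff linorder_not_le)
  qed
  finally show ?thesis .
qed

lemma bits_eqI_less:
  assumes "(x::nat) < 2 ^ N" "y < 2 ^ N" "\<And>k. k < N \<Longrightarrow> bit x (N - 1 - k) = bit y (N - 1 - k)"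
  shows "x = y"
proof (rule bit_eqI)
  fix p
  show "bit x p = bit y p"
  proof (cases "p < N")
    case True
    then have "N - 1 - (N - 1 - p) = p" "N - 1 - p < N" by auto
    then show ?thesis using assms(3) by metis
  next
    case False
    then show ?thesis using assms(1,2) by (simp add: less_exp_iff_bits)
  qed
qed

lemma bit_block:
  assumes "(w::nat) < 2 ^ l"
  shows "bit (h * 2 ^ l + w) p = (if p < l then bit w p else bit h (p - l))"
proof (cases "p < l")
  case True
  then obtain t where l: "l = p + Suc t" using less_imp_Suc_add by auto
  have "h * 2 ^ l + w = w + (h * 2 ^ Suc t) * 2 ^ p" by (simp add: l power_add)
  then have "(h * 2 ^ l + w) div 2 ^ p = h * 2 ^ Suc t + w div 2 ^ p"
    by (simp only: div_mult_self1[OF power_not_zero[OF zero_neq_numeral[symmetric]]])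
  then show ?thesis using True by (simp add: bit_iff_odd)
next
  case False
  then obtain u where p: "p = l + u" using le_Suc_ex linorder_not_less by blast
  have "(h * 2 ^ l + w) div 2 ^ p = (h * 2 ^ l + w) div 2 ^ l div 2 ^ u"
    by (simp only: p power_add div_mult2_eq)
  also have "(h * 2 ^ l + w) div 2 ^ l = h" using assms by simp
  finally show ?thesis using False p by (simp add: bit_iff_odd)
qed

text \<open>If the two bits differ, exchanging them means flipping both.\<close>

definition bit_swap :: "nat \<Rightarrow> nat \<Rightarrow> nat \<Rightarrow> nat" where
  "bit_swap a b x = (if bit x a = bit x b then x else flip_bit a (flip_bit b x))"

lemma bit_bit_swap: "bit (bit_swap a b x) p = bit x (if p = a then b else if p = b then a else p)"
  by (auto simp: bit_swap_def bit_flip_bit_iff)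

lemma bit_swap_less: "a < N \<Longrightarrow> b < N \<Longrightarrow> x < 2 ^ N \<Longrightarrow> bit_swap a b x < 2 ^ N"
  unfolding less_exp_iff_bits by (auto simp: bit_bit_swap)

lemma set_bit_less: "p < N \<Longrightarrow> x < 2 ^ N \<Longrightarrow> set_bit p (x::nat) < 2 ^ N"
  unfolding less_exp_iff_bits by (auto simp: bit_set_bit_iff)

lemma unset_bit_less: "x < 2 ^ N \<Longrightarrow> unset_bit p (x::nat) < 2 ^ N"
  unfolding less_exp_iff_bits by (auto simp: bit_unset_bit_iff)

lemma set_bit_eq: "bit x p \<Longrightarrow> set_bit p (x::nat) = x"
  by (rule bit_eqI) (auto simp: bit_set_bit_iff)

lemma unset_bit_eq: "\<not> bit x p \<Longrightarrow> unset_bit p (x::nat) = x"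
  by (rule bit_eqI) (auto simp: bit_unset_bit_iff)

section \<open>Action of gates and circuits on amplitude vectors\<close>

lemma act_cong: "(\<And>j. j < d \<Longrightarrow> v j = w j) \<Longrightarrow> act d A v i = act d A w i"
  unfolding act_def by (rule sum.cong) auto

lemma gate_mat_carrier [simp]: "gate_mat N g \<in> carrier_mat (2^N) (2^N)"
  by (cases g) auto

lemma circuit_mat_carrier [simp]: "circuit_mat N gs \<in> carrier_mat (2^N) (2^N)"
  by (induction gs) (auto intro!: mult_square_carrier simp del: mult_square_carrier)

lemma circuit_mat_append: "circuit_mat N (gs @ hs) = circuit_mat N hs * circuit_mat N gs"
  by (induction gs) (simp_all add: assoc_mult_mat[of _ "2^N" "2^N" _ "2^N" _ "2^N"])

lemma act_circuit_Cons: "i < 2^N \<Longrightarrow> act (2^N) (circuit_mat N (g # gs)) \<psi> i = act (2^N) (circuit_mat N gs) (act (2^N) (gate_mat N g) \<psi>) i"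
  by (simp add: act_mult)

lemma act_circuit_append: "i < 2^N \<Longrightarrow> act (2^N) (circuit_mat N (gs @ hs)) \<psi> i = act (2^N) (circuit_mat N hs) (act (2^N) (circuit_mat N gs) \<psi>) i"
  by (simp add: circuit_mat_append act_mult)

lemma act_circuit_single: "i < 2^N \<Longrightarrow> act (2^N) (circuit_mat N [g]) \<psi> i = act (2^N) (gate_mat N g) \<psi> i"
  by simp

text \<open>The gate is an involutive permutation of basis indices, so row X has its only 1 in the
  column of the swapped index. The gate reads its controls off the column; as controls are not
  targets, they agree with those of X.\<close>

lemma act_CFredkin:
  assumes wf: "wf_gate N (CFredkin c1 c2 a b)" and X: "X < 2 ^ N"
  shows "act (2^N) (gate_mat N (CFredkin c1 c2 a b)) \<psi> X =
    \<psi> (if bit X (N-1-c1) \<and> bit X (N-1-c2) then bit_swap (N-1-a) (N-1-b) X else X)" (is "_ = \<psi> ?Y")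
proof -
  have lt: "c1 < N" "c2 < N" "a < N" "b < N" and ne: "c1 \<noteq> a" "c1 \<noteq> b" "c2 \<noteq> a" "c2 \<noteq> b" "a \<noteq> b"
    using wf by auto
  have inj: "N - 1 - x = N - 1 - y \<longleftrightarrow> x = y" if "x < N" "y < N" for x y using that by auto
  have Y: "?Y < 2 ^ N" using X lt by (auto intro!: bit_swap_less)
  have bY: "bit ?Y (N-1-k) = (if bit X (N-1-c1) \<and> bit X (N-1-c2) then bit X (if k = a then N-1-b else if k = b then N-1-a else N-1-k) else bit X (N-1-k))"
    if "k < N" for k
  proof (cases "bit X (N-1-c1) \<and> bit X (N-1-c2)")
    case True
    then show ?thesis by (simp only: if_True bit_bit_swap inj[OF that lt(3)] inj[OF that lt(4)] simp_thms)
  next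
    case False
    then show ?thesis by (simp only: if_False)
  qed
  have "gate_mat N (CFredkin c1 c2 a b) $$ (X,u) = (if u = ?Y then 1 else 0)" if u: "u < 2 ^ N" for u
  proof -
    have "((\<forall>k<N. k \<noteq> a \<and> k \<noteq> b \<longrightarrow> qbit N X k = qbit N u k) \<and>
         (if qbit N u c1 = 1 \<and> qbit N u c2 = 1
          then qbit N X a = qbit N u b \<and> qbit N X b = qbit N u a
          else qbit N X a = qbit N u a \<and> qbit N X b = qbit N u b)) \<longleftrightarrow> u = ?Y" (is "?C \<longleftrightarrow> _")
    proof
      assume C: ?C
      then have o: "\<And>k. k < N \<Longrightarrow> k \<noteq> a \<Longrightarrow> k \<noteq> b \<Longrightarrow> bit X (N-1-k) = bit u (N-1-k)"
        unfolding qbit_iffs by blast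
      have cc: "bit X (N-1-c1) = bit u (N-1-c1)" "bit X (N-1-c2) = bit u (N-1-c2)" by (intro o lt ne)+
      have C2: "if bit X (N-1-c1) \<and> bit X (N-1-c2)
          then bit X (N-1-a) = bit u (N-1-b) \<and> bit X (N-1-b) = bit u (N-1-a)
          else bit X (N-1-a) = bit u (N-1-a) \<and> bit X (N-1-b) = bit u (N-1-b)"
        using C unfolding qbit_iffs cc by blast
      show "u = ?Y"
      proof (rule bits_eqI_less[OF u Y])
        fix k assume k: "k < N"
        consider "k = a" | "k = b" | "k \<noteq> a" "k \<noteq> b" by blast
        then show "bit u (N - 1 - k) = bit ?Y (N - 1 - k)"
        proof cases
          case 1
          then show ?thesis using C2 unfolding bY[OF k] by (auto simp only: split: if_splits)
        next
          case 2
          then show ?thesis using C2 ne(5) unfolding bY[OF k] by (auto simp only: split: if_splits)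
        next
          case 3
          then show ?thesis using o[OF k 3] unfolding bY[OF k] by (simp only: if_False if_cancel)
        qed
      qed
    next
      assume e: "u = ?Y"
      note b = bY[folded e]
      show ?C
        unfolding qbit_iffs
      proof (intro conjI allI impI)
        fix k assume "k < N" "k \<noteq> a \<and> k \<noteq> b"
        then show "bit X (N - 1 - k) = bit u (N - 1 - k)" by (simp only: b if_False if_cancel)
      next
        have "bit u (N-1-c1) = bit X (N-1-c1)" "bit u (N-1-c2) = bit X (N-1-c2)"
          using ne by (simp_all only: b[OF lt(1)] b[OF lt(2)] if_False if_cancel)
        moreover have "bit u (N-1-a) = (if bit X (N-1-c1) \<and> bit X (N-1-c2) then bit X (N-1-b) else bit X (N-1-a))"
          "bit u (N-1-b) = (if bit X (N-1-c1) \<and> bit X (N-1-c2) then bit X (N-1-a) else bit X (N-1-b))"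
          using ne by (simp_all only: b[OF lt(3)] b[OF lt(4)] refl if_False if_True not_sym[OF ne(5)] simp_thms eq_commute[of b a])
        ultimately show "if bit u (N-1-c1) \<and> bit u (N-1-c2)
          then bit X (N-1-a) = bit u (N-1-b) \<and> bit X (N-1-b) = bit u (N-1-a)
          else bit X (N-1-a) = bit u (N-1-a) \<and> bit X (N-1-b) = bit u (N-1-b)"
          by (simp only: if_True if_False split: if_split) blast
      qed
    qed
    then show ?thesis using X u by simp
  qed
  then have "act (2^N) (gate_mat N (CFredkin c1 c2 a b)) \<psi> X = (\<Sum>u<2^N. if u = ?Y then \<psi> u else 0)"
    unfolding act_def by (intro sum.cong refl) (simp del: gate_mat.simps)
  then show ?thesis using Y by simp
qed

text \<open>Row X can be nonzero only in the two columns that agree with X outside the bit of qubit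
  j.\<close>

lemma act_Gate1:
  assumes j: "j < N" and X: "X < 2 ^ N"
  shows "act (2^N) (gate_mat N (Gate1 U j)) \<psi> X =
    U $$ (of_bool (bit X (N-1-j)), 0) * \<psi> (unset_bit (N-1-j) X) + U $$ (of_bool (bit X (N-1-j)), 1) * \<psi> (set_bit (N-1-j) X)"
proof -
  let ?p = "N - 1 - j"
  let ?A = "{unset_bit ?p X, set_bit ?p X}"
  have ne: "unset_bit ?p X \<noteq> set_bit ?p X"
    by (metis bit_set_bit_iff bit_unset_bit_iff possible_bit_nat)
  have A: "?A \<subseteq> {..<2^N}" using j X by (auto intro!: unset_bit_less set_bit_less)
  have inj: "N - 1 - x = N - 1 - y \<longleftrightarrow> x = y" if "x < N" "y < N" for x y using that by auto
  have iff: "(\<forall>k<N. k \<noteq> j \<longrightarrow> qbit N X k = qbit N u k) \<longleftrightarrow> u \<in> ?A" if u: "u < 2 ^ N" for u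
  proof
    assume "\<forall>k<N. k \<noteq> j \<longrightarrow> qbit N X k = qbit N u k"
    then have o: "\<And>k. k < N \<Longrightarrow> k \<noteq> j \<Longrightarrow> bit X (N-1-k) = bit u (N-1-k)" unfolding qbit_iffs by blast
    have "u = (if bit u ?p then set_bit ?p X else unset_bit ?p X)" (is "_ = ?Y")
    proof (rule bits_eqI_less[OF u])
      show "?Y < 2 ^ N" using A by auto
      fix k assume k: "k < N"
      show "bit u (N - 1 - k) = bit ?Y (N - 1 - k)"
        using o[OF k] inj[OF k j] by (auto simp: bit_set_bit_iff bit_unset_bit_iff)
    qed
    then show "u \<in> ?A" by (metis insertCI)
  next
    assume "u \<in> ?A"
    then show "\<forall>k<N. k \<noteq> j \<longrightarrow> qbit N X k = qbit N u k"
      unfolding qbit_iffs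
    proof (intro allI impI)
      fix k assume "k < N" "k \<noteq> j"
      then have "?p \<noteq> N - 1 - k" using j by linarith
      then show "bit X (N - 1 - k) = bit u (N - 1 - k)"
        using \<open>u \<in> ?A\<close> by (auto simp: bit_set_bit_iff bit_unset_bit_iff)
    qed
  qed
  have "act (2^N) (gate_mat N (Gate1 U j)) \<psi> X = (\<Sum>u<2^N. if u \<in> ?A then U $$ (qbit N X j, qbit N u j) * \<psi> u else 0)"
    unfolding act_def using X by (intro sum.cong refl) (auto simp: iff simp del: insert_iff)
  also have "\<dots> = (\<Sum>u\<in>?A. U $$ (qbit N X j, qbit N u j) * \<psi> u)"
    using A by (simp add: sum.If_cases Int_absorb1 Int_commute del: insert_iff)
  also have "\<dots> = U $$ (of_bool (bit X ?p), 0) * \<psi> (unset_bit ?p X) + U $$ (of_bool (bit X ?p), 1) * \<psi> (set_bit ?p X)"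
    using ne by (simp add: qbit_eq_bit bit_set_bit_iff bit_unset_bit_iff)
  finally show ?thesis .
qed

text \<open>Interchanges the \<open>r\<close> leading bits of the two blocks of \<open>q\<close> bits starting at the positions
  \<open>A\<close> and \<open>l\<close>.\<close>
fun block_swap :: "nat \<Rightarrow> nat \<Rightarrow> nat \<Rightarrow> nat \<Rightarrow> nat \<Rightarrow> nat" where
  "block_swap q A l 0 X = X"
| "block_swap q A l (Suc r) X = block_swap q A l r (bit_swap (A + (q-1-r)) (l + (q-1-r)) X)"

text \<open>Both sides read a bit of X at a relocated position, so the claim reduces to composing
  the relocation for r with one transposition.\<close>

lemma bit_block_swap:
  assumes "r \<le> q" "l + q \<le> A"
  shows "bit (block_swap q A l r X) p = bit X (if A + q - r \<le> p \<and> p < A + q then p - A + l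
     else if l + q - r \<le> p \<and> p < l + q then p - l + A else p)"
  using assms(1)
proof (induction r arbitrary: X)
  case 0
  then show ?case by auto
next
  case (Suc r)
  let ?\<pi> = "\<lambda>r p. if A + q - r \<le> p \<and> p < A + q then p - A + l
     else if l + q - r \<le> p \<and> p < l + q then p - l + A else p"
  let ?a = "A + (q-1-r)" and ?b = "l + (q-1-r)"
  have "bit (block_swap q A l (Suc r) X) p = bit (bit_swap ?a ?b X) (?\<pi> r p)"
    using Suc.IH[of "bit_swap ?a ?b X"] Suc.prems by simp
  also have "\<dots> = bit X (if ?\<pi> r p = ?a then ?b else if ?\<pi> r p = ?b then ?a else ?\<pi> r p)"
    by (rule bit_bit_swap)
  also have "(if ?\<pi> r p = ?a then ?b else if ?\<pi> r p = ?b then ?a else ?\<pi> r p) = ?\<pi> (Suc r) p"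
  proof -
    obtain t where t: "q = Suc (r + t)" using Suc.prems less_iff_Suc_add by (metis Suc_le_eq)
    obtain m where m: "A = l + q + m" using assms(2) le_Suc_ex by blast
    \<comment> \<open>Positions are split at the transposed pair A + t, l + t and at the ends of the
      blocks. Within a block, those above the pair are exchanged by the recursive call.\<close>
    consider "A + Suc t \<le> p" "p < A + q" | "p = A + t" | "l + Suc t \<le> p" "p < l + q" | "p = l + t"
      | "p < l + t" | "l + q \<le> p" "p < A + t" | "A + q \<le> p" by linarith
    then show ?thesis by cases (auto simp: m t dest!: le_Suc_ex)
  qed
  finally show ?case .
qed

lemma bit_block_swap_full:
  assumes "l + q \<le> A"
  shows "bit (block_swap q A l q X) p = bit X (if A \<le> p \<and> p < A + q then p - A + l
     else if l \<le> p \<and> p < l + q then p - l + A else p)"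
  using bit_block_swap[OF order_refl assms] by simp

lemma block_swap_less: "r \<le> q \<Longrightarrow> A + q \<le> N \<Longrightarrow> l + q \<le> A \<Longrightarrow> X < 2 ^ N \<Longrightarrow> block_swap q A l r X < 2 ^ N"
  unfolding less_exp_iff_bits by (auto simp: bit_block_swap)

lemma block_swap_involution: "l + q \<le> A \<Longrightarrow> block_swap q A l q (block_swap q A l q X) = X"
  by (rule bit_eqI) (auto simp: bit_block_swap_full)

text \<open>As \<open>0 < l\<close>, both blocks lie above bit 0: the ancilla is not moved.\<close>

lemma block_swap_set_bit0: "l + q \<le> A \<Longrightarrow> 0 < l \<Longrightarrow> block_swap q A l q (set_bit 0 X) = set_bit 0 (block_swap q A l q X)"
  by (rule bit_eqI) (auto simp: bit_block_swap_full bit_set_bit_iff)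

lemma block_swap_unset_bit0: "l + q \<le> A \<Longrightarrow> 0 < l \<Longrightarrow> block_swap q A l q (unset_bit 0 X) = unset_bit 0 (block_swap q A l q X)"
  by (rule bit_eqI) (auto simp: bit_block_swap_full bit_unset_bit_iff)

lemma bit_blocks:
  assumes "(s::nat) < 2^q" "d < 2^m" "e < 2^q" "w < 2^l"
  shows "bit ((((b * 2^q + s) * 2^m + d) * 2^q + e) * 2^l + w) p =
    (if p < l then bit w p else if p < l + q then bit e (p - l)
     else if p < l + q + m then bit d (p - (l + q)) else if p < l + q + m + q then bit s (p - (l + q + m))
     else bit b (p - (l + q + m + q)))"
proof -
  have "p - l < q \<longleftrightarrow> p < l + q" if "\<not> p < l" using that by linarith
  moreover have "p - l - q < m \<longleftrightarrow> p < l + q + m" if "\<not> p < l + q" using that by linarith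
  moreover have "p - l - q - m < q \<longleftrightarrow> p < l + q + m + q" if "\<not> p < l + q + m" using that by linarith
  ultimately show ?thesis
    unfolding bit_block[OF assms(4)] bit_block[OF assms(3)] bit_block[OF assms(2)] bit_block[OF assms(1)] diff_diff_left
    by presburger
qed

lemma block_swap_blocks:
  assumes "(s::nat) < 2^q" "d < 2^m" "e < 2^q" "w < 2^l"
  shows "block_swap q (l + q + m) l q ((((b * 2^q + s) * 2^m + d) * 2^q + e) * 2^l + w)
    = (((b * 2^q + e) * 2^m + d) * 2^q + s) * 2^l + w"
proof (rule bit_eqI)
  fix p
  let ?p = "if l + q + m \<le> p \<and> p < l + q + m + q then p - (l + q + m) + l else if l \<le> p \<and> p < l + q then p - l + (l + q + m) else p"
  consider "p < l" | "l \<le> p" "p < l + q" | "l + q \<le> p" "p < l + q + m"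
    | "l + q + m \<le> p" "p < l + q + m + q" | "l + q + m + q \<le> p" by linarith
  then show "bit (block_swap q (l + q + m) l q ((((b * 2^q + s) * 2^m + d) * 2^q + e) * 2^l + w)) p
    = bit ((((b * 2^q + e) * 2^m + d) * 2^q + s) * 2^l + w) p"
    unfolding bit_block_swap_full[OF le_add1] bit_blocks[OF assms] bit_blocks[OF assms(3,2,1,4)]
    by cases (auto dest!: le_Suc_ex)
qed

subsection \<open>A controlled partial swap as a circuit\<close>

lemma circuit_mat_single: "circuit_mat N [g] = gate_mat N g"
  by (simp only: circuit_mat.simps one_mult_square(1)[OF gate_mat_carrier])

text \<open>The prefix length r is a parameter for the induction only; a full swap has
  \<open>r = q\<close>.\<close>

definition copy_swap :: "nat \<Rightarrow> nat \<Rightarrow> nat \<Rightarrow> nat \<Rightarrow> nat \<Rightarrow> gate list" where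
  "copy_swap N c sys cpy r = map (\<lambda>i. CFredkin c (N-1) (sys + i) (cpy + i)) [0..<r]"

definition rotX :: "real \<Rightarrow> complex mat" where
  "rotX \<delta> = mat 2 2 (\<lambda>(i,j). if i = j then of_real (cos \<delta>) else - \<i> * of_real (sin \<delta>))"

definition phase0 :: "real \<Rightarrow> complex mat" where
  "phase0 \<delta> = mat 2 2 (\<lambda>(i,j). if i = j then (if i = 0 then exp (\<i> * of_real \<delta>) else 1) else 0)"

text \<open>On the ancilla state \<open>|+\<rangle>\<close> the rotation \<open>exp (-i\<delta>X)\<close> between two controlled
  swaps acts as \<open>exp (-i\<delta>X \<otimes> SWAP)\<close>, that is as \<open>exp (-i\<delta>SWAP)\<close>; the phase gate cancels the phase
  that \<open>exp (-i\<delta>X)\<close> leaves behind when the control is \<open>0\<close>.\<close>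
definition step_circuit :: "nat \<Rightarrow> nat \<Rightarrow> nat \<Rightarrow> nat \<Rightarrow> nat \<Rightarrow> real \<Rightarrow> gate list" where
  "step_circuit N c sys cpy q \<delta> = copy_swap N c sys cpy q @ [Gate1 (rotX \<delta>) (N-1)] @ copy_swap N c sys cpy q @ [Gate1 (phase0 \<delta>) c]"

text \<open>The amplitude at X is fetched from the preimage of X, so the gate applied last moves the
  index first; \<open>block_swap\<close> recurses in the same order. The controls lie outside both
  blocks and keep their values.\<close>

lemma act_copy_swap:
  assumes "c < N - 1" "sys + q \<le> cpy" "cpy + q \<le> N - 1" "c < sys \<or> cpy + q \<le> c" "r \<le> q" "X < 2 ^ N"
  shows "act (2^N) (circuit_mat N (copy_swap N c sys cpy r)) \<psi> X =
    \<psi> (if bit X (N-1-c) \<and> bit X 0 then block_swap q (N - sys - q) (N - cpy - q) r X else X)"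
  using assms(5,6)
proof (induction r arbitrary: X)
  case 0
  then show ?case by (simp add: copy_swap_def act_one)
next
  case (Suc r)
  let ?g = "CFredkin c (N-1) (sys + r) (cpy + r)"
  let ?A = "N - sys - q" and ?l = "N - cpy - q"
  let ?a = "?A + (q-1-r)" and ?b = "?l + (q-1-r)"
  have ab: "N - 1 - (sys + r) = ?a" "N - 1 - (cpy + r) = ?b" using assms Suc.prems by auto
  have wf: "wf_gate N ?g" using assms Suc.prems by auto
  let ?Y = "if bit X (N-1-c) \<and> bit X 0 then bit_swap ?a ?b X else X"
  have Y: "?Y < 2 ^ N" using Suc.prems assms by (auto intro!: bit_swap_less)
  have "N-1-c \<noteq> ?a" "N-1-c \<noteq> ?b" "0 \<noteq> ?a" "0 \<noteq> ?b" using assms Suc.prems by auto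
  then have cb: "bit (bit_swap ?a ?b X) (N-1-c) = bit X (N-1-c)" "bit (bit_swap ?a ?b X) 0 = bit X 0"
    by (simp_all only: bit_bit_swap if_False)
  have "act (2^N) (circuit_mat N (copy_swap N c sys cpy (Suc r))) \<psi> X
      = act (2^N) (circuit_mat N (copy_swap N c sys cpy r @ [?g])) \<psi> X"
    by (simp add: copy_swap_def)
  also have "\<dots> = act (2^N) (gate_mat N ?g) (act (2^N) (circuit_mat N (copy_swap N c sys cpy r)) \<psi>) X"
    using Suc.prems(2) by (simp only: act_circuit_append act_circuit_single)
  also have "\<dots> = act (2^N) (circuit_mat N (copy_swap N c sys cpy r)) \<psi> ?Y"
    unfolding act_CFredkin[OF wf Suc.prems(2)] ab by simp
  also have "\<dots> = \<psi> (if bit ?Y (N-1-c) \<and> bit ?Y 0 then block_swap q ?A ?l r ?Y else ?Y)"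
    by (rule Suc.IH) (use Suc.prems Y in auto)
  also have "(if bit ?Y (N-1-c) \<and> bit ?Y 0 then block_swap q ?A ?l r ?Y else ?Y)
    = (if bit X (N-1-c) \<and> bit X 0 then block_swap q ?A ?l (Suc r) X else X)"
    by (cases "bit X (N-1-c) \<and> bit X 0") (simp_all only: cb if_True if_False block_swap.simps simp_thms)
  finally show ?case .
qed

text \<open>The hypothesis on \<psi> says that the ancilla is in |+>. With the control on, the
  diagonal part of the rotation meets no swap or two swaps that cancel, and the off-diagonal part,
  which flips the ancilla, meets exactly one. With the control off no swap occurs, and the rotation
  multiplies |+> by exp (-i \<delta>), which the phase gate undoes.\<close>

lemma act_step_circuit:
  assumes pos: "c < N - 1" "sys + q \<le> cpy" "cpy + q \<le> N - 1" "c < sys \<or> cpy + q \<le> c" and X: "X < 2 ^ N"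
    and inv: "\<And>Y. Y < 2 ^ N \<Longrightarrow> \<psi> (set_bit 0 Y) = \<psi> (unset_bit 0 Y)"
  shows "act (2^N) (circuit_mat N (step_circuit N c sys cpy q \<delta>)) \<psi> X =
    (if bit X (N-1-c) then of_real (cos \<delta>) else 1) * \<psi> X
    + (if bit X (N-1-c) then - \<i> * of_real (sin \<delta>) else 0) * \<psi> (block_swap q (N - sys - q) (N - cpy - q) q X)"
proof -
  obtain A l p where Al: "N - sys - q = A" "N - cpy - q = l" and p: "N - 1 - c = p" by blast
  let ?S = "block_swap q A l q"
  let ?F = "circuit_mat N (copy_swap N c sys cpy q)"
  define C where "C X = (if bit X p \<and> bit X 0 then ?S X else X)" for X
  have F: "act (2^N) ?F \<phi> X = \<phi> (C X)" if "X < 2 ^ N" for \<phi> X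
    unfolding C_def by (rule act_copy_swap[OF pos order_refl that, unfolded Al p])
  have lA: "l + q \<le> A" "A + q \<le> N" "0 < l" unfolding Al[symmetric] using pos by linarith+
  have Sl: "?S X < 2 ^ N" if "X < 2 ^ N" for X by (rule block_swap_less[OF order_refl lA(2,1) that])
  have Cl: "C X < 2 ^ N" if "X < 2 ^ N" for X using that Sl by (simp add: C_def)
  have N0: "0 < N" "N - 1 < N" "c < N" using pos by auto
  have p0: "p \<noteq> 0" unfolding p[symmetric] using pos by linarith
  have pc: "A + q \<le> p \<or> p < l" unfolding Al[symmetric] p[symmetric] using pos by linarith
  have pS: "bit (?S X) p = bit X p" "bit (?S X) 0 = bit X 0" for X
    unfolding bit_block_swap_full[OF lA(1)] using pc lA by (auto split: if_splits)
  have Cbits: "bit (C X) p = bit X p" "bit (C X) 0 = bit X 0" for X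
    by (auto simp: C_def pS)
  have inv': "\<psi> (set_bit 0 Y) = \<psi> Y" "\<psi> (unset_bit 0 Y) = \<psi> Y" if "Y < 2 ^ N" for Y
    using inv[OF that] by (cases "bit Y 0"; simp add: set_bit_eq unset_bit_eq)+
  define \<psi>3 where "\<psi>3 X = rotX \<delta> $$ (of_bool (bit X 0), 0) * \<psi> (C (unset_bit 0 (C X))) + rotX \<delta> $$ (of_bool (bit X 0), 1) * \<psi> (C (set_bit 0 (C X)))" for X
  have 3: "act (2^N) ?F (act (2^N) (gate_mat N (Gate1 (rotX \<delta>) (N-1))) (act (2^N) ?F \<psi>)) X = \<psi>3 X" if X: "X < 2 ^ N" for X
    unfolding F[OF X] act_Gate1[OF N0(2) Cl[OF X]] \<psi>3_def
    using F[OF unset_bit_less[OF Cl[OF X]]] F[OF set_bit_less[OF N0(1) Cl[OF X]]] by (simp add: Cbits)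
  have "act (2^N) (circuit_mat N (step_circuit N c sys cpy q \<delta>)) \<psi> X
    = act (2^N) (gate_mat N (Gate1 (phase0 \<delta>) c)) (act (2^N) ?F (act (2^N) (gate_mat N (Gate1 (rotX \<delta>) (N-1))) (act (2^N) ?F \<psi>))) X"
    unfolding step_circuit_def circuit_mat_append circuit_mat_single using X
    by (simp add: act_mult assoc_mult_mat[of _ "2^N" "2^N" _ "2^N" _ "2^N"] del: gate_mat.simps cong: act_cong)
  also have "\<dots> = act (2^N) (gate_mat N (Gate1 (phase0 \<delta>) c)) \<psi>3 X"
    by (rule act_cong) (rule 3)
  also have "\<dots> = (if bit X p then 1 else exp (\<i> * of_real \<delta>)) * \<psi>3 X"
    unfolding act_Gate1[OF N0(3) X] p by (cases "bit X p") (simp_all add: phase0_def set_bit_eq unset_bit_eq)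
  also have "\<dots> = (if bit X p then of_real (cos \<delta>) else 1) * \<psi> X + (if bit X p then - \<i> * of_real (sin \<delta>) else 0) * \<psi> (?S X)"
  proof (cases "bit X p")
    case False
    have C: "C X = X" "C (unset_bit 0 X) = unset_bit 0 X" "C (set_bit 0 X) = set_bit 0 X"
      using False p0 by (simp_all add: C_def bit_set_bit_iff bit_unset_bit_iff)
    have "\<psi>3 X = (of_real (cos \<delta>) - \<i> * of_real (sin \<delta>)) * \<psi> X"
      unfolding \<psi>3_def C inv'[OF X] by (cases "bit X 0") (simp_all add: rotX_def algebra_simps)
    moreover have "exp (\<i> * of_real \<delta>) * (of_real (cos \<delta>) - \<i> * of_real (sin \<delta>)) = 1"
    proof -
      have "of_real (cos \<delta>) - \<i> * of_real (sin \<delta>) = exp (\<i> * of_real (- \<delta>))"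
        by (simp only: cis_conv_exp[symmetric]) (simp add: complex_eq_iff)
      then show ?thesis by (simp add: exp_add[symmetric])
    qed
    ultimately show ?thesis using False by (simp add: mult.assoc[symmetric])
  next
    case True
    show ?thesis
    proof (cases "bit X 0")
      case b: True
      have CX: "C X = ?S X" using True b by (simp add: C_def)
      have "C (set_bit 0 (?S X)) = X"
        using True b pS p0 by (simp add: C_def set_bit_eq block_swap_involution[OF lA(1)])
      moreover have "C (unset_bit 0 (?S X)) = unset_bit 0 (?S X)"
        by (simp add: C_def bit_unset_bit_iff)
      ultimately show ?thesis using True b inv'(2)[OF Sl[OF X]] by (simp add: \<psi>3_def CX rotX_def)
    next
      case b: False
      have CX: "C X = X" using b by (simp add: C_def)
      have "C (unset_bit 0 X) = X" using b by (simp add: unset_bit_eq CX)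
      moreover have "C (set_bit 0 X) = set_bit 0 (?S X)"
        using True p0 by (simp add: C_def bit_set_bit_iff block_swap_set_bit0[OF lA(1,3)])
      ultimately show ?thesis using True b inv'(1)[OF Sl[OF X]] by (simp add: \<psi>3_def CX rotX_def)
    qed
  qed
  finally show ?thesis unfolding Al p .
qed

section \<open>Circuits acting on density matrices\<close>

definition run :: "nat \<Rightarrow> gate list \<Rightarrow> complex mat \<Rightarrow> complex mat" where
  "run N gs M = circuit_mat N gs * M * adj (circuit_mat N gs)"

lemma run_carrier [simp]: "M \<in> carrier_mat (2^N) (2^N) \<Longrightarrow> run N gs M \<in> carrier_mat (2^N) (2^N)"
  by (simp add: run_def)

lemma run_append: "M \<in> carrier_mat (2^N) (2^N) \<Longrightarrow> run N (gs @ hs) M = run N hs (run N gs M)"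
  by (simp add: run_def circuit_mat_append adj_mult[of _ "2^N" "2^N" _ "2^N"] assoc_mult_mat[of _ "2^N" "2^N" _ "2^N" _ "2^N"])

lemma run_index:
  assumes "M \<in> carrier_mat (2^N) (2^N)" "X < 2^N" "Y < 2^N"
  shows "run N gs M $$ (X,Y) = cnj (act (2^N) (circuit_mat N gs) (\<lambda>v. cnj (act (2^N) (circuit_mat N gs) (\<lambda>u. M $$ (u,v)) X)) Y)"
proof -
  have "run N gs M $$ (X,Y) = cnj (act (2^N) (circuit_mat N gs) (\<lambda>v. cnj ((circuit_mat N gs * M) $$ (X,v))) Y)"
    unfolding run_def using assms by (intro mult_adj_index_act) simp_all
  also have "\<dots> = cnj (act (2^N) (circuit_mat N gs) (\<lambda>v. cnj (act (2^N) (circuit_mat N gs) (\<lambda>u. M $$ (u,v)) X)) Y)"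
    using assms by (intro arg_cong[of _ _ cnj] act_cong) (simp add: mult_index_act del: index_mult_mat(1))
  finally show ?thesis .
qed

text \<open>The ancilla is in |+> on the row side and on the column side, expressed as insensitivity
  to bit 0. No factorisation of the whole state has to be exhibited for this.\<close>

definition anc_invariant :: "nat \<Rightarrow> complex mat \<Rightarrow> bool" where
  "anc_invariant N M \<longleftrightarrow> (\<forall>X<2^N. \<forall>Y<2^N. M $$ (set_bit 0 X, Y) = M $$ (unset_bit 0 X, Y)
     \<and> M $$ (Y, set_bit 0 X) = M $$ (Y, unset_bit 0 X))"

text \<open>The action on amplitudes is applied to the columns and then, under complex conjugation,
  to the rows; invariance under bit 0 supplies its hypothesis both times.\<close>

lemma run_step_circuit:
  fixes \<delta> :: real
  assumes pos: "c < N - 1" "sys + q \<le> cpy" "cpy + q \<le> N - 1" "c < sys \<or> cpy + q \<le> c"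
    and M: "M \<in> carrier_mat (2^N) (2^N)" "anc_invariant N M" and XY: "X < 2 ^ N" "Y < 2 ^ N"
  defines "S \<equiv> block_swap q (N - sys - q) (N - cpy - q) q"
    and "\<alpha> \<equiv> \<lambda>X. if bit X (N-1-c) then complex_of_real (cos \<delta>) else 1"
    and "\<beta> \<equiv> \<lambda>X. if bit X (N-1-c) then - \<i> * complex_of_real (sin \<delta>) else 0"
  shows "run N (step_circuit N c sys cpy q \<delta>) M $$ (X,Y) =
    \<alpha> X * cnj (\<alpha> Y) * M $$ (X,Y) + \<alpha> X * cnj (\<beta> Y) * M $$ (X, S Y)
    + \<beta> X * cnj (\<alpha> Y) * M $$ (S X, Y) + \<beta> X * cnj (\<beta> Y) * M $$ (S X, S Y)"
proof -
  have lA: "N - cpy - q + q \<le> N - sys - q" "N - sys - q + q \<le> N" "0 < N - cpy - q" using pos by auto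
  have Sl: "S X < 2 ^ N" if "X < 2 ^ N" for X unfolding S_def by (rule block_swap_less[OF order_refl lA(2,1) that])
  let ?T = "circuit_mat N (step_circuit N c sys cpy q \<delta>)"
  have left: "act (2^N) ?T (\<lambda>u. M $$ (u,v)) X = \<alpha> X * M $$ (X,v) + \<beta> X * M $$ (S X, v)" if "v < 2 ^ N" for v
    unfolding \<alpha>_def \<beta>_def S_def by (rule act_step_circuit[OF pos XY(1)]) (use M(2) that in \<open>simp add: anc_invariant_def\<close>)
  let ?\<phi> = "\<lambda>v. cnj (\<alpha> X * M $$ (X,v) + \<beta> X * M $$ (S X, v))"
  have "run N (step_circuit N c sys cpy q \<delta>) M $$ (X,Y) = cnj (act (2^N) ?T ?\<phi> Y)"
    unfolding run_index[OF M(1) XY] by (intro arg_cong[of _ _ cnj] act_cong) (simp only: left)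
  also have "act (2^N) ?T ?\<phi> Y = \<alpha> Y * ?\<phi> Y + \<beta> Y * ?\<phi> (S Y)"
    unfolding \<alpha>_def \<beta>_def S_def
    by (rule act_step_circuit[OF pos XY(2)]) (use M(2) XY(1) Sl[OF XY(1)] in \<open>simp add: anc_invariant_def S_def\<close>)
  finally show ?thesis by (simp add: algebra_simps)
qed

text \<open>The amplitudes depend on the control bit only, and the block swap commutes with changes
  of bit 0.\<close>

lemma anc_invariant_run_step_circuit:
  assumes pos: "c < N - 1" "sys + q \<le> cpy" "cpy + q \<le> N - 1" "c < sys \<or> cpy + q \<le> c"
    and M: "M \<in> carrier_mat (2^N) (2^N)" "anc_invariant N M"
  shows "anc_invariant N (run N (step_circuit N c sys cpy q \<delta>) M)"
  unfolding anc_invariant_def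
proof (intro allI impI)
  fix X Y :: nat assume XY: "X < 2^N" "Y < 2^N"
  obtain A l p where Al: "N - sys - q = A" "N - cpy - q = l" and p: "N - 1 - c = p" by blast
  have lA: "l + q \<le> A" "A + q \<le> N" "0 < l" unfolding Al[symmetric] using pos by linarith+
  note l = set_bit_less[of 0 N, OF _ XY(1)] unset_bit_less[OF XY(1)]
  have N: "0 < N" "p \<noteq> 0" unfolding p[symmetric] using pos by linarith+
  have Sl: "block_swap q A l q X < 2 ^ N" if "X < 2 ^ N" for X
    by (rule block_swap_less[OF order_refl lA(2,1) that])
  show "run N (step_circuit N c sys cpy q \<delta>) M $$ (set_bit 0 X, Y) = run N (step_circuit N c sys cpy q \<delta>) M $$ (unset_bit 0 X, Y) \<and>
    run N (step_circuit N c sys cpy q \<delta>) M $$ (Y, set_bit 0 X) = run N (step_circuit N c sys cpy q \<delta>) M $$ (Y, unset_bit 0 X)"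
    using N XY l Sl M(2)
    by (simp add: run_step_circuit[OF pos M, unfolded Al p] block_swap_set_bit0[OF lA(1,3)] block_swap_unset_bit0[OF lA(1,3)]
      bit_set_bit_iff bit_unset_bit_iff anc_invariant_def)
qed

subsection \<open>Tracing out the copies\<close>

lemma kron_carrier [simp]:
  "A \<in> carrier_mat a b \<Longrightarrow> B \<in> carrier_mat c d \<Longrightarrow> kron A B \<in> carrier_mat (a*c) (b*d)"
  by (auto simp: kron_def)

lemma kron_index:
  assumes "A \<in> carrier_mat a a" "B \<in> carrier_mat d d" "i < a" "k < d" "j < a" "l < d"
  shows "kron A B $$ (i*d+k, j*d+l) = A $$ (i,j) * B $$ (k,l)"
  using assms block_index_less[of i a k d] block_index_less[of j a l d] by (auto simp: kron_def)

lemma kpow_carrier: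
  "\<sigma> \<in> carrier_mat (2^q) (2^q) \<Longrightarrow> kpow \<sigma> n \<in> carrier_mat (2^(n*q)) (2^(n*q))"
  by (induction n) (auto simp: power_add intro!: kron_carrier)

lemma ket0_carrier: "ket0_proj m \<in> carrier_mat (2^m) (2^m)"
  by (simp add: ket0_proj_def)

lemma mtrace_kron:
  assumes "A \<in> carrier_mat a a" "B \<in> carrier_mat d d"
  shows "mtrace (kron A B) = mtrace A * mtrace B"
proof -
  have "mtrace (kron A B) = (\<Sum>i<a*d. kron A B $$ (i,i))"
    unfolding mtrace_def using kron_carrier[OF assms] by auto
  also have "\<dots> = (\<Sum>i<a. \<Sum>k<d. A $$ (i,i) * B $$ (k,k))"
    unfolding sum_lessThan_mult by (intro sum.cong refl) (simp add: kron_index[OF assms])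
  also have "\<dots> = mtrace A * mtrace B"
    unfolding mtrace_def using assms by (auto simp: sum_product)
  finally show ?thesis .
qed

lemma mtrace_kpow:
  assumes "\<sigma> \<in> carrier_mat (2^q) (2^q)" "mtrace \<sigma> = 1"
  shows "mtrace (kpow \<sigma> n) = 1"
  by (induction n) (simp_all add: mtrace_kron[OF assms(1) kpow_carrier[OF assms(1)]] assms(2), simp add: mtrace_def)

lemma mtrace_ket0: "mtrace (ket0_proj m) = 1"
proof -
  have "mtrace (ket0_proj m) = (\<Sum>i<2^m. if i = (0::nat) then 1 else 0)"
    unfolding mtrace_def by (intro sum.cong) (auto simp: ket0_proj_def)
  then show ?thesis by simp
qed

text \<open>The amplitudes of |1+> on the last two qubits. Qubit \<open>N-2\<close> is the higher of
  the two bits, so it is 1 exactly for the values 2 and 3.\<close>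

definition anc :: "nat \<Rightarrow> complex" where
  "anc a = (if 2 \<le> a then of_real (1 / sqrt 2) else 0)"

definition hadamard :: "complex mat" where
  "hadamard = mat 2 2 (\<lambda>(i,j). of_real (if i = 1 \<and> j = 1 then - 1 / sqrt 2 else 1 / sqrt 2))"

definition pauliX :: "complex mat" where
  "pauliX = mat 2 2 (\<lambda>(i,j). if i = j then 0 else 1)"

definition prep :: "nat \<Rightarrow> gate list" where
  "prep N = [Gate1 hadamard (N-1), Gate1 pauliX (N-2)]"

text \<open>The amplitudes vanish where bit 0 is set, so only column 0 of \<open>hadamard\<close>
  counts, whose entries are both 1 / sqrt 2. The other gate makes the amplitude be fetched from the
  index with bit 1 negated.\<close>

lemma act_prep:
  assumes N: "2 \<le> N" and X: "X < 2 ^ N" and z: "\<And>Y. Y < 2 ^ N \<Longrightarrow> bit Y 0 \<Longrightarrow> \<psi> Y = 0"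
  shows "act (2^N) (circuit_mat N (prep N)) \<psi> X =
    of_real (1 / sqrt 2) * \<psi> (unset_bit 0 (if bit X 1 then unset_bit 1 X else set_bit 1 X))"
proof -
  let ?Y = "if bit X 1 then unset_bit 1 X else set_bit 1 X"
  have N': "N - 1 < N" "N - 2 < N" "N - 1 - (N - 1) = 0" "N - 1 - (N - 2) = 1" using N by auto
  have Y: "?Y < 2 ^ N" using N X by (auto intro!: set_bit_less unset_bit_less)
  have "act (2^N) (circuit_mat N (prep N)) \<psi> X = act (2^N) (gate_mat N (Gate1 pauliX (N-2))) (act (2^N) (gate_mat N (Gate1 hadamard (N-1))) \<psi>) X"
    unfolding prep_def act_circuit_Cons[OF X] circuit_mat_single ..
  also have "\<dots> = act (2^N) (gate_mat N (Gate1 hadamard (N-1))) \<psi> ?Y"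
    unfolding act_Gate1[OF N'(2) X] N'(4) by (cases "bit X 1") (simp_all add: pauliX_def)
  also have "\<dots> = of_real (1 / sqrt 2) * \<psi> (unset_bit 0 ?Y)"
    unfolding act_Gate1[OF N'(1) Y] N'(3)
    using z[of "set_bit 0 ?Y"] set_bit_less[of 0 N, OF _ Y] N
    by (cases "bit ?Y 0") (simp_all add: hadamard_def bit_set_bit_iff)
  finally show ?thesis .
qed

text \<open>The ancilla values 2 and 3 are fetched from |00>, the values 0 and 1 from |10>, where
  the initial state vanishes.\<close>

lemma prep_bits:
  assumes "a < 4"
  shows "unset_bit 0 (if bit (h*4+a) 1 then unset_bit 1 (h*4+a) else set_bit 1 (h*4+a)) = h*4 + (if 2 \<le> a then 0 else 2 :: nat)"
proof (rule bit_eqI)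
  fix p :: nat
  have b: "bit (h*4+x) r = (if r < 2 then bit x r else bit h (r-2))" if "x < 4" for x r :: nat
    using bit_block[of x 2 h r] that by simp
  consider "p = 0" | "p = 1" | "2 \<le> p" by linarith
  then show "bit (unset_bit 0 (if bit (h*4+a) 1 then unset_bit 1 (h*4+a) else set_bit 1 (h*4+a))) p =
     bit (h*4 + (if 2 \<le> a then 0 else 2 :: nat)) p"
  proof cases
    case 1
    have "\<not> bit (unset_bit 0 y) p" for y :: nat unfolding 1 bit_unset_bit_iff by simp
    moreover have "\<not> bit (h*4 + (if 2 \<le> a then 0 else 2)) p" unfolding 1 by (simp add: bit_0)
    ultimately show ?thesis by blast
  next
    case 2
    have "a = 0 \<or> a = 1 \<or> a = 2 \<or> a = 3" using assms by linarith
    then have "bit a 1 \<longleftrightarrow> 2 \<le> a" by (auto simp: bit_1_iff bit_iff_odd)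
    then have "bit (h*4+a) 1 \<longleftrightarrow> 2 \<le> a" using b[OF assms, of 1] by simp
    moreover have "bit (unset_bit 0 (if bit y 1 then unset_bit 1 y else set_bit 1 y)) p \<longleftrightarrow> \<not> bit y 1" for y :: nat
      unfolding 2 by (auto simp: bit_unset_bit_iff bit_set_bit_iff)
    moreover have "bit (h*4 + (if 2 \<le> a then 0 else 2)) p \<longleftrightarrow> \<not> 2 \<le> a"
      using b[of "if 2 \<le> a then 0 else 2" 1] unfolding 2 by (simp add: bit_iff_odd)
    ultimately show ?thesis by blast
  next
    case 3
    then show ?thesis using b[of "if 2 \<le> a then 0 else 2" p] b[OF assms, of p]
      by (auto simp: bit_unset_bit_iff bit_set_bit_iff)
  qed
qed

text \<open>Tracing out the copies used so far from \<open>M\<close> leaves \<open>r\<close> on the system, the product state on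
  the unused copies, and \<open>|1+\<rangle>\<close> on the two ancillas.\<close>
definition traced :: "nat \<Rightarrow> nat \<Rightarrow> nat \<Rightarrow> complex mat \<Rightarrow> nat \<Rightarrow> complex mat \<Rightarrow> complex mat \<Rightarrow> bool" where
  "traced K q n \<sigma> j M r \<longleftrightarrow> (\<forall>s<K. \<forall>s'<K. \<forall>c<2^((n-j)*q). \<forall>c'<2^((n-j)*q). \<forall>a<4. \<forall>a'<4.
     (\<Sum>d<2^(j*q). M $$ (((s * 2^(j*q) + d) * 2^((n-j)*q) + c) * 4 + a, ((s' * 2^(j*q) + d) * 2^((n-j)*q) + c') * 4 + a'))
       = r $$ (s,s') * kpow \<sigma> (n-j) $$ (c,c') * (anc a * anc a'))"

lemma tracedD:
  assumes "traced K q n \<sigma> j M r" "s < K" "s' < K" "c < 2^((n-j)*q)" "c' < 2^((n-j)*q)" "a < 4" "a' < 4"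
  shows "(\<Sum>d<2^(j*q). M $$ (((s * 2^(j*q) + d) * 2^((n-j)*q) + c) * 4 + a, ((s' * 2^(j*q) + d) * 2^((n-j)*q) + c') * 4 + a'))
       = r $$ (s,s') * kpow \<sigma> (n-j) $$ (c,c') * (anc a * anc a')"
  using assms unfolding traced_def by blast

text \<open>The start of the iteration, with no copy traced out yet. Row and column contribute 1 /
  sqrt 2 each, and the initial projector leaves only entries whose ancilla values are at least 2 on
  both sides.\<close>

lemma prep_state:
  fixes k q n :: nat
  assumes R: "\<rho> \<in> carrier_mat (2^k) (2^k)" and S: "\<sigma> \<in> carrier_mat (2^q) (2^q)"
  defines "N \<equiv> k + (n*q+2)"
  defines "M \<equiv> kron \<rho> (kron (kpow \<sigma> n) (ket0_proj 2))"
  shows "M \<in> carrier_mat (2^N) (2^N)" "anc_invariant N (run N (prep N) M)" "traced (2^k) q n \<sigma> 0 (run N (prep N) M) \<rho>"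
proof -
  let ?C = "2^(n*q) :: nat"
  have Kc: "kpow \<sigma> n \<in> carrier_mat ?C ?C" by (rule kpow_carrier[OF S])
  have P: "ket0_proj 2 \<in> carrier_mat 4 4" using ket0_carrier[of 2] by simp
  have KP: "kron (kpow \<sigma> n) (ket0_proj 2) \<in> carrier_mat (?C*4) (?C*4)" by (rule kron_carrier[OF Kc P])
  have N: "2^N = 2^k * (?C*4)" "2 \<le> N" by (simp_all add: N_def power_add)
  show M: "M \<in> carrier_mat (2^N) (2^N)" unfolding N M_def by (rule kron_carrier[OF R KP])
  have Mi: "M $$ ((s*?C+c)*4+a, (s'*?C+c')*4+a') = \<rho> $$ (s,s') * kpow \<sigma> n $$ (c,c') * (if a = 0 \<and> a' = 0 then 1 else 0)"
    if "s < 2^k" "s' < 2^k" "c < ?C" "c' < ?C" "a < 4" "a' < 4" for s s' c c' a a'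
  proof -
    have e: "(s*?C+c)*4+a = s*(?C*4)+(c*4+a)" "(s'*?C+c')*4+a' = s'*(?C*4)+(c'*4+a')" by (simp_all add: algebra_simps)
    have "M $$ (s*(?C*4)+(c*4+a), s'*(?C*4)+(c'*4+a')) = \<rho> $$ (s,s') * kron (kpow \<sigma> n) (ket0_proj 2) $$ (c*4+a, c'*4+a')"
      unfolding M_def by (intro kron_index[OF R KP] block_index_less that)
    also have "kron (kpow \<sigma> n) (ket0_proj 2) $$ (c*4+a, c'*4+a') = kpow \<sigma> n $$ (c,c') * ket0_proj 2 $$ (a,a')"
      by (intro kron_index[OF Kc P] that)
    also have "ket0_proj 2 $$ (a,a') = (if a = 0 \<and> a' = 0 then 1 else 0)"
      using that by (simp add: ket0_proj_def)
    finally show ?thesis unfolding e by (simp only: mult.assoc)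
  qed
  have dec: "\<exists>s c a. s < 2^k \<and> c < ?C \<and> a < 4 \<and> X = (s*?C+c)*4+a" if "X < 2^N" for X
  proof (intro exI conjI)
    have "X div 4 < 2^k * ?C" using that unfolding N by (intro less_mult_imp_div_less) (simp add: mult.assoc)
    then show "X div 4 div ?C < 2^k" by (rule less_mult_imp_div_less)
    show "X div 4 mod ?C < ?C" "X mod 4 < 4" by simp_all
    show "X = (X div 4 div ?C * ?C + X div 4 mod ?C) * 4 + X mod 4" by (simp only: div_mult_mod_eq)
  qed
  have odd: "M $$ (X,Y) = 0" if XY: "X < 2^N" "Y < 2^N" and o: "bit X 0 \<or> bit Y 0" for X Y
  proof -
    obtain s c a where X: "s < 2^k" "c < ?C" "a < 4" "X = (s*?C+c)*4+a" using dec[OF XY(1)] by blast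
    obtain s' c' a' where Y: "s' < 2^k" "c' < ?C" "a' < 4" "Y = (s'*?C+c')*4+a'" using dec[OF XY(2)] by blast
    have "a \<noteq> 0 \<or> a' \<noteq> 0" using o unfolding X(4) Y(4) by (auto simp: bit_0 dest: odd_pos)
    then show ?thesis unfolding X(4) Y(4) Mi[OF X(1) Y(1) X(2) Y(2) X(3) Y(3)] by auto
  qed
  define g where "g X = unset_bit 0 (if bit X 1 then unset_bit 1 X else set_bit 1 (X::nat))" for X
  have gl: "g X < 2^N" if "X < 2^N" for X unfolding g_def using that N(2) by (auto intro!: unset_bit_less set_bit_less)
  have run: "run N (prep N) M $$ (X,Y) = of_real (1/2) * M $$ (g X, g Y)" if XY: "X < 2^N" "Y < 2^N" for X Y
  proof -
    have l: "act (2^N) (circuit_mat N (prep N)) (\<lambda>u. M $$ (u,v)) X = of_real (1 / sqrt 2) * M $$ (g X, v)" if "v < 2^N" for v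
      unfolding g_def by (rule act_prep[OF N(2) XY(1)]) (use odd that in auto)
    have "run N (prep N) M $$ (X,Y) = cnj (act (2^N) (circuit_mat N (prep N)) (\<lambda>v. cnj (of_real (1 / sqrt 2) * M $$ (g X, v))) Y)"
      unfolding run_index[OF M XY] by (intro arg_cong[of _ _ cnj] act_cong) (simp only: l)
    also have "\<dots> = cnj (of_real (1 / sqrt 2) * cnj (of_real (1 / sqrt 2) * M $$ (g X, g Y)))"
      unfolding g_def[of Y] by (intro arg_cong[of _ _ cnj] act_prep[OF N(2) XY(2)]) (use odd gl[OF XY(1)] in auto)
    also have "\<dots> = (of_real (1 / sqrt 2) * of_real (1 / sqrt 2)) * M $$ (g X, g Y)"
      by (simp only: complex_cnj_mult complex_cnj_cnj complex_cnj_complex_of_real mult.assoc)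
    also have "complex_of_real (1 / sqrt 2) * of_real (1 / sqrt 2) = of_real (1/2)"
      by (simp only: of_real_mult[symmetric]) simp
    finally show ?thesis .
  qed
  show "anc_invariant N (run N (prep N) M)"
    unfolding anc_invariant_def
  proof (intro allI impI)
    fix X Y :: nat assume XY: "X < 2^N" "Y < 2^N"
    have g0: "g (set_bit 0 X) = g (unset_bit 0 X)"
      unfolding g_def by (rule bit_eqI) (auto simp: bit_unset_bit_iff bit_set_bit_iff)
    have "set_bit 0 X < 2^N" "unset_bit 0 X < 2^N" using XY N(2) by (auto intro!: set_bit_less unset_bit_less)
    then show "run N (prep N) M $$ (set_bit 0 X, Y) = run N (prep N) M $$ (unset_bit 0 X, Y) \<and>
      run N (prep N) M $$ (Y, set_bit 0 X) = run N (prep N) M $$ (Y, unset_bit 0 X)"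
      using XY by (simp only: run g0)
  qed
  show "traced (2^k) q n \<sigma> 0 (run N (prep N) M) \<rho>"
    unfolding traced_def
  proof (intro allI impI)
    fix s s' c c' a a' :: nat
    assume h: "s < 2^k" "s' < 2^k" "c < 2^((n-0)*q)" "c' < 2^((n-0)*q)" "a < 4" "a' < 4"
    then have c: "c < ?C" "c' < ?C" by simp_all
    have gi: "g ((s*?C+c)*4+a) = (s*?C+c)*4 + (if 2 \<le> a then 0 else 2)" if "a < 4" for s c a
      unfolding g_def by (rule prep_bits[OF that])
    have Xl: "(s*?C+c)*4+a < 2^N" if "s < 2^k" "c < ?C" "a < 4" for s c a
    proof -
      have "s*(?C*4)+(c*4+a) < 2^k*(?C*4)" by (intro block_index_less that)
      then show ?thesis unfolding N by (simp add: algebra_simps)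
    qed
    have "run N (prep N) M $$ ((s*?C+c)*4+a, (s'*?C+c')*4+a') = of_real (1/2) * (\<rho> $$ (s,s') * kpow \<sigma> n $$ (c,c') * (if 2 \<le> a \<and> 2 \<le> a' then 1 else 0))"
      unfolding run[OF Xl[OF h(1) c(1) h(5)] Xl[OF h(2) c(2) h(6)]] gi[OF h(5)] gi[OF h(6)]
      by (subst Mi) (use h c in auto)
    also have "\<dots> = \<rho> $$ (s,s') * kpow \<sigma> n $$ (c,c') * (anc a * anc a')"
      by (auto simp: anc_def of_real_mult[symmetric] simp del: of_real_mult)
    finally show "(\<Sum>d<2^(0*q). run N (prep N) M $$ (((s * 2^(0*q) + d) * 2^((n-0)*q) + c) * 4 + a, ((s' * 2^(0*q) + d) * 2^((n-0)*q) + c') * 4 + a'))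
       = \<rho> $$ (s,s') * kpow \<sigma> (n-0) $$ (c,c') * (anc a * anc a')"
      by simp
  qed
qed

lemma sum_partial_swap:
  fixes S f g h :: "nat \<Rightarrow> 'a::comm_ring_1"
  shows "(\<Sum>e\<in>A. c1 * (x * S e * K) + c2 * (f1 e * f e * K) + c3 * (g1 e * g e * K) + c4 * (y * h e * K))
    = (c1 * x * (\<Sum>e\<in>A. S e) + c2 * (\<Sum>e\<in>A. f1 e * f e) + c3 * (\<Sum>e\<in>A. g1 e * g e) + c4 * (y * (\<Sum>e\<in>A. h e))) * K"
  by (simp add: sum.distrib sum_distrib_left sum_distrib_right distrib_right mult.assoc)

text \<open>Here and below \<open>b \<in> {0, 1}\<close> is the number of control qubits in front of the system; without
  one, the ancilla in state \<open>|1\<rangle>\<close> takes over the role of the control.\<close>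
definition ctrl_pos :: "nat \<Rightarrow> nat \<Rightarrow> nat" where
  "ctrl_pos b N = (if b = 1 then 0 else N - 2)"

text \<open>The range of the traced-out index grows by one digit e, the copy in turn. Summing over
  the old range replaces M by r and the product state; summing over e then traces out the new copy.
  As the swap exchanges e with the system digit, the four terms of the step become those of
  \<open>swap_channel\<close>.\<close>

lemma traced_step:
  fixes b j n q :: nat and \<delta> :: real
  assumes b: "b \<le> 1" and j: "j < n"
    and S: "\<sigma> \<in> carrier_mat (2^q) (2^q)" "mtrace \<sigma> = 1"
  defines "N \<equiv> (b + q) + (n*q+2)"
  assumes M: "M \<in> carrier_mat (2^N) (2^N)" "anc_invariant N M" "traced (2^b * 2^q) q n \<sigma> j M r"
  defines "M' \<equiv> run N (step_circuit N (ctrl_pos b N) b (b + q + j*q) q \<delta>) M"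
  shows "traced (2^b * 2^q) q n \<sigma> (Suc j) M' (swap_channel (2^b) (2^q) \<sigma> (amp0 (2^b) \<delta>) (amp1 (2^b) \<delta>) r)"
    and "anc_invariant N M'"
proof -
  obtain i where n: "n = Suc (j + i)" using j less_iff_Suc_add by auto
  define c where "c = ctrl_pos b N"
  have pos: "c < N - 1" "b + q \<le> b + q + j*q" "b + q + j*q + q \<le> N - 1" "c < b \<or> b + q + j*q + q \<le> c"
    using b by (auto simp: N_def n c_def ctrl_pos_def algebra_simps)
  show "anc_invariant N M'" unfolding M'_def c_def[symmetric] by (rule anc_invariant_run_step_circuit[OF pos M(1,2)])
  let ?D = "2^q :: nat" and ?J = "2^(j*q) :: nat" and ?I = "2^(i*q) :: nat"
  define l where "l = i*q+2"
  have l: "?I * 4 = 2^l" by (simp add: l_def power_add)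
  have pa: "N - b - q = l + q + j*q" "N - (b + q + j*q) - q = l" by (auto simp: N_def n l_def algebra_simps)
  define Z where "Z s d e w = ((s * ?J + d) * ?D + e) * 2^l + w" for s d e w :: nat
  have Zl: "Z s d e w < 2^N" if "s < 2^b * ?D" "d < ?J" "e < ?D" "w < 2^l" for s d e w
  proof -
    have "Z s d e w < ((2^b * ?D) * ?J) * ?D * 2^l"
      unfolding Z_def by (intro block_index_less that)
    also have "((2^b * ?D) * ?J) * ?D * 2^l = 2^N"
      by (simp add: N_def n l_def power_add[symmetric] algebra_simps)
    finally show ?thesis .
  qed
  have Zs: "block_swap q (N - b - q) (N - (b + q + j*q) - q) q (Z (u * ?D + s) d e w) = Z (u * ?D + e) d s w"
    if "s < ?D" "d < ?J" "e < ?D" "w < 2^l" for u s d e w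
    unfolding pa Z_def by (rule block_swap_blocks[OF that])
  \<comment> \<open>The bit that controls the step: the leading qubit if there is a control qubit,
    otherwise bit 1, the ancilla in |1>.\<close>
  define flag where "flag u w \<longleftrightarrow> (if b = 1 then u = 1 else bit w 1)" for u w :: nat
  have Zf: "bit (Z (u * ?D + s) d e w) (N - 1 - c) \<longleftrightarrow> flag u w"
    if "u < 2^b" "s < ?D" "d < ?J" "e < ?D" "w < 2^l" for u s d e w
  proof (cases "b = 1")
    case True
    then have u: "u = 0 \<or> u = 1" using that(1) by auto
    have "N - 1 - c = l + q + j*q + q" using True by (simp add: N_def n l_def c_def ctrl_pos_def algebra_simps)
    then show ?thesis
      unfolding Z_def bit_blocks[OF that(2-5)] flag_def using True u by (auto simp: bit_0)
  next
    case False
    have "N - 1 - c = 1" using False by (simp add: N_def c_def ctrl_pos_def)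
    then show ?thesis
      unfolding Z_def bit_blocks[OF that(2-5)] flag_def using False by (auto simp: l_def)
  qed
  define \<alpha> where "\<alpha> u w = (if flag u w then complex_of_real (cos \<delta>) else 1)" for u w
  define \<beta> where "\<beta> u w = (if flag u w then - \<i> * complex_of_real (sin \<delta>) else 0)" for u w
  have G: "(\<Sum>d<?J. M $$ (Z s d e (x*4+a), Z s' d e' (x'*4+a'))) = r $$ (s,s') * (\<sigma> $$ (e,e') * kpow \<sigma> i $$ (x,x')) * (anc a * anc a')"
    if h: "s < 2^b * ?D" "s' < 2^b * ?D" "e < ?D" "e' < ?D" "x < ?I" "x' < ?I" "a < 4" "a' < 4" for s s' e e' x x' a a'
  proof -
    have nj: "n - j = Suc i" by (simp add: n)
    have p: "(2::nat)^(Suc i * q) = ?D * ?I" by (simp add: power_add)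
    have lt: "e * ?I + x < 2^((n-j)*q)" "e' * ?I + x' < 2^((n-j)*q)"
      unfolding nj p by (intro block_index_less h)+
    have e: "((s * ?J + d) * 2^((n-j)*q) + (e * ?I + x)) * 4 + a = Z s d e (x*4+a)" for s d e x a
      unfolding nj p Z_def l[symmetric] by (simp add: algebra_simps)
    have k: "kpow \<sigma> (n-j) $$ (e * ?I + x, e' * ?I + x') = \<sigma> $$ (e,e') * kpow \<sigma> i $$ (x,x')"
      unfolding nj kpow.simps by (rule kron_index[OF S(1) kpow_carrier[OF S(1)]]) (use h in auto)
    show ?thesis using tracedD[OF M(3) h(1,2) lt h(7,8)] unfolding e k .
  qed
  show "traced (2^b * 2^q) q n \<sigma> (Suc j) M' (swap_channel (2^b) (2^q) \<sigma> (amp0 (2^b) \<delta>) (amp1 (2^b) \<delta>) r)"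
    unfolding traced_def
  proof (intro allI impI)
    fix s s' x x' a a' :: nat
    assume s: "s < 2^b * ?D" "s' < 2^b * ?D" and x0: "x < 2^((n - Suc j)*q)" "x' < 2^((n - Suc j)*q)" and a: "a < 4" "a' < 4"
    have nj: "n - Suc j = i" by (simp add: n)
    have x: "x < ?I" "x' < ?I" using x0 unfolding nj .
    define u v u' v' where "u = s div ?D" and "v = s mod ?D" and "u' = s' div ?D" and "v' = s' mod ?D"
    have sv: "s = u * ?D + v" "s' = u' * ?D + v'" by (simp_all only: u_def v_def u'_def v'_def div_mult_mod_eq)
    have uv: "u < 2^b" "v < ?D" "u' < 2^b" "v' < ?D"
      using s by (simp_all add: u_def v_def u'_def v'_def less_mult_imp_div_less)
    define w w' where "w = x*4+a" and "w' = x'*4+a'"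
    have w: "w < 2^l" "w' < 2^l" unfolding w_def w'_def l[symmetric] by (intro block_index_less x a)+
    let ?K = "kpow \<sigma> i $$ (x,x') * (anc a * anc a')"
    have se: "u * ?D + e < 2^b * ?D" "u' * ?D + e < 2^b * ?D" if "e < ?D" for e
      using that uv by (auto intro: block_index_less)
    have step: "M' $$ (Z s d e w, Z s' d e w') =
        \<alpha> u w * cnj (\<alpha> u' w') * M $$ (Z s d e w, Z s' d e w') + \<alpha> u w * cnj (\<beta> u' w') * M $$ (Z s d e w, Z (u' * ?D + e) d v' w')
        + \<beta> u w * cnj (\<alpha> u' w') * M $$ (Z (u * ?D + e) d v w, Z s' d e w') + \<beta> u w * cnj (\<beta> u' w') * M $$ (Z (u * ?D + e) d v w, Z (u' * ?D + e) d v' w')"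
      if "d < ?J" "e < ?D" for d e
      unfolding M'_def c_def[symmetric] \<alpha>_def \<beta>_def
      using run_step_circuit[OF pos M(1,2) Zl[OF s(1) that w(1)] Zl[OF s(2) that w(2)], of \<delta>]
      unfolding sv Zf[OF uv(1,2) that w(1)] Zf[OF uv(3,4) that w(2)] Zs[OF uv(2) that w(1)] Zs[OF uv(4) that w(2)] .
    have ix: "((s * 2^(Suc j*q) + (d * ?D + e)) * 2^((n - Suc j)*q) + x) * 4 + a = Z s d e (x*4+a)" for s d e x a
      unfolding nj Z_def l[symmetric] by (simp add: power_add algebra_simps)
    have J: "(2::nat)^(Suc j*q) = ?J * ?D" by (simp add: power_add)
    have "(\<Sum>d<2^(Suc j*q). M' $$ (((s * 2^(Suc j*q) + d) * 2^((n-Suc j)*q) + x) * 4 + a, ((s' * 2^(Suc j*q) + d) * 2^((n-Suc j)*q) + x') * 4 + a'))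
      = (\<Sum>d<?J. \<Sum>e<?D. M' $$ (Z s d e w, Z s' d e w'))"
      unfolding w_def w'_def ix[symmetric] by (subst (1) J, rule sum_lessThan_mult)
    also have "\<dots> = (\<Sum>e<?D. \<Sum>d<?J. M' $$ (Z s d e w, Z s' d e w'))" by (rule sum.swap)
    also have "\<dots> = (\<Sum>e<?D. \<alpha> u w * cnj (\<alpha> u' w') * (\<Sum>d<?J. M $$ (Z s d e w, Z s' d e w'))
        + \<alpha> u w * cnj (\<beta> u' w') * (\<Sum>d<?J. M $$ (Z s d e w, Z (u' * ?D + e) d v' w'))
        + \<beta> u w * cnj (\<alpha> u' w') * (\<Sum>d<?J. M $$ (Z (u * ?D + e) d v w, Z s' d e w'))
        + \<beta> u w * cnj (\<beta> u' w') * (\<Sum>d<?J. M $$ (Z (u * ?D + e) d v w, Z (u' * ?D + e) d v' w')))"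
      by (intro sum.cong refl) (simp add: step sum.distrib sum_distrib_left)
    also have "\<dots> = (\<Sum>e<?D. \<alpha> u w * cnj (\<alpha> u' w') * (r $$ (s,s') * \<sigma> $$ (e,e) * ?K)
        + \<alpha> u w * cnj (\<beta> u' w') * (r $$ (s,u'*?D+e) * \<sigma> $$ (e,v') * ?K)
        + \<beta> u w * cnj (\<alpha> u' w') * (\<sigma> $$ (v,e) * r $$ (u*?D+e,s') * ?K)
        + \<beta> u w * cnj (\<beta> u' w') * (\<sigma> $$ (v,v') * r $$ (u*?D+e,u'*?D+e) * ?K))"
      unfolding w_def w'_def by (intro sum.cong refl) (simp add: G s se uv x a mult_ac)
    also have "\<dots> = (\<alpha> u w * cnj (\<alpha> u' w') * r $$ (s,s')
        + \<alpha> u w * cnj (\<beta> u' w') * (\<Sum>e<?D. r $$ (s,u'*?D+e) * \<sigma> $$ (e,v'))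
        + \<beta> u w * cnj (\<alpha> u' w') * (\<Sum>e<?D. \<sigma> $$ (v,e) * r $$ (u*?D+e,s'))
        + \<beta> u w * cnj (\<beta> u' w') * (\<sigma> $$ (v,v') * (\<Sum>e<?D. r $$ (u*?D+e,u'*?D+e)))) * ?K"
    proof -
      \<comment> \<open>In the term without any swap the new copy is traced out on its own.\<close>
      have tr: "(\<Sum>e<?D. \<sigma> $$ (e,e)) = 1" using S unfolding mtrace_def by auto
      show ?thesis unfolding sum_partial_swap tr by simp
    qed
    also have "\<dots> = swap_channel (2^b) (2^q) \<sigma> (amp0 (2^b) \<delta>) (amp1 (2^b) \<delta>) r $$ (s,s') * ?K"
    \<comment> \<open>Only the ancilla values 2 and 3 carry weight, and they have bit 1 set. So
      without a control qubit the step always fires, in agreement with u = 0 = 2^b - 1 for b =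
      0.\<close>
    proof (cases "anc a * anc a' = 0")
      case True
      then show ?thesis by simp
    next
      case False
      have fl: "flag u (x*4+a) \<longleftrightarrow> u = 2^b - 1" if "u < 2^b" "a < 4" "anc a \<noteq> 0" for u x a :: nat
      proof -
        have "a = 2 \<or> a = 3" using that by (auto simp: anc_def split: if_splits)
        then have "bit (x*2\<^sup>2+a) 1" by (subst bit_block) (auto simp: bit_iff_odd)
        then show ?thesis using that(1) b unfolding flag_def by (auto simp: le_Suc_eq)
      qed
      have "flag u w \<longleftrightarrow> u = 2^b - 1" "flag u' w' \<longleftrightarrow> u' = 2^b - 1"
        unfolding w_def w'_def using False by (intro fl uv a; simp)+
      then have "\<alpha> u w = amp0 (2^b) \<delta> u" "\<alpha> u' w' = amp0 (2^b) \<delta> u'" "\<beta> u w = amp1 (2^b) \<delta> u" "\<beta> u' w' = amp1 (2^b) \<delta> u'"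
        by (simp_all add: \<alpha>_def \<beta>_def amp0_def amp1_def)
      then show ?thesis unfolding sv swap_channel_index[OF uv] by simp
    qed
    finally show "(\<Sum>d<2^(Suc j*q). M' $$ (((s * 2^(Suc j*q) + d) * 2^((n-Suc j)*q) + x) * 4 + a, ((s' * 2^(Suc j*q) + d) * 2^((n-Suc j)*q) + x') * 4 + a'))
      = swap_channel (2^b) (2^q) \<sigma> (amp0 (2^b) \<delta>) (amp1 (2^b) \<delta>) r $$ (s,s') * kpow \<sigma> (n - Suc j) $$ (x,x') * (anc a * anc a')"
      unfolding nj by (simp only: mult.assoc)
  qed
qed

subsection \<open>Density matrix exponentiation\<close>

text \<open>The register has room for all n copies while only the first j are used, which permits an
  induction on j with the register fixed.\<close>

definition dme_circuit :: "nat \<Rightarrow> nat \<Rightarrow> nat \<Rightarrow> real \<Rightarrow> nat \<Rightarrow> gate list" where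
  "dme_circuit b q n \<delta> j = (let N = (b + q) + (n*q+2) in
     prep N @ concat (map (\<lambda>i. step_circuit N (ctrl_pos b N) b (b + q + i*q) q \<delta>) [0..<j]))"

lemma dme_circuit_Suc:
  "dme_circuit b q n \<delta> (Suc j) = dme_circuit b q n \<delta> j
     @ step_circuit ((b + q) + (n*q+2)) (ctrl_pos b ((b + q) + (n*q+2))) b (b + q + j*q) q \<delta>"
  by (simp add: dme_circuit_def Let_def)

lemma dme_circuit_traced:
  fixes b q n j :: nat and \<delta> :: real
  assumes b: "b \<le> 1" and S: "\<sigma> \<in> carrier_mat (2^q) (2^q)" "mtrace \<sigma> = 1" and R: "\<rho> \<in> carrier_mat (2^(b+q)) (2^(b+q))"
    and j: "j \<le> n"
  defines "N \<equiv> (b + q) + (n*q+2)"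
  defines "M \<equiv> kron \<rho> (kron (kpow \<sigma> n) (ket0_proj 2))"
  shows "anc_invariant N (run N (dme_circuit b q n \<delta> j) M) \<and>
    traced (2^b * 2^q) q n \<sigma> j (run N (dme_circuit b q n \<delta> j) M) ((swap_channel (2^b) (2^q) \<sigma> (amp0 (2^b) \<delta>) (amp1 (2^b) \<delta>) ^^ j) \<rho>)"
  using j
proof (induction j)
  case 0
  show ?case using prep_state(2,3)[OF R S(1), of n]
    by (simp add: dme_circuit_def M_def N_def power_add)
next
  case (Suc j)
  have M: "M \<in> carrier_mat (2^N) (2^N)" unfolding M_def N_def by (rule prep_state(1)[OF R S(1)])
  have IH: "anc_invariant N (run N (dme_circuit b q n \<delta> j) M)"
    "traced (2^b * 2^q) q n \<sigma> j (run N (dme_circuit b q n \<delta> j) M) ((swap_channel (2^b) (2^q) \<sigma> (amp0 (2^b) \<delta>) (amp1 (2^b) \<delta>) ^^ j) \<rho>)"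
    using Suc by auto
  have jn: "j < n" using Suc.prems by simp
  show ?case
    unfolding dme_circuit_Suc N_def[symmetric] run_append[OF M]
    using traced_step[OF b jn S, folded N_def, OF run_carrier[OF M] IH, of \<delta>] by simp
qed

text \<open>After n steps no copy is left, the remaining product state is the 1 x 1 identity, and
  tracing out the ancillas adds the weights 1/2 and 1/2.\<close>

lemma circuit_output_dme:
  fixes b q n :: nat and \<delta> :: real
  assumes b: "b \<le> 1" and S: "\<sigma> \<in> carrier_mat (2^q) (2^q)" "mtrace \<sigma> = 1" and R: "\<rho> \<in> carrier_mat (2^(b+q)) (2^(b+q))"
  shows "circuit_output (b+q) (n*q+2) (dme_circuit b q n \<delta> n) (kron \<rho> (kron (kpow \<sigma> n) (ket0_proj 2)))
    = (swap_channel (2^b) (2^q) \<sigma> (amp0 (2^b) \<delta>) (amp1 (2^b) \<delta>) ^^ n) \<rho>" (is "?L = ?r")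
proof (rule eq_matI)
  let ?N = "(b + q) + (n*q+2)" and ?M = "kron \<rho> (kron (kpow \<sigma> n) (ket0_proj 2))" and ?C = "2^(n*q) :: nat"
  define M' where "M' = run ?N (dme_circuit b q n \<delta> n) ?M"
  have T: "traced (2^b * 2^q) q n \<sigma> n M' ?r"
    unfolding M'_def using dme_circuit_traced[OF b S R order_refl] by blast
  have r: "?r \<in> carrier_mat (2^(b+q)) (2^(b+q))"
    using R by (cases n) (simp_all add: power_add)
  then show "dim_row ?L = dim_row ?r" "dim_col ?L = dim_col ?r"
    by (simp_all add: circuit_output_def ptrace_right_def Let_def)
  fix s s' assume "s < dim_row ?r" "s' < dim_col ?r"
  then have s: "s < 2^(b+q)" "s' < 2^(b+q)" using r by auto
  have rs: "(2::nat)^(n*q+2) = ?C * 4" by (simp add: power_add)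
  have "?L $$ (s,s') = (\<Sum>t<?C*4. M' $$ (s*(?C*4)+t, s'*(?C*4)+t))"
    using s unfolding circuit_output_def ptrace_right_def Let_def M'_def run_def rs by simp
  also have "\<dots> = (\<Sum>a<4. \<Sum>d<?C. M' $$ (s*(?C*4)+(d*4+a), s'*(?C*4)+(d*4+a)))"
    unfolding sum_lessThan_mult by (rule sum.swap)
  also have "\<dots> = (\<Sum>a<4. ?r $$ (s,s') * (anc a * anc a))"
  proof (intro sum.cong refl)
    fix a :: nat assume a: "a \<in> {..<4}"
    have e: "((u * 2^(n*q) + d) * 2^((n-n)*q) + 0) * 4 + a = u*(?C*4)+(d*4+a)" for u d by (simp add: algebra_simps)
    have "(\<Sum>d<?C. M' $$ (s*(?C*4)+(d*4+a), s'*(?C*4)+(d*4+a))) = ?r $$ (s,s') * kpow \<sigma> (n-n) $$ (0,0) * (anc a * anc a)"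
      using tracedD[OF T, of s s' 0 0 a a] s a unfolding e by (simp add: power_add)
    then show "(\<Sum>d<?C. M' $$ (s*(?C*4)+(d*4+a), s'*(?C*4)+(d*4+a))) = ?r $$ (s,s') * (anc a * anc a)" by simp
  qed
  also have "\<dots> = ?r $$ (s,s')"
  proof -
    have "(\<Sum>a<4. anc a * anc a) = 1"
      by (simp add: anc_def eval_nat_numeral of_real_mult[symmetric] del: of_real_mult)
    then show ?thesis by (simp add: sum_distrib_left[symmetric])
  qed
  finally show "?L $$ (s,s') = ?r $$ (s,s')" .
qed

text \<open>Copies and ancillas are discarded untouched, and together they have trace 1.\<close>

lemma circuit_output_Nil:
  assumes S: "\<sigma> \<in> carrier_mat (2^q) (2^q)" "mtrace \<sigma> = 1" and R: "\<rho> \<in> carrier_mat (2^k) (2^k)"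
  shows "circuit_output k (n*q+m) [] (kron \<rho> (kron (kpow \<sigma> n) (ket0_proj m))) = \<rho>" (is "?L = _")
proof -
  let ?K = "kron (kpow \<sigma> n) (ket0_proj m)"
  have K: "?K \<in> carrier_mat (2^(n*q+m)) (2^(n*q+m))"
    unfolding power_add by (rule kron_carrier[OF kpow_carrier[OF S(1)] ket0_carrier])
  have "mtrace ?K = 1"
    by (simp add: mtrace_kron[OF kpow_carrier[OF S(1)] ket0_carrier] mtrace_kpow[OF S] mtrace_ket0)
  then have t: "(\<Sum>i<2^(n*q+m). ?K $$ (i,i)) = 1" unfolding mtrace_def using K by auto
  have c: "kron \<rho> ?K \<in> carrier_mat (2^(k+(n*q+m))) (2^(k+(n*q+m)))"
    using kron_carrier[OF R K] by (simp add: power_add)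
  show ?thesis
  proof (rule eq_matI)
    fix i j assume "i < dim_row \<rho>" "j < dim_col \<rho>"
    then have ij: "i < 2^k" "j < 2^k" using R by auto
    have "?L $$ (i,j) = (\<Sum>l<2^(n*q+m). kron \<rho> ?K $$ (i*2^(n*q+m)+l, j*2^(n*q+m)+l))"
      unfolding circuit_output_def Let_def ptrace_right_def circuit_mat.simps adj_one
        one_mult_square(1)[OF c] one_mult_square(2)[OF c] using ij by simp
    also have "\<dots> = (\<Sum>l<2^(n*q+m). \<rho> $$ (i,j) * ?K $$ (l,l))"
      by (intro sum.cong refl kron_index[OF R K] ij) auto
    also have "\<dots> = \<rho> $$ (i,j)" by (simp only: sum_distrib_left[symmetric] t mult_1_right)
    finally show "?L $$ (i,j) = \<rho> $$ (i,j)" .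
  qed (use R in \<open>auto simp: circuit_output_def Let_def ptrace_right_def\<close>)
qed

section \<open>Well-formedness and size of the circuit\<close>

lemma unitary_2I:
  assumes "U \<in> carrier_mat 2 2"
    "\<And>i j. i < 2 \<Longrightarrow> j < 2 \<Longrightarrow> cnj (U $$ (0,i)) * U $$ (0,j) + cnj (U $$ (1,i)) * U $$ (1,j) = (if i = j then 1 else 0)"
  shows "unitary_mat 2 U"
  unfolding unitary_mat_def
proof (intro conjI assms(1) eq_matI)
  fix i j assume "i < dim_row (1\<^sub>m 2 :: complex mat)" "j < dim_col (1\<^sub>m 2 :: complex mat)"
  then have ij: "i < 2" "j < 2" by auto
  have "(adj U * U) $$ (i,j) = (\<Sum>k<2. adj U $$ (i,k) * U $$ (k,j))"
    using ij assms(1) by (intro mult_mat_index[of _ 2 2]) auto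
  then show "(adj U * U) $$ (i,j) = 1\<^sub>m 2 $$ (i,j)"
    using ij assms by (simp add: numeral_2_eq_2 del: index_mult_mat(1))
qed (use assms(1) in auto)

lemma unitary_hadamard: "unitary_mat 2 hadamard"
proof (rule unitary_2I)
  have "complex_of_real (1 / sqrt 2) * complex_of_real (1 / sqrt 2) = 1/2"
    by (simp only: of_real_mult[symmetric]) simp
  then have s: "2 * (complex_of_real (1 / sqrt 2) * complex_of_real (1 / sqrt 2)) = 1"
    by (simp only:) simp
  show "cnj (hadamard $$ (0,i)) * hadamard $$ (0,j) + cnj (hadamard $$ (1,i)) * hadamard $$ (1,j) = (if i = j then 1 else 0)"
    if "i < 2" "j < 2" for i j
    using that s by (auto simp: hadamard_def less_2_cases_iff simp del: of_real_divide)
qed (simp add: hadamard_def)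

text \<open>System and copies end before qubit N - 2, so the ancillas are never swap targets; a
  control qubit, if present, precedes the system.\<close>

lemma wf_dme_circuit:
  assumes "b \<le> 1"
  shows "wf_circuit ((b + q) + (n*q+2)) (dme_circuit b q n \<delta> n)"
proof -
  let ?N = "(b + q) + (n*q+2)"
  have X: "unitary_mat 2 pauliX" by (rule unitary_2I) (auto simp: pauliX_def less_2_cases_iff)
  have P: "unitary_mat 2 (phase0 \<delta>)"
    by (rule unitary_2I) (auto simp: phase0_def less_2_cases_iff cis_conv_exp[symmetric] cis_cnj cis_mult)
  have c2: "(complex_of_real (cos \<delta>))\<^sup>2 + (complex_of_real (sin \<delta>))\<^sup>2 = 1"
    by (metis of_real_add of_real_power of_real_1 sin_cos_squared_add2)
  have Rx: "unitary_mat 2 (rotX \<delta>)"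
    by (rule unitary_2I) (use c2 in \<open>auto simp: rotX_def less_2_cases_iff power2_eq_square algebra_simps\<close>)
  have "wf_gate ?N g" if g: "g \<in> set (dme_circuit b q n \<delta> n)" for g
  proof -
    have jn: "b + q + j*q + q \<le> ?N - 2" if "j < n" for j
    proof -
      have "Suc j * q \<le> n * q" using that by (intro mult_right_mono) auto
      then show ?thesis by simp
    qed
    from g consider "g \<in> set (prep ?N)" | j where "j < n" "g \<in> set (step_circuit ?N (ctrl_pos b ?N) b (b + q + j*q) q \<delta>)"
      by (auto simp: dme_circuit_def Let_def)
    then show ?thesis
    proof cases
      case 1
      then show ?thesis using unitary_hadamard X by (auto simp: prep_def)
    next
      case 2
      then consider "g = Gate1 (rotX \<delta>) (?N - 1)" | "g = Gate1 (phase0 \<delta>) (ctrl_pos b ?N)"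
        | i where "i < q" "g = CFredkin (ctrl_pos b ?N) (?N-1) (b + i) (b + q + j*q + i)"
        by (auto simp: step_circuit_def copy_swap_def)
      then show ?thesis
      proof cases
        case 1
        then show ?thesis using Rx by simp
      next
        case 2
        then show ?thesis using P by (simp add: ctrl_pos_def)
      next
        case 3
        have "b + q + j*q + i < ?N - 2" "b + i < ?N - 2" using jn[OF \<open>j < n\<close>] 3(1) by auto
        then show ?thesis using 3 assms by (auto simp: ctrl_pos_def)
      qed
    qed
  qed
  then show ?thesis by (simp add: wf_circuit_def list_all_iff)
qed

lemma length_dme_circuit: "length (dme_circuit b q n \<delta> j) = 2 + j * (2*q+2)"
  by (induction j) (simp_all add: dme_circuit_Suc step_circuit_def copy_swap_def, simp add: dme_circuit_def prep_def)

text \<open>The error bound degenerates to a constant when \<open>n = 1\<close> or \<open>t\<^sup>2 > n\<close>, so the empty circuit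
  suffices there; for \<open>n = 1\<close> it is forced, as \<open>ln 1 = 0\<close>.\<close>
lemma dme_exists:
  fixes b q n :: nat and t :: real
  assumes b: "b \<le> 1" and q: "1 \<le> q" and n: "1 \<le> n" and C: "17 * exp 17 + 12 \<le> C"
  shows "\<exists>m gs. wf_circuit ((b + q) + n*q + m) gs \<and>
     real (length gs) \<le> C * real q * real n * ln (real n) \<and>
     (\<forall>\<sigma> \<rho>. density (2^q) \<sigma> \<longrightarrow> density (2^(b + q)) \<rho> \<longrightarrow>
       (let W = ctl (2^b) (2^q) 1 (mat_exp ((- \<i> * complex_of_real t) \<cdot>\<^sub>m \<sigma>)) in
        trace_dist (circuit_output (b + q) (n*q+m) gs (kron \<rho> (kron (kpow \<sigma> n) (ket0_proj m)))) (W * \<rho> * adj W)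
          \<le> C * (t\<^sup>2 + 1) / real n))"
proof -
  have C0: "0 < C" "1 \<le> C" "12 \<le> C" using C exp_gt_zero[of "17::real"] by linarith+
  have sig: "\<sigma> \<in> carrier_mat (2^q) (2^q)" "mtrace \<sigma> = 1" if "density (2^q) \<sigma>" for \<sigma>
    using that by (auto simp: density_def psd_def)
  have dens: "tr_bound (2^b * 2^q) \<rho> 1" if "density (2^(b+q)) \<rho>" for \<rho>
    using tr_bound_density[OF that] by (simp add: power_add)
  have exp_evolution: "mat_exp ((- \<i> * complex_of_real t) \<cdot>\<^sub>m \<sigma>) = evolution D U p t"
    if "U \<in> carrier_mat D D" "adj U * U = 1\<^sub>m D" "\<sigma> = U * diag D (\<lambda>i. complex_of_real (p i)) * adj U" for D U p \<sigma>
    unfolding that(3) mat_exp_conj_diag[OF that(1,2) unitary_left_right[OF that(1,2)]] evolution_def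
    by (simp add: mult.assoc)
  show ?thesis
  proof (cases "n = 1 \<or> real n < t\<^sup>2")
    case True
    have "1 \<le> (t\<^sup>2 + 1) / real n" using True n by auto
    then have bd: "1 \<le> C * (t\<^sup>2 + 1) / real n" using C0 mult_mono[of 1 C 1 "(t\<^sup>2 + 1) / real n"] by simp
    show ?thesis
    proof (intro exI[of _ 0] exI[of _ "[]"] conjI allI impI)
      show "wf_circuit (b + q + n*q + 0) []" by (simp add: wf_circuit_def)
      show "real (length ([]::gate list)) \<le> C * real q * real n * ln (real n)" using C0 n by simp
      fix \<sigma> \<rho> assume d: "density (2^q) \<sigma>" "density (2^(b+q)) \<rho>"
      obtain U p where U: "U \<in> carrier_mat (2^q) (2^q)" "adj U * U = 1\<^sub>m (2^q)"
        "\<sigma> = U * diag (2^q) (\<lambda>i. complex_of_real (p i)) * adj U"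
        by (rule density_spectral[OF d(1)]) blast
      define W where "W = ctl (2^b) (2^q) 1 (mat_exp ((- \<i> * complex_of_real t) \<cdot>\<^sub>m \<sigma>))"
      have oW: "op_bound (2^b * 2^q) W 1" unfolding W_def exp_evolution[OF U] by (rule op_bound_ctl_evolution[OF U(1,2)])
      \<comment> \<open>Two matrices of trace norm at most 1 differ by at most 2, and the factor 1/2
        in \<open>trace_dist\<close> leaves 1.\<close>
      have "tr_bound (2^b * 2^q) (\<rho> - W * \<rho> * adj W) (1 + 1 * (1 * 1))"
        by (intro tr_bound_diff tr_bound_right[OF op_bound_adj] tr_bound_left oW dens d)
      then have "trace_dist \<rho> (W * \<rho> * adj W) \<le> 1" using trace_norm_le by (fastforce simp: trace_dist_def)
      moreover have "\<rho> \<in> carrier_mat (2^(b+q)) (2^(b+q))" using d(2) by (simp add: density_def psd_def)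
      ultimately show "let W = ctl (2^b) (2^q) 1 (mat_exp ((- \<i> * complex_of_real t) \<cdot>\<^sub>m \<sigma>)) in
        trace_dist (circuit_output (b + q) (n*q+0) [] (kron \<rho> (kron (kpow \<sigma> n) (ket0_proj 0)))) (W * \<rho> * adj W)
          \<le> C * (t\<^sup>2 + 1) / real n"
        unfolding Let_def W_def[symmetric] using bd circuit_output_Nil[OF sig[OF d(1)], of \<rho> "b+q" n 0] by simp
    qed
  next
    case False
    then have n_ge: "2 \<le> n" and t_le: "t\<^sup>2 \<le> real n" using n by auto
    define \<delta> where "\<delta> = t / real n"
    have nd: "real n * \<delta> = t" and nd2: "real n * \<delta>\<^sup>2 = t\<^sup>2 / real n" using n_ge by (simp_all add: \<delta>_def power2_eq_square)
    have t1: "t\<^sup>2 / real n \<le> 1" using t_le n_ge by simp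
    \<comment> \<open>The case distinction yields \<delta>^2 \<le> n \<delta>^2 = t^2 / n \<le> 1,
      as the single-step estimate requires.\<close>
    have "1 * \<delta>\<^sup>2 \<le> real n * \<delta>\<^sup>2" using n_ge by (intro mult_right_mono) auto
    then have d1: "\<bar>\<delta>\<bar> \<le> 1" using nd2 t1 by (simp add: abs_square_le_1[symmetric])
    show ?thesis
    proof (intro exI[of _ 2] exI[of _ "dme_circuit b q n \<delta> n"] conjI allI impI)
      show "wf_circuit (b + q + n*q + 2) (dme_circuit b q n \<delta> n)"
        using wf_dme_circuit[OF b, of q n \<delta>] by (simp add: add.assoc)
      \<comment> \<open>Since exp (1/2) \<le> 2, the logarithm is at least 1/2 from n = 2 on. With
        at most 6 q n gates, this is where the summand 12 in the constant comes from.\<close>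
      have ln: "1/2 \<le> ln (real n)"
        using exp_half_le2 n_ge by (subst ln_ge_iff) linarith+
      have "real (length (dme_circuit b q n \<delta> n)) \<le> 6 * (real q * real n)"
      proof -
        have "1 * n \<le> q * n" using q by (intro mult_right_mono) auto
        moreover have "length (dme_circuit b q n \<delta> n) = 2 + 2 * (q * n) + 2 * n"
          by (simp add: length_dme_circuit algebra_simps)
        ultimately have "length (dme_circuit b q n \<delta> n) \<le> 6 * (q * n)"
          using n_ge by linarith
        then show ?thesis by (metis of_nat_le_iff of_nat_mult of_nat_numeral)
      qed
      moreover have "6 * (real q * real n) \<le> (C * ln (real n)) * (real q * real n)"
      proof (rule mult_right_mono)
        have "12 * (1/2) \<le> C * ln (real n)" using C0 ln by (intro mult_mono) auto
        then show "6 \<le> C * ln (real n)" by simp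
      qed simp
      ultimately show "real (length (dme_circuit b q n \<delta> n)) \<le> C * real q * real n * ln (real n)"
        by (simp add: mult_ac)
      fix \<sigma> \<rho> assume d: "density (2^q) \<sigma>" "density (2^(b+q)) \<rho>"
      obtain U p where U: "U \<in> carrier_mat (2^q) (2^q)" "adj U * U = 1\<^sub>m (2^q)"
        "\<sigma> = U * diag (2^q) (\<lambda>i. complex_of_real (p i)) * adj U" and p: "\<And>i. i < 2^q \<Longrightarrow> 0 \<le> p i \<and> p i \<le> 1"
        by (rule density_spectral[OF d(1)]) blast
      define W where "W = ctl (2^b) (2^q) 1 (mat_exp ((- \<i> * complex_of_real t) \<cdot>\<^sub>m \<sigma>))"
      define out where "out = (swap_channel (2^b) (2^q) \<sigma> (amp0 (2^b) \<delta>) (amp1 (2^b) \<delta>) ^^ n) \<rho>"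
      have "tr_bound (2^b * 2^q) (out - W * \<rho> * adj W) ((1 + 17 * \<delta>\<^sup>2) ^ n - 1)"
        using swap_channel_iterate_bound[OF U(1,2) unitary_left_right[OF U(1,2)] p U(3) tr_bound_density[OF d(1)] d1 _ dens[OF d(2)], of n]
        unfolding nd out_def W_def exp_evolution[OF U] by simp
      then have "trace_norm (out - W * \<rho> * adj W) \<le> (1 + 17 * \<delta>\<^sup>2) ^ n - 1" by (rule trace_norm_le)
      \<comment> \<open>The power is at most exp (17 y) with y = t^2 / n \<le> 1, and exp x - 1
        \<le> x exp x makes the bound linear in y at the cost of the factor exp 17.\<close>
      also have "\<dots> \<le> 17 * exp 17 * (t\<^sup>2 / real n)"
      proof -
        define y where "y = t\<^sup>2 / real n"
        have y: "0 \<le> y" "y \<le> 1" using t1 by (simp_all add: y_def)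
        have "(1 + 17 * \<delta>\<^sup>2) ^ n \<le> exp (17 * \<delta>\<^sup>2) ^ n"
          by (intro power_mono) (simp_all add: add.commute exp_ge_add_one_self_aux)
        also have "\<dots> = exp (17 * y)" unfolding y_def nd2[symmetric] by (simp add: exp_of_nat_mult[symmetric] mult_ac)
        also have "exp (17 * y) - 1 \<le> 17 * y * exp (17 * y)"
        proof -
          have "1 - 17 * y \<le> exp (- (17 * y))" using exp_ge_add_one_self[of "- (17 * y)"] by simp
          then have "(1 - 17 * y) * exp (17 * y) \<le> exp (- (17 * y)) * exp (17 * y)" by (intro mult_right_mono) auto
          also have "\<dots> = 1" by (simp add: exp_add[symmetric])
          finally show ?thesis by (simp add: algebra_simps)
        qed
        then have "exp (17 * y) \<le> 17 * y * exp (17 * y) + 1" by simp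
        also have "17 * y * exp (17 * y) \<le> 17 * y * exp 17" using y by (intro mult_left_mono) auto
        finally show ?thesis unfolding y_def by (simp add: mult_ac)
      qed
      also have "\<dots> \<le> C * ((t\<^sup>2 + 1) / real n)"
        using C C0 by (intro mult_mono divide_right_mono) auto
      finally have fin: "trace_norm (out - W * \<rho> * adj W) \<le> C * ((t\<^sup>2 + 1) / real n)" .
      have pos: "0 \<le> C * ((t\<^sup>2 + 1) / real n)" using C0 by (intro mult_nonneg_nonneg divide_nonneg_nonneg) auto
      have td: "trace_dist out (W * \<rho> * adj W) \<le> C * (t\<^sup>2 + 1) / real n"
        using fin pos unfolding trace_dist_def times_divide_eq_right by linarith
      have rc: "\<rho> \<in> carrier_mat (2^(b+q)) (2^(b+q))" using d(2) by (simp add: density_def psd_def)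
      show "let W = ctl (2^b) (2^q) 1 (mat_exp ((- \<i> * complex_of_real t) \<cdot>\<^sub>m \<sigma>)) in
        trace_dist (circuit_output (b + q) (n*q+2) (dme_circuit b q n \<delta> n) (kron \<rho> (kron (kpow \<sigma> n) (ket0_proj 2)))) (W * \<rho> * adj W)
          \<le> C * (t\<^sup>2 + 1) / real n"
        unfolding Let_def W_def[symmetric] circuit_output_dme[OF b sig[OF d(1)] rc] by (rule td[unfolded out_def])
    qed
  qed
qed

lemma mat_exp_carrier: "A \<in> carrier_mat d d \<Longrightarrow> mat_exp A \<in> carrier_mat d d"
  by (auto simp: mat_exp_def)

lemma ctl_1: "V \<in> carrier_mat D D \<Longrightarrow> ctl 1 D 1 V = V"
  by (intro eq_matI) (auto simp: ctl_def)

lemma ctl_2: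
  assumes V: "V \<in> carrier_mat D D"
  shows "ctl 2 D 1 V = kron (1\<^sub>m 2 - proj1) (1\<^sub>m D) + kron proj1 V"
proof (rule eq_mat_blockI)
  have c: "1\<^sub>m 2 - proj1 \<in> carrier_mat 2 2" "proj1 \<in> carrier_mat 2 2" "1\<^sub>m D \<in> carrier_mat D D"
    by (auto simp: proj1_def)
  show "ctl 2 D 1 V \<in> carrier_mat (2*D) (2*D)" by simp
  show kc: "kron (1\<^sub>m 2 - proj1) (1\<^sub>m D) + kron proj1 V \<in> carrier_mat (2*D) (2*D)"
    by (intro add_carrier_mat kron_carrier c V)
  fix b s b' s' :: nat assume b: "b < 2" "s < D" "b' < 2" "s' < D"
  have "(kron (1\<^sub>m 2 - proj1) (1\<^sub>m D) + kron proj1 V) $$ (b*D+s, b'*D+s')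
    = kron (1\<^sub>m 2 - proj1) (1\<^sub>m D) $$ (b*D+s, b'*D+s') + kron proj1 V $$ (b*D+s, b'*D+s')"
    using block_index_less[OF b(1,2)] block_index_less[OF b(3,4)] kron_carrier[OF c(2) V] by (intro index_add_mat) auto
  also have "\<dots> = (1\<^sub>m 2 - proj1) $$ (b,b') * 1\<^sub>m D $$ (s,s') + proj1 $$ (b,b') * V $$ (s,s')"
    by (simp only: kron_index[OF c(1,3) b(1,2,3,4)] kron_index[OF c(2) V b(1,2,3,4)])
  also have "\<dots> = ctl 2 D 1 V $$ (b*D+s, b'*D+s')"
    using b by (auto simp: ctl_index proj1_def less_2_cases_iff)
  finally show "ctl 2 D 1 V $$ (b*D+s, b'*D+s') = (kron (1\<^sub>m 2 - proj1) (1\<^sub>m D) + kron proj1 V) $$ (b*D+s, b'*D+s')" ..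
qed

text \<open>The two claims are \<open>dme_exists\<close> with no control qubit and with one, the
  control being the leading qubit. In the constant, 17 exp 17 serves the error and 12 the number of
  gates.\<close>

theorem theorem3:
  shows "\<exists>C::real. C > 0 \<and>
    (\<forall>(q::nat) (n::nat) (t::real). q \<ge> 1 \<longrightarrow> n \<ge> 1 \<longrightarrow>
      (\<exists>(m::nat) gs.
         wf_circuit (q + n * q + m) gs \<and>
         real (length gs) \<le> C * real q * real n * ln (real n) \<and>
         (\<forall>\<sigma> \<rho>. density (2^q) \<sigma> \<longrightarrow> density (2^q) \<rho> \<longrightarrow>
            (let V = mat_exp ((- \<i> * complex_of_real t) \<cdot>\<^sub>m \<sigma>) in
             trace_dist
               (circuit_output q (n * q + m) gs (kron \<rho> (kron (kpow \<sigma> n) (ket0_proj m))))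
               (V * \<rho> * adj V)
             \<le> C * (t^2 + 1) / real n))) \<and>
      (\<exists>(m::nat) gs.
         wf_circuit ((q + 1) + n * q + m) gs \<and>
         real (length gs) \<le> C * real q * real n * ln (real n) \<and>
         (\<forall>\<sigma> \<rho>. density (2^q) \<sigma> \<longrightarrow> density (2^(q + 1)) \<rho> \<longrightarrow>
            (let W = kron (1\<^sub>m 2 - proj1) (1\<^sub>m (2^q))
                     + kron proj1 (mat_exp ((- \<i> * complex_of_real t) \<cdot>\<^sub>m \<sigma>)) in
             trace_dist
               (circuit_output (q + 1) (n * q + m) gs (kron \<rho> (kron (kpow \<sigma> n) (ket0_proj m))))
               (W * \<rho> * adj W)
             \<le> C * (t^2 + 1) / real n))))"
proof (intro exI[of _ "17 * exp 17 + 12"] conjI allI impI)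
  show "(0::real) < 17 * exp 17 + 12" using exp_gt_zero[of "17::real"] by linarith
next
  fix q n :: nat and t :: real
  assume q: "1 \<le> q" and n: "1 \<le> n"
  have m: "mat_exp ((- \<i> * complex_of_real t) \<cdot>\<^sub>m \<sigma>) \<in> carrier_mat (2^q) (2^q)" if "density (2^q) \<sigma>" for \<sigma>
    using that by (intro mat_exp_carrier) (simp add: density_def psd_def)
  show "\<exists>m gs. wf_circuit (q + n * q + m) gs \<and>
         real (length gs) \<le> (17 * exp 17 + 12) * real q * real n * ln (real n) \<and>
         (\<forall>\<sigma> \<rho>. density (2^q) \<sigma> \<longrightarrow> density (2^q) \<rho> \<longrightarrow>
            (let V = mat_exp ((- \<i> * complex_of_real t) \<cdot>\<^sub>m \<sigma>) in
             trace_dist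
               (circuit_output q (n * q + m) gs (kron \<rho> (kron (kpow \<sigma> n) (ket0_proj m))))
               (V * \<rho> * adj V)
             \<le> (17 * exp 17 + 12) * (t^2 + 1) / real n))"
    using dme_exists[of 0 q n "17 * exp 17 + 12" t] q n m by (simp add: ctl_1[unfolded One_nat_def] Let_def cong: conj_cong imp_cong)
  show "\<exists>m gs. wf_circuit ((q + 1) + n * q + m) gs \<and>
         real (length gs) \<le> (17 * exp 17 + 12) * real q * real n * ln (real n) \<and>
         (\<forall>\<sigma> \<rho>. density (2^q) \<sigma> \<longrightarrow> density (2^(q + 1)) \<rho> \<longrightarrow>
            (let W = kron (1\<^sub>m 2 - proj1) (1\<^sub>m (2^q))
                     + kron proj1 (mat_exp ((- \<i> * complex_of_real t) \<cdot>\<^sub>m \<sigma>)) in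
             trace_dist
               (circuit_output (q + 1) (n * q + m) gs (kron \<rho> (kron (kpow \<sigma> n) (ket0_proj m))))
               (W * \<rho> * adj W)
             \<le> (17 * exp 17 + 12) * (t^2 + 1) / real n))"
    using dme_exists[OF order_refl q n order_refl, of t]
    unfolding add.commute[of 1 q] power_one_right Let_def by (metis (no_types, lifting) ctl_2 m)
qed

end
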